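(* Let $\varphi\in C_b^2(\mathbb R^N;\mathbb R)$. For any $p\ge2$ there exists a constant $C>0$, independent of $\ell$, such that for every level $1\le\ell\le L$ $$\mathbb E\bigl[\,\bigl|\mathcal P^\varphi_{f,\ell}-\mathcal P^\varphi_{c,\ell-1}\bigr|^p\,\bigr]\le C\,\Delta_{\ell-1}^p .$$
   Context: **SDE.** Let $T>0$ be real, $d\ge1$, $N_S\ge 0$, $N_R\ge 1$ integers, $N=N_S+N_R$, $x\in\mathbb{R}^N$. $B=(B^1,\dots,B^d)$ is a standard $d$-dimensional Brownian motion on $(\Omega,\mathcal F,\{\mathcal F_t\}_{t\ge0},\mathbb P)$, and $\widetilde B=(\widetilde B^2,\dots,\widetilde B^d)$ is a standard $(d-1)$-dimensional Brownian motion independent of $B$; both are adapted to $\{\mathcal F_t\}$ with increments after time $t$ independent of $\mathcal F_t$. The underlying Itô SDE is $dX_t=\sigma_0(X_t)\,dt+\sum_{1\le j\le d}\sigma_j(X_t)\,dB_t^j$, $X_0=x$, where $\sigma_0=[\sigma_{S,0}^\top,\sigma_{R,0}^\top]^\top$, $\sigma_j=[\mathbf 0_{N_S}^\top,\sigma_{R,j}^\top]^\top$ for $1\le j\le d$, with $\sigma_{S,0}:\mathbb R^N\to\mathbb R^{N_S}$, $\sigma_{R,j}:\mathbb R^N\to\mathbb R^{N_R}$. **Operators.** $\mathcal L_0\varphi=\sum_k\sigma_0^k\partial_{x_k}\varphi+\frac12\sum_{1\le j\le d}\sum_{k_1,k_2}\sigma_j^{k_1}\sigma_j^{k_2}\partial_{x_{k_1}}\partial_{x_{k_2}}\varphi$,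 $\mathcal L_i\varphi=\sum_k\sigma_i^k\partial_{x_k}\varphi$ for $1\le i\le d$, acting componentwise on vector-valued functions. For $1\le i_1,i_2\le d$, $[\sigma_{i_1},\sigma_{i_2}]=\mathcal L_{i_1}\sigma_{i_2}-\mathcal L_{i_2}\sigma_{i_1}$. For $1\le j\le d$, $[\sigma_0,\sigma_j]=\sum_k\{\widetilde\sigma_0^k\partial_{x_k}\sigma_j-\sigma_j^k\partial_{x_k}\widetilde\sigma_0\}$ where $\widetilde\sigma_0=\sigma_0-\frac12\sum_{1\le i\le N}\sum_{1\le j\le d}\sigma_j^i\partial_i\sigma_j$. **Standing assumptions.** (1) $\sigma_j\in C_b^\infty(\mathbb R^N;\mathbb R^N)$, $0\le j\le d$, where $C_b^K(\mathbb R^n;\mathbb R^m)$ is the space of $K$-times differentiable functions whose partial derivatives up to order $K$ are bounded. (2) If $N_S=0$: $\mathrm{Span}\{\sigma_1(z),\dots,\sigma_d(z)\}=\mathbb R^N$ for all $z\in\mathbb R^N$. If $N_S\ge1$: for all $z\in\mathbb R^N$, $\mathrm{Span}\{\sigma_{R,1}(z),\dots,\sigma_{R,d}(z)\}=\mathbb R^{N_R}$ and $\mathrm{Span}\{\sigma_1(z),\dots,\sigma_d(z),[\sigma_0,\sigma_1](z),\dots,[\sigma_0,\sigma_d](z)\}=\mathbb R^N$. **Random variables.** For $0\le s\le t$: $\Delta B^j_{t,s}=B^j_t-B^j_s$ ($1\le j\le d$), $\Delta B^0_{t,s}=t-s$, $\Delta\widetilde B^j_{t,s}=\widetilde B^j_t-\widetilde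 B^j_s$, $\Delta\widetilde A^{j_1j_2}_{t,s}=\Delta B^{j_1}_{t,s}\Delta\widetilde B^{j_2}_{t,s}$ ($1\le j_1<j_2\le d$). If $N_S=0$, $\Delta\eta^{j_1j_2}_{t,s}=\frac12(\Delta B^{j_1}_{t,s}\Delta B^{j_2}_{t,s}-(t-s)\mathbf 1_{j_1=j_2\ne0})$ for all $0\le j_1,j_2\le d$. If $N_S\ge1$, the same formula is used when $1\le j_1,j_2\le d$ or $j_1=j_2=0$, while $\Delta\eta^{0j_2}_{t,s}=\int_s^t\int_s^{v}du\,dB^{j_2}_v$ ($1\le j_2\le d$) and $\Delta\eta^{j_10}_{t,s}=\int_s^t\int_s^v dB^{j_1}_u\,dv$ ($1\le j_1\le d$). **Integrators.** For $z\in\mathbb R^N$, $$\overline{\mathcal I}_{t,s}(z)=z+\sum_{0\le j\le d}\sigma_j(z)\Delta B^j_{t,s}+\sum_{0\le j_1,j_2\le d}\mathcal L_{j_1}\sigma_{j_2}(z)\Delta\eta^{j_1j_2}_{t,s}+\tfrac12\sum_{1\le j_1<j_2\le d}[\sigma_{j_1},\sigma_{j_2}](z)\Delta\widetilde A^{j_1j_2}_{t,s},$$ and $\widetilde{\mathcal I}_{t,s}(z)$ is the same expression with the sign of the last term changed to minus. **Schemes.** $L\in\mathbb N$, $\Delta_\ell=T/2^\ell$. For $1\le\ell\le L$: $t_k=k\Delta_{\ell-1}$, $t_{k+1/2}=(k+\frac12)\Delta_{\ell-1}$. All schemes start at $x$ at time $t_0=0$, and for $0\le k\le2^{\ell-1}-1$: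 coarse: $\bar X^{c,[\ell-1]}_{t_{k+1}}=\overline{\mathcal I}_{t_{k+1},t_k}(\bar X^{c,[\ell-1]}_{t_k})$; antithetic coarse: $\widetilde X^{c,[\ell-1]}_{t_{k+1}}=\widetilde{\mathcal I}_{t_{k+1},t_k}(\widetilde X^{c,[\ell-1]}_{t_k})$; fine: $\bar X^{f,[\ell]}_{t_{k+1/2}}=\overline{\mathcal I}_{t_{k+1/2},t_k}(\bar X^{f,[\ell]}_{t_k})$, $\bar X^{f,[\ell]}_{t_{k+1}}=\overline{\mathcal I}_{t_{k+1},t_{k+1/2}}(\bar X^{f,[\ell]}_{t_{k+1/2}})$; antithetic fine: $\widetilde X^{f,[\ell]}_{t_{k+1/2}}=\widetilde{\mathcal I}_{t_{k+1},t_{k+1/2}}(\widetilde X^{f,[\ell]}_{t_k})$, $\widetilde X^{f,[\ell]}_{t_{k+1}}=\widetilde{\mathcal I}_{t_{k+1/2},t_k}(\widetilde X^{f,[\ell]}_{t_{k+1/2}})$. **Couplings.** $\mathcal P^\varphi_{f,\ell}=\frac12(\varphi(\bar X^{f,[\ell]}_T)+\varphi(\widetilde X^{f,[\ell]}_T))$, $\mathcal P^\varphi_{c,\ell-1}=\frac12(\varphi(\bar X^{c,[\ell-1]}_T)+\varphi(\widetilde X^{c,[\ell-1]}_T))$. *)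

theory Defs
  imports "HOL-Probability.Probability"
begin

section \<open>Differential operators\<close>

definition pderiv_at :: "'n::finite \<Rightarrow> (real^'n \<Rightarrow> 'b::real_normed_vector) \<Rightarrow> real^'n \<Rightarrow> 'b"
  where "pderiv_at k f z = frechet_derivative f (at z) (axis k 1)"

text \<open>
  The class of \<open>K\<close>-times differentiable functions, all of whose partial derivatives of order
  \<open>0, \<dots>, K\<close> (the function itself included) are bounded. Continuity of the derivatives of top
  order is not demanded.
\<close>

primrec Cb :: "nat \<Rightarrow> (real^'n::finite \<Rightarrow> 'b::real_normed_vector) \<Rightarrow> bool" where
  "Cb 0 f \<longleftrightarrow> bounded (range f)"
| "Cb (Suc K) f \<longleftrightarrow>
     bounded (range f) \<and> (\<forall>z. f differentiable (at z)) \<and> (\<forall>k. Cb K (pderiv_at k f))"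

definition Cb_inf :: "(real^'n::finite \<Rightarrow> 'b::real_normed_vector) \<Rightarrow> bool"
  where "Cb_inf f \<longleftrightarrow> (\<forall>K. Cb K f)"

text \<open>
  The coefficients are a family \<open>\<sigma> 0, \<dots>, \<sigma> d\<close> of vector fields: \<open>\<sigma> 0\<close> is the (Ito) drift,
  \<open>\<sigma> 1, \<dots>, \<sigma> d\<close> are the diffusion coefficients. Values at indices above \<open>d\<close> are never used.
\<close>

definition lie_op ::
  "nat \<Rightarrow> (nat \<Rightarrow> real^'n::finite \<Rightarrow> real^'n) \<Rightarrow> nat \<Rightarrow> (real^'n \<Rightarrow> 'b::real_normed_vector) \<Rightarrow> real^'n \<Rightarrow> 'b"
  where "lie_op d \<sigma> i f z =
    (if i = 0 then
       (\<Sum>k\<in>UNIV. (\<sigma> 0 z $ k) *\<^sub>R pderiv_at k f z)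
       + (1/2) *\<^sub>R (\<Sum>j=1..d. \<Sum>k1\<in>UNIV. \<Sum>k2\<in>UNIV.
           (\<sigma> j z $ k1 * \<sigma> j z $ k2) *\<^sub>R pderiv_at k1 (pderiv_at k2 f) z)
     else (\<Sum>k\<in>UNIV. (\<sigma> i z $ k) *\<^sub>R pderiv_at k f z))"

text \<open>The bracket of two diffusion fields (\<open>i1, i2 \<ge> 1\<close>).\<close>

definition lie_bracket ::
  "nat \<Rightarrow> (nat \<Rightarrow> real^'n::finite \<Rightarrow> real^'n) \<Rightarrow> nat \<Rightarrow> nat \<Rightarrow> real^'n \<Rightarrow> real^'n"
  where "lie_bracket d \<sigma> i1 i2 z = lie_op d \<sigma> i1 (\<sigma> i2) z - lie_op d \<sigma> i2 (\<sigma> i1) z"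

definition strat_drift ::
  "nat \<Rightarrow> (nat \<Rightarrow> real^'n::finite \<Rightarrow> real^'n) \<Rightarrow> real^'n \<Rightarrow> real^'n"
  where "strat_drift d \<sigma> z =
    \<sigma> 0 z - (1/2) *\<^sub>R (\<Sum>i\<in>UNIV. \<Sum>j=1..d. (\<sigma> j z $ i) *\<^sub>R pderiv_at i (\<sigma> j) z)"

text \<open>The bracket of the drift with \<open>\<sigma> j\<close>; it uses the Stratonovich drift, not \<open>\<sigma> 0\<close>.\<close>

definition drift_bracket ::
  "nat \<Rightarrow> (nat \<Rightarrow> real^'n::finite \<Rightarrow> real^'n) \<Rightarrow> nat \<Rightarrow> real^'n \<Rightarrow> real^'n"
  where "drift_bracket d \<sigma> j z =
    (\<Sum>k\<in>UNIV. (strat_drift d \<sigma> z $ k) *\<^sub>R pderiv_at k (\<sigma> j) z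
             - (\<sigma> j z $ k) *\<^sub>R pderiv_at k (strat_drift d \<sigma>) z)"

text \<open>
  \<open>S\<close> is the set of coordinates of the block without noise, its complement the set of coordinates
  of the noisy block. The projection onto the latter is written with zero entries
  on \<open>S\<close>, so that the noisy block \<open>R^(N_R)\<close> is the subspace of vectors vanishing on \<open>S\<close>.
\<close>

definition proj_R :: "'n::finite set \<Rightarrow> real^'n \<Rightarrow> real^'n"
  where "proj_R S v = (\<chi> i. if i \<in> S then 0 else v $ i)"

definition span_condition ::
  "'n::finite set \<Rightarrow> nat \<Rightarrow> (nat \<Rightarrow> real^'n \<Rightarrow> real^'n) \<Rightarrow> bool"
  where "span_condition S d \<sigma> \<longleftrightarrow>
    (if S = {} then \<forall>z. span ((\<lambda>j. \<sigma> j z) ` {1..d}) = UNIV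
     else \<forall>z. span ((\<lambda>j. proj_R S (\<sigma> j z)) ` {1..d}) = {v. \<forall>i\<in>S. v $ i = 0}
            \<and> span ((\<lambda>j. \<sigma> j z) ` {1..d} \<union> (\<lambda>j. drift_bracket d \<sigma> j z) ` {1..d}) = UNIV)"


section \<open>Filtrations, Brownian motion, Ito integrals\<close>

definition filtered :: "'w measure \<Rightarrow> (real \<Rightarrow> 'w measure) \<Rightarrow> bool"
  where "filtered M F \<longleftrightarrow>
    (\<forall>t\<ge>0. subalgebra M (F t)) \<and> (\<forall>s t. 0 \<le> s \<longrightarrow> s \<le> t \<longrightarrow> subalgebra (F t) (F s))"

text \<open>The events generated by a family \<open>X\<close> of real random variables indexed by \<open>I\<close>.\<close>

definition generated_events :: "'w measure \<Rightarrow> 'i set \<Rightarrow> ('i \<Rightarrow> 'w \<Rightarrow> real) \<Rightarrow> 'w set set"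
  where "generated_events M I X =
    sigma_sets (space M) {X i -` A \<inter> space M | i A. i \<in> I \<and> A \<in> sets borel}"

text \<open>
  \<open>(W j)\<close>, \<open>j \<in> J\<close>, is a standard \<open>card J\<close>-dimensional Brownian motion with respect to the
  filtration \<open>F\<close>. Time is restricted to \<open>[0, \<infinity>)\<close>; paths are continuous almost surely.
\<close>

definition brownian_motion ::
  "'w measure \<Rightarrow> (real \<Rightarrow> 'w measure) \<Rightarrow> nat set \<Rightarrow> (nat \<Rightarrow> real \<Rightarrow> 'w \<Rightarrow> real) \<Rightarrow> bool"
  where "brownian_motion M F J W \<longleftrightarrow>
    (\<forall>j\<in>J. \<forall>t\<ge>0. W j t \<in> borel_measurable (F t)) \<and>
    (\<forall>j\<in>J. AE \<omega> in M. W j 0 \<omega> = 0) \<and>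
    (\<forall>j\<in>J. AE \<omega> in M. continuous_on {0..} (\<lambda>t. W j t \<omega>)) \<and>
    (\<forall>j\<in>J. \<forall>s t. 0 \<le> s \<longrightarrow> s < t \<longrightarrow>
       distributed M lborel (\<lambda>\<omega>. W j t \<omega> - W j s \<omega>)
         (\<lambda>y. ennreal (normal_density 0 (sqrt (t - s)) y))) \<and>
    (\<forall>s t. 0 \<le> s \<longrightarrow> s < t \<longrightarrow>
       prob_space.indep_vars M (\<lambda>_. borel) (\<lambda>j \<omega>. W j t \<omega> - W j s \<omega>) J) \<and>
    (\<forall>s\<ge>0. prob_space.indep_set M (sets (F s))
       (generated_events M (J \<times> {s..}) (\<lambda>(j, u) \<omega>. W j u \<omega> - W j s \<omega>)))"

text \<open>
  Simple integrands on \<open>[s, t]\<close>: a list of triples \<open>(a, b, \<xi>)\<close> stands for the process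
  \<open>\<Sum> \<xi> 1_(a, b]\<close> with \<open>\<xi>\<close> bounded and \<open>F a\<close>-measurable.
\<close>

type_synonym 'w simple_process = "(real \<times> real \<times> ('w \<Rightarrow> real)) list"

definition simple_integrand ::
  "'w measure \<Rightarrow> (real \<Rightarrow> 'w measure) \<Rightarrow> real \<Rightarrow> real \<Rightarrow> 'w simple_process \<Rightarrow> bool"
  where "simple_integrand M F s t h \<longleftrightarrow>
    (\<forall>(a, b, \<xi>)\<in>set h. s \<le> a \<and> a \<le> b \<and> b \<le> t \<and> \<xi> \<in> borel_measurable (F a) \<and>
       (\<exists>K. \<forall>\<omega>\<in>space M. \<bar>\<xi> \<omega>\<bar> \<le> K))"

definition simple_value :: "'w simple_process \<Rightarrow> real \<Rightarrow> 'w \<Rightarrow> real"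
  where "simple_value h v \<omega> = (\<Sum>(a, b, \<xi>)\<leftarrow>h. \<xi> \<omega> * indicator {a<..b} v)"

definition simple_integral :: "(real \<Rightarrow> 'w \<Rightarrow> real) \<Rightarrow> 'w simple_process \<Rightarrow> 'w \<Rightarrow> real"
  where "simple_integral W h \<omega> = (\<Sum>(a, b, \<xi>)\<leftarrow>h. \<xi> \<omega> * (W b \<omega> - W a \<omega>))"

text \<open>
  \<open>I\<close> is a version of the Ito integral of \<open>H\<close> against the one-dimensional Brownian motion \<open>W\<close>
  over \<open>[s, t]\<close>: the \<open>L^2\<close>-limit of integrals of simple integrands that approximate \<open>H\<close> in
  \<open>L^2([s, t] \<times> M)\<close>. It is unique up to null sets, and \<open>ito_integral\<close> selects a version.
\<close>

definition is_ito_integral ::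
  "'w measure \<Rightarrow> (real \<Rightarrow> 'w measure) \<Rightarrow> (real \<Rightarrow> 'w \<Rightarrow> real) \<Rightarrow> (real \<Rightarrow> 'w \<Rightarrow> real) \<Rightarrow>
    real \<Rightarrow> real \<Rightarrow> ('w \<Rightarrow> real) \<Rightarrow> bool"
  where "is_ito_integral M F W H s t I \<longleftrightarrow>
    I \<in> borel_measurable M \<and>
    (\<exists>h. (\<forall>n. simple_integrand M F s t (h n)) \<and>
       (\<lambda>n::nat. \<integral>\<^sup>+\<omega>. (\<integral>\<^sup>+v\<in>{s..t}. ennreal ((simple_value (h n) v \<omega> - H v \<omega>)\<^sup>2) \<partial>lborel) \<partial>M)
         \<longlonglongrightarrow> 0 \<and>
       (\<lambda>n::nat. \<integral>\<^sup>+\<omega>. ennreal ((simple_integral W (h n) \<omega> - I \<omega>)\<^sup>2) \<partial>M) \<longlonglongrightarrow> 0)"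

definition ito_integral ::
  "'w measure \<Rightarrow> (real \<Rightarrow> 'w measure) \<Rightarrow> (real \<Rightarrow> 'w \<Rightarrow> real) \<Rightarrow> (real \<Rightarrow> 'w \<Rightarrow> real) \<Rightarrow>
    real \<Rightarrow> real \<Rightarrow> 'w \<Rightarrow> real"
  where "ito_integral M F W H s t = (SOME I. is_ito_integral M F W H s t I)"


section \<open>Increments and iterated integrals\<close>

text \<open>Following the index order of the increments, the later time \<open>t\<close> precedes the earlier time \<open>s\<close>.\<close>

definition incr :: "(nat \<Rightarrow> real \<Rightarrow> 'w \<Rightarrow> real) \<Rightarrow> nat \<Rightarrow> real \<Rightarrow> real \<Rightarrow> 'w \<Rightarrow> real"
  where "incr B j t s \<omega> = (if j = 0 then t - s else B j t \<omega> - B j s \<omega>)"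

definition area_incr ::
  "(nat \<Rightarrow> real \<Rightarrow> 'w \<Rightarrow> real) \<Rightarrow> (nat \<Rightarrow> real \<Rightarrow> 'w \<Rightarrow> real) \<Rightarrow> nat \<Rightarrow> nat \<Rightarrow> real \<Rightarrow> real \<Rightarrow> 'w \<Rightarrow> real"
  where "area_incr B Bt j1 j2 t s \<omega> = (B j1 t \<omega> - B j1 s \<omega>) * (Bt j2 t \<omega> - Bt j2 s \<omega>)"

definition eta_incr ::
  "'w measure \<Rightarrow> (real \<Rightarrow> 'w measure) \<Rightarrow> nat \<Rightarrow> (nat \<Rightarrow> real \<Rightarrow> 'w \<Rightarrow> real) \<Rightarrow>
    nat \<Rightarrow> nat \<Rightarrow> real \<Rightarrow> real \<Rightarrow> 'w \<Rightarrow> real"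
  where "eta_incr M F N\<^sub>S B j1 j2 t s \<omega> =
    (if 1 \<le> N\<^sub>S \<and> j1 = 0 \<and> 1 \<le> j2 then
       ito_integral M F (B j2) (\<lambda>v _. LBINT u:{s..v}. 1) s t \<omega>
     else if 1 \<le> N\<^sub>S \<and> 1 \<le> j1 \<and> j2 = 0 then
       (LBINT v:{s..t}. (B j1 v \<omega> - B j1 s \<omega>))
     else (1/2) * (incr B j1 t s \<omega> * incr B j2 t s \<omega>
                   - (if j1 = j2 \<and> j1 \<noteq> 0 then t - s else 0)))"


section \<open>Integrators and schemes\<close>

text \<open>
  One step from time \<open>s\<close> to time \<open>t\<close>. The sign \<open>\<theta>\<close> of the area term is \<open>1\<close> for the
  plain integrator and \<open>-1\<close> for the antithetic one.
\<close>

definition integrator ::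
  "real \<Rightarrow> 'w measure \<Rightarrow> (real \<Rightarrow> 'w measure) \<Rightarrow> nat \<Rightarrow> nat \<Rightarrow> (nat \<Rightarrow> real^'n::finite \<Rightarrow> real^'n) \<Rightarrow>
    (nat \<Rightarrow> real \<Rightarrow> 'w \<Rightarrow> real) \<Rightarrow> (nat \<Rightarrow> real \<Rightarrow> 'w \<Rightarrow> real) \<Rightarrow> 'w \<Rightarrow>
    real \<Rightarrow> real \<Rightarrow> real^'n \<Rightarrow> real^'n"
  where "integrator \<theta> M F N\<^sub>S d \<sigma> B Bt \<omega> t s z =
    z + (\<Sum>j=0..d. incr B j t s \<omega> *\<^sub>R \<sigma> j z)
      + (\<Sum>j1=0..d. \<Sum>j2=0..d. eta_incr M F N\<^sub>S B j1 j2 t s \<omega> *\<^sub>R lie_op d \<sigma> j1 (\<sigma> j2) z)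
      + (\<theta> / 2) *\<^sub>R (\<Sum>j2=1..d. \<Sum>j1=1..<j2. area_incr B Bt j1 j2 t s \<omega> *\<^sub>R lie_bracket d \<sigma> j1 j2 z)"

text \<open>
  The schemes, for a one-step map \<open>I t s z\<close> and coarse step size \<open>h\<close>, after \<open>k\<close> coarse steps.
  The antithetic fine scheme uses the driving noise of the two half steps in exchanged order.
\<close>

primrec coarse_scheme :: "(real \<Rightarrow> real \<Rightarrow> 'z \<Rightarrow> 'z) \<Rightarrow> real \<Rightarrow> 'z \<Rightarrow> nat \<Rightarrow> 'z" where
  "coarse_scheme I h x 0 = x"
| "coarse_scheme I h x (Suc k) = I ((real k + 1) * h) (real k * h) (coarse_scheme I h x k)"

primrec fine_scheme :: "(real \<Rightarrow> real \<Rightarrow> 'z \<Rightarrow> 'z) \<Rightarrow> real \<Rightarrow> 'z \<Rightarrow> nat \<Rightarrow> 'z" where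
  "fine_scheme I h x 0 = x"
| "fine_scheme I h x (Suc k) =
     I ((real k + 1) * h) ((real k + 1/2) * h)
       (I ((real k + 1/2) * h) (real k * h) (fine_scheme I h x k))"

primrec swapped_fine_scheme :: "(real \<Rightarrow> real \<Rightarrow> 'z \<Rightarrow> 'z) \<Rightarrow> real \<Rightarrow> 'z \<Rightarrow> nat \<Rightarrow> 'z" where
  "swapped_fine_scheme I h x 0 = x"
| "swapped_fine_scheme I h x (Suc k) =
     I ((real k + 1/2) * h) (real k * h)
       (I ((real k + 1) * h) ((real k + 1/2) * h) (swapped_fine_scheme I h x k))"

definition step_size :: "real \<Rightarrow> nat \<Rightarrow> real"
  where "step_size T l = T / 2 ^ l"

text \<open>
  Both couplings are used for \<open>l \<ge> 1\<close> only; \<open>2 ^ (l - 1)\<close> coarse steps of size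
  \<open>step_size T (l - 1)\<close> lead from time \<open>0\<close> to \<open>T\<close>. \<open>coupling_fine\<close> at \<open>l\<close> is the fine
  coupling of level \<open>l\<close>; \<open>coupling_coarse\<close> at \<open>l\<close> is the coarse coupling of level \<open>l - 1\<close>.
\<close>

definition coupling_fine ::
  "'w measure \<Rightarrow> (real \<Rightarrow> 'w measure) \<Rightarrow> nat \<Rightarrow> nat \<Rightarrow> (nat \<Rightarrow> real^'n::finite \<Rightarrow> real^'n) \<Rightarrow>
    (nat \<Rightarrow> real \<Rightarrow> 'w \<Rightarrow> real) \<Rightarrow> (nat \<Rightarrow> real \<Rightarrow> 'w \<Rightarrow> real) \<Rightarrow> real \<Rightarrow> real^'n \<Rightarrow>
    (real^'n \<Rightarrow> real) \<Rightarrow> nat \<Rightarrow> 'w \<Rightarrow> real"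
  where "coupling_fine M F N\<^sub>S d \<sigma> B Bt T x \<phi> l \<omega> =
    (1/2) * (\<phi> (fine_scheme (integrator 1 M F N\<^sub>S d \<sigma> B Bt \<omega>) (step_size T (l - 1)) x (2 ^ (l - 1)))
           + \<phi> (swapped_fine_scheme (integrator (-1) M F N\<^sub>S d \<sigma> B Bt \<omega>) (step_size T (l - 1)) x (2 ^ (l - 1))))"

definition coupling_coarse ::
  "'w measure \<Rightarrow> (real \<Rightarrow> 'w measure) \<Rightarrow> nat \<Rightarrow> nat \<Rightarrow> (nat \<Rightarrow> real^'n::finite \<Rightarrow> real^'n) \<Rightarrow>
    (nat \<Rightarrow> real \<Rightarrow> 'w \<Rightarrow> real) \<Rightarrow> (nat \<Rightarrow> real \<Rightarrow> 'w \<Rightarrow> real) \<Rightarrow> real \<Rightarrow> real^'n \<Rightarrow>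
    (real^'n \<Rightarrow> real) \<Rightarrow> nat \<Rightarrow> 'w \<Rightarrow> real"
  where "coupling_coarse M F N\<^sub>S d \<sigma> B Bt T x \<phi> l \<omega> =
    (1/2) * (\<phi> (coarse_scheme (integrator 1 M F N\<^sub>S d \<sigma> B Bt \<omega>) (step_size T (l - 1)) x (2 ^ (l - 1)))
           + \<phi> (coarse_scheme (integrator (-1) M F N\<^sub>S d \<sigma> B Bt \<omega>) (step_size T (l - 1)) x (2 ^ (l - 1))))"

end

theory Submission
  imports Defs
begin

text \<open>
  Each single scheme approximates the diffusion with strong order one half only, because the area
  terms are replaced by independent products. The coupling gains a factor \<open>sqrt h\<close> (\<open>h\<close> the coarse
  step size) from cancellation between a scheme and its antithetic partner. Let \<open>f\<close>, \<open>f'\<close>, \<open>c\<close>, \<open>c'\<close> be the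
  states of the fine, the swapped fine, the coarse and the antithetic coarse scheme at the final time, and
  \<open>D = (f + f') / 2 - (c + c') / 2\<close>. Expanding the test function at the two midpoints bounds the difference of
  the couplings by a multiple of \<open>\<bar>D\<bar> + \<bar>f - f'\<bar>^2 + \<bar>c - c'\<bar>^2\<close>. Hence it suffices that, in every
  \<open>L^p\<close>, the two antithetic gaps \<open>f - f'\<close> and \<open>c - c'\<close> are of order \<open>sqrt h\<close> and \<open>D\<close> is of order \<open>h\<close>.

  One step takes each of these gaps \<open>V\<close> to \<open>V + X\<close>, where \<open>X\<close> splits into a centered part of size
  \<open>sqrt h * w\<close> and a remainder of size \<open>h * w\<close>, with \<open>w = \<bar>V\<bar> + e\<close>; this is the notion \<open>increment w X\<close>.
  In the binomial expansion of \<open>\<bar>V + X\<bar>^(2m)\<close> the term linear in the centered part has mean zero, so the moment is at most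
  multiplied by \<open>1 + C h\<close> and gains \<open>C h e^(2m)\<close> (\<open>moment_growth\<close>). By a discrete Gronwall argument \<open>V\<close> is then as
  small as \<open>e\<close>. For the antithetic gaps \<open>e = sqrt h\<close> (\<open>antithetic_differences\<close>). For \<open>D\<close> one gets
  \<open>e = h + \<bar>f - f'\<bar>^2 + \<bar>c - c'\<bar>^2\<close> (\<open>average_difference\<close>): two half steps agree with one coarse step up to
  a centered error of size \<open>h^(3/2)\<close>, an error \<open>h^2\<close>, and terms of size \<open>h\<close> that are odd under the exchange of the two half
  steps or carry an area weight. The latter have opposite signs in a scheme and in its partner, so in the mean of
  both only the differences of their coefficients remain, and these are small because the partners are close.
  The weights with exactly one time index are centered and of size \<open>h^(3/2)\<close>; they never have to be compared between levels.

  Since the noise of a step is independent of the past, the expectation over one step may be computed with the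
  state frozen (\<open>nn_integral_independent\<close>). So all expansions concern one step from a deterministic
  state, with constants uniform over step size, time and state. Independence of past and present is
  established for the sigma-algebras \<open>window a b\<close> generated by the increments of both Brownian motions within \<open>[a, b]\<close>:
  each motion has increments independent of the past, and the two motions are independent of each
  other, which gives the joint independence (\<open>indep_window\<close>), whereas the pair of them need not be independent of the given filtration.

  The iterated integrals with one time index enter through their means and sizes only. The time integral of a Brownian increment
  is realised as a limit of Riemann sums, which keeps it measurable in the window. The Ito integral of the elapsed
  time equals, almost surely, the expression given by integration by parts: that expression is an
  \<open>L^2\<close>-limit of integrals of staircases, and versions of an Ito integral are unique by the isometry for simple
  integrands.
\<close>

section \<open>Bounded Lipschitz coefficients\<close>

text \<open>
  One constant bounds the values and the Lipschitz quotients. Every coefficient occurring in the schemes has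
  both properties, and sums and products preserve them jointly.
\<close>

definition bdd_lip :: "('a::real_normed_vector \<Rightarrow> 'b::real_normed_vector) \<Rightarrow> bool"
  where "bdd_lip f \<longleftrightarrow> (\<exists>K. \<forall>a b. norm (f a) \<le> K \<and> norm (f a - f b) \<le> K * norm (a - b))"

lemma bdd_lipI:
  assumes "\<And>a. norm (f a) \<le> K1" and "\<And>a b. norm (f a - f b) \<le> K2 * norm (a - b)"
  shows "bdd_lip f"
proof -
  have "norm (f a - f b) \<le> max K1 K2 * norm (a - b)" for a b
    using assms(2)[of a b] mult_right_mono[of K2 "max K1 K2" "norm (a - b)"] by simp
  moreover have "norm (f a) \<le> max K1 K2" for a
    using assms(1)[of a] by simp
  ultimately show ?thesis unfolding bdd_lip_def by blast
qed

lemma bdd_lipE: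
  assumes "bdd_lip f"
  obtains K where "K \<ge> 0" "\<And>a. norm (f a) \<le> K" "\<And>a b. norm (f a - f b) \<le> K * norm (a - b)"
proof -
  obtain K where K: "\<And>a b. norm (f a) \<le> K \<and> norm (f a - f b) \<le> K * norm (a - b)"
    using assms unfolding bdd_lip_def by blast
  have "K \<ge> 0" using K[of undefined] norm_ge_zero[of "f undefined"] by (meson order_trans)
  with K that show ?thesis by blast
qed

lemma bdd_lip_continuous:
  assumes "bdd_lip f" shows "continuous_on UNIV f"
proof -
  obtain K where K: "K \<ge> 0" "\<And>a b. norm (f a - f b) \<le> K * norm (a - b)"
    using bdd_lipE[OF assms] by metis
  then have "K-lipschitz_on UNIV f"
    by (intro lipschitz_onI) (auto simp: dist_norm)
  then show ?thesis by (rule lipschitz_on_continuous_on)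
qed

lemma bdd_lip_measurable:
  assumes "bdd_lip f" shows "f \<in> borel_measurable borel"
  using bdd_lip_continuous[OF assms] by (rule borel_measurable_continuous_onI)

lemma bdd_lip_const: "bdd_lip (\<lambda>z. c)"
  by (rule bdd_lipI[of _ "norm c" 0]) auto

lemma bdd_lip_add:
  assumes "bdd_lip f" "bdd_lip g" shows "bdd_lip (\<lambda>z. f z + g z)"
proof -
  obtain K where K: "K \<ge> 0" "\<And>a. norm (f a) \<le> K" "\<And>a b. norm (f a - f b) \<le> K * norm (a - b)"
    using bdd_lipE[OF assms(1)] by metis
  obtain K' where K': "K' \<ge> 0" "\<And>a. norm (g a) \<le> K'" "\<And>a b. norm (g a - g b) \<le> K' * norm (a - b)"
    using bdd_lipE[OF assms(2)] by metis
  show ?thesis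
  proof (rule bdd_lipI)
    show "norm (f a + g a) \<le> K + K'" for a using K(2)[of a] K'(2)[of a] norm_triangle_ineq[of "f a" "g a"] by simp
    show "norm (f a + g a - (f b + g b)) \<le> (K + K') * norm (a - b)" for a b
      using K(3)[of a b] K'(3)[of a b] norm_triangle_ineq[of "f a - f b" "g a - g b"]
      by (simp add: algebra_simps)
  qed
qed

lemma bdd_lip_linear:
  assumes "bounded_linear h" "bdd_lip f" shows "bdd_lip (\<lambda>z. h (f z))"
proof -
  interpret bounded_linear h by fact
  obtain K where K: "K \<ge> 0" "\<And>a. norm (f a) \<le> K" "\<And>a b. norm (f a - f b) \<le> K * norm (a - b)"
    using bdd_lipE[OF assms(2)] by metis
  obtain B where B: "B \<ge> 0" "\<And>v. norm (h v) \<le> norm v * B" using nonneg_bounded by blast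
  show ?thesis
  proof (rule bdd_lipI)
    show "norm (h (f a)) \<le> K * B" for a
      using B(2)[of "f a"] mult_right_mono[OF K(2)[of a] B(1)] by linarith
    show "norm (h (f a) - h (f b)) \<le> (K * B) * norm (a - b)" for a b
      using B(2)[of "f a - f b"] mult_right_mono[OF K(3)[of a b] B(1)]
      by (simp add: diff algebra_simps)
  qed
qed

lemma bdd_lip_scaleR:
  assumes "bdd_lip f" "bdd_lip g" shows "bdd_lip (\<lambda>z. f z *\<^sub>R g z)"
proof -
  obtain K where K: "K \<ge> 0" "\<And>a. norm (f a) \<le> K" "\<And>a b. norm (f a - f b) \<le> K * norm (a - b)"
    using bdd_lipE[OF assms(1)] by metis
  obtain K' where K': "K' \<ge> 0" "\<And>a. norm (g a) \<le> K'" "\<And>a b. norm (g a - g b) \<le> K' * norm (a - b)"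
    using bdd_lipE[OF assms(2)] by metis
  show ?thesis
  proof (rule bdd_lipI)
    show "norm (f a *\<^sub>R g a) \<le> K * K'" for a
      using K(2)[of a] K'(2)[of a] K(1) by (simp add: mult_mono)
    fix a b
    have "f a *\<^sub>R g a - f b *\<^sub>R g b = f a *\<^sub>R (g a - g b) + (f a - f b) *\<^sub>R g b"
      by (simp add: algebra_simps)
    also have "norm \<dots> \<le> K * (K' * norm (a - b)) + (K * norm (a - b)) * K'"
      using K(2)[of a] K'(3)[of a b] K(3)[of a b] K'(2)[of b] K(1)
      by (intro norm_triangle_le add_mono) (auto intro!: mult_mono)
    also have "\<dots> = (2 * K * K') * norm (a - b)" by simp
    finally show "norm (f a *\<^sub>R g a - f b *\<^sub>R g b) \<le> (2 * K * K') * norm (a - b)" .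
  qed
qed

lemma bdd_lip_sum:
  assumes "\<And>k. k \<in> A \<Longrightarrow> bdd_lip (f k)" shows "bdd_lip (\<lambda>z. \<Sum>k\<in>A. f k z)"
  using assms by (induction A rule: infinite_finite_induct) (auto intro: bdd_lip_const bdd_lip_add)

lemma bdd_lip_diff:
  assumes "bdd_lip f" "bdd_lip g" shows "bdd_lip (\<lambda>z. f z - g z)"
  using bdd_lip_add[OF assms(1) bdd_lip_linear[OF bounded_linear_minus[OF bounded_linear_ident] assms(2)]] by simp

lemma bdd_lip_nth: "bdd_lip f \<Longrightarrow> bdd_lip (\<lambda>z. f z $ k)"
  by (rule bdd_lip_linear[OF bounded_linear_vec_nth])

lemma frechet_derivative_pderiv_at:
  fixes f :: "real^'n::finite \<Rightarrow> 'b::real_normed_vector"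
  assumes "f differentiable (at z)"
  shows "frechet_derivative f (at z) v = (\<Sum>k\<in>UNIV. (v $ k) *\<^sub>R pderiv_at k f z)"
proof -
  interpret linear "frechet_derivative f (at z)" by (rule linear_frechet_derivative[OF assms])
  have "frechet_derivative f (at z) v = frechet_derivative f (at z) (\<Sum>k\<in>UNIV. (v $ k) *\<^sub>R axis k 1)"
    using basis_expansion[of v] by (simp add: scalar_mult_eq_scaleR)
  then show ?thesis by (simp add: sum scaleR pderiv_at_def)
qed

lemma has_derivative_pderiv_at:
  fixes f :: "real^'n::finite \<Rightarrow> 'b::real_normed_vector"
  assumes "f differentiable (at z)"
  shows "(f has_derivative (\<lambda>v. \<Sum>k\<in>UNIV. (v $ k) *\<^sub>R pderiv_at k f z)) (at z)"
  using assms frechet_derivative_pderiv_at[OF assms] frechet_derivative_works[of f "at z"]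
  by (metis (no_types, lifting) ext)

lemma Cb_bounded: "Cb K f \<Longrightarrow> bounded (range f)"
  by (cases K) auto

lemma norm_sum_scaleR_le:
  fixes v :: "real^'n::finite" and g :: "'n \<Rightarrow> 'b::real_normed_vector"
  assumes "\<And>k. norm (g k) \<le> K k"
  shows "norm (\<Sum>k\<in>UNIV. (v $ k) *\<^sub>R g k) \<le> norm v * (\<Sum>k\<in>UNIV. K k)"
  unfolding sum_distrib_left
  by (rule sum_norm_le) (auto intro!: mult_mono component_le_norm_cart assms)

lemma Cb_Suc_0_bdd_lip:
  fixes f :: "real^'n::finite \<Rightarrow> 'b::real_normed_vector"
  assumes "Cb (Suc K) f" shows "bdd_lip f"
proof -
  from assms have bf: "bounded (range f)" and df: "\<And>z. f differentiable (at z)"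
    and "\<And>k. bounded (range (pderiv_at k f))" using Cb_bounded by auto
  then obtain B where B: "\<And>k z. norm (pderiv_at k f z) \<le> B k"
    unfolding bounded_iff by (metis rangeI)
  obtain B0 where B0: "\<And>z. norm (f z) \<le> B0" using bf unfolding bounded_iff by auto
  show ?thesis
  proof (rule bdd_lipI[OF B0])
    fix a b
    show "norm (f a - f b) \<le> (\<Sum>k\<in>UNIV. B k) * norm (a - b)"
    proof (rule differentiable_bound[OF convex_UNIV])
      show "(f has_derivative (\<lambda>v. \<Sum>k\<in>UNIV. (v $ k) *\<^sub>R pderiv_at k f z)) (at z within UNIV)" for z
        using has_derivative_pderiv_at[OF df[of z]] by simp
      show "onorm (\<lambda>v. \<Sum>k\<in>UNIV. (v $ k) *\<^sub>R pderiv_at k f z) \<le> (\<Sum>k\<in>UNIV. B k)" for z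
        using norm_sum_scaleR_le[of "\<lambda>k. pderiv_at k f z" B] B
        by (intro onorm_le) (simp add: mult.commute)
    qed auto
  qed
qed

text \<open>
  On the segment from \<open>a\<close> to \<open>b\<close> the function minus its linearisation at \<open>a\<close> has derivative of norm at most
  a multiple of \<open>norm (b - a)\<close>, because bounded second derivatives make the partial derivatives Lipschitz.
\<close>

lemma Cb_2_taylor:
  fixes f :: "real^'n::finite \<Rightarrow> 'b::real_normed_vector"
  assumes "Cb 2 f"
  obtains K where "K \<ge> 0" and
    "\<And>a b. norm (f b - f a - (\<Sum>k\<in>UNIV. ((b - a) $ k) *\<^sub>R pderiv_at k f a)) \<le> K * (norm (b - a))\<^sup>2"
proof -
  have df: "\<And>z. f differentiable (at z)" and "\<And>k. Cb (Suc 0) (pderiv_at k f)"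
    using assms by (auto simp: numeral_2_eq_2)
  then have "\<And>k. bdd_lip (pderiv_at k f)" using Cb_Suc_0_bdd_lip by blast
  then have "\<exists>K. \<forall>k. K k \<ge> 0 \<and> (\<forall>a b. norm (pderiv_at k f a - pderiv_at k f b) \<le> K k * norm (a - b))"
    by (intro choice allI) (metis bdd_lipE)
  then obtain K where K: "\<And>k. K k \<ge> 0"
    "\<And>k a b. norm (pderiv_at k f a - pderiv_at k f b) \<le> K k * norm (a - b)" by blast
  show ?thesis
  proof (rule that)
    show "0 \<le> (\<Sum>k\<in>UNIV. K k)" by (intro sum_nonneg K)
    fix a b
    let ?L = "\<lambda>z v. \<Sum>k\<in>UNIV. (v $ k) *\<^sub>R pderiv_at k f z"
    have "norm ((\<lambda>z. f z - ?L a z) b - (\<lambda>z. f z - ?L a z) a) \<le> ((\<Sum>k\<in>UNIV. K k) * norm (b - a)) * norm (b - a)"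
    proof (rule differentiable_bound[where S="closed_segment a b" and f'="\<lambda>z v. ?L z v - ?L a v"])
      fix z assume z: "z \<in> closed_segment a b"
      have "(f has_derivative ?L z) (at z within closed_segment a b)"
        using has_derivative_pderiv_at[OF df[of z]] by (rule has_derivative_at_withinI)
      moreover have "(?L a has_derivative ?L a) (at z within closed_segment a b)"
        by (intro bounded_linear_imp_has_derivative bounded_linear_intros
            bounded_linear_sum bounded_linear_scaleR_const bounded_linear_vec_nth)
      ultimately show "((\<lambda>z. f z - ?L a z) has_derivative (\<lambda>v. ?L z v - ?L a v)) (at z within closed_segment a b)"
        by (rule has_derivative_diff)
      have za: "norm (z - a) \<le> norm (b - a)" using z by (metis norm_minus_commute segment_bound(1))
      show "onorm (\<lambda>v. ?L z v - ?L a v) \<le> (\<Sum>k\<in>UNIV. K k) * norm (b - a)"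
      proof (rule onorm_le)
        fix v
        have "norm (?L z v - ?L a v) = norm (\<Sum>k\<in>UNIV. (v $ k) *\<^sub>R (pderiv_at k f z - pderiv_at k f a))"
          by (simp add: sum_subtractf scaleR_diff_right)
        also have "\<dots> \<le> norm v * (\<Sum>k\<in>UNIV. K k * norm (b - a))"
          using K za by (intro norm_sum_scaleR_le) (meson mult_left_mono order_trans)
        finally show "norm (?L z v - ?L a v) \<le> (\<Sum>k\<in>UNIV. K k) * norm (b - a) * norm v"
          by (simp add: sum_distrib_right[symmetric] mult_ac)
      qed
    qed auto
    moreover have "?L a b - ?L a a = ?L a (b - a)"
      by (simp add: sum_subtractf algebra_simps)
    ultimately show "norm (f b - f a - ?L a (b - a)) \<le> (\<Sum>k\<in>UNIV. K k) * (norm (b - a))\<^sup>2"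
      by (simp add: power2_eq_square algebra_simps)
  qed
qed

text \<open>
  The linear terms of the expansions of \<open>f a\<close> and \<open>f b\<close> around the midpoint cancel.
\<close>

lemma Cb_2_midpoint:
  fixes f :: "real^'n::finite \<Rightarrow> 'b::real_normed_vector"
  assumes "Cb 2 f"
  obtains K where "K \<ge> 0" and
    "\<And>a b. norm ((1/2) *\<^sub>R (f a + f b) - f ((1/2) *\<^sub>R (a + b))) \<le> K * (norm (a - b))\<^sup>2"
proof -
  obtain K where K: "K \<ge> 0"
    "\<And>a b. norm (f b - f a - (\<Sum>k\<in>UNIV. ((b - a) $ k) *\<^sub>R pderiv_at k f a)) \<le> K * (norm (b - a))\<^sup>2"
    using Cb_2_taylor[OF assms] by metis
  show ?thesis
  proof (rule that[OF K(1)])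
    fix a b :: "real^'n"
    let ?c = "(1/2) *\<^sub>R (a + b)"
    let ?L = "\<lambda>v. \<Sum>k\<in>UNIV. (v $ k) *\<^sub>R pderiv_at k f ?c"
    have ac: "a - ?c = (1/2) *\<^sub>R (a - b)" and bc: "b - ?c = - ((1/2) *\<^sub>R (a - b))"
      by (vector field_simps)+
    have n: "norm (a - ?c) \<le> norm (a - b)" "norm (b - ?c) \<le> norm (a - b)"
      unfolding ac bc by simp_all
    have L: "?L (b - ?c) = - ?L (a - ?c)"
      unfolding ac bc by (simp add: sum_negf)
    have "(1/2) *\<^sub>R (f a + f b) - f ?c
        = (1/2) *\<^sub>R ((f a - f ?c - ?L (a - ?c)) + (f b - f ?c - ?L (b - ?c)))"
      unfolding L by (simp add: algebra_simps flip: scaleR_add_left)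
    also have "norm \<dots> \<le> (1/2) * (K * (norm (a - ?c))\<^sup>2 + K * (norm (b - ?c))\<^sup>2)"
      using K(2)[of a ?c] K(2)[of b ?c] by (simp add: norm_triangle_le)
    also have "\<dots> \<le> (1/2) * (K * (norm (a - b))\<^sup>2 + K * (norm (a - b))\<^sup>2)"
      using n K(1) by (intro mult_left_mono add_mono power_mono) auto
    finally show "norm ((1/2) *\<^sub>R (f a + f b) - f ?c) \<le> K * (norm (a - b))\<^sup>2" by simp
  qed
qed

lemma Cb_inf_Cb: "Cb_inf f \<Longrightarrow> Cb K f" by (simp add: Cb_inf_def)

lemma Cb_inf_bdd_lip: "Cb_inf f \<Longrightarrow> bdd_lip f"
  using Cb_Suc_0_bdd_lip Cb_inf_def by blast

lemma Cb_inf_pderiv_at: "Cb_inf f \<Longrightarrow> Cb_inf (pderiv_at k f)"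
  unfolding Cb_inf_def by (metis Cb.simps(2))

text \<open>
  For \<open>i = 0\<close> second derivatives of \<open>f\<close> occur as factors; this is where smoothness beyond order two is used.
\<close>

lemma bdd_lip_lie_op:
  assumes \<sigma>: "\<And>j. j \<in> {0..d} \<Longrightarrow> Cb_inf (\<sigma> j)" and f: "Cb_inf f" and i: "i \<le> d"
  shows "bdd_lip (lie_op d \<sigma> i f)"
proof -
  have s: "bdd_lip (\<lambda>z. \<sigma> j z $ k)" if "j \<le> d" for j k
    using that by (intro bdd_lip_nth Cb_inf_bdd_lip \<sigma>) simp
  have ss: "bdd_lip (\<lambda>z. \<sigma> j z $ k * \<sigma> j z $ k')" if "j \<le> d" for j k k'
    using bdd_lip_scaleR[OF s[OF that] s[OF that]] by simp
  have D: "bdd_lip (pderiv_at k f)" "bdd_lip (pderiv_at k (pderiv_at k' f))" for k k'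
    using f by (auto intro!: Cb_inf_bdd_lip Cb_inf_pderiv_at)
  show ?thesis
  proof (cases "i = 0")
    case True
    have "bdd_lip (\<lambda>z. (\<Sum>k\<in>UNIV. (\<sigma> 0 z $ k) *\<^sub>R pderiv_at k f z)
       + (1/2) *\<^sub>R (\<Sum>j=1..d. \<Sum>k1\<in>UNIV. \<Sum>k2\<in>UNIV.
           (\<sigma> j z $ k1 * \<sigma> j z $ k2) *\<^sub>R pderiv_at k1 (pderiv_at k2 f) z))"
      by (intro bdd_lip_add bdd_lip_sum bdd_lip_scaleR bdd_lip_const s ss D) auto
    with True show ?thesis unfolding lie_op_def by simp
  next
    case False
    have "bdd_lip (\<lambda>z. \<Sum>k\<in>UNIV. (\<sigma> i z $ k) *\<^sub>R pderiv_at k f z)"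
      by (intro bdd_lip_sum bdd_lip_scaleR s D i)
    with False show ?thesis unfolding lie_op_def by simp
  qed
qed

lemma bdd_lip_lie_bracket:
  assumes \<sigma>: "\<And>j. j \<in> {0..d} \<Longrightarrow> Cb_inf (\<sigma> j)" and "i \<le> d" "j \<le> d"
  shows "bdd_lip (lie_bracket d \<sigma> i j)"
  unfolding lie_bracket_def using assms
  by (intro bdd_lip_diff bdd_lip_lie_op) auto

section \<open>Moment orders\<close>

lemma (in prob_space) nn_integral_norm_mult_sqr_le:
  fixes f g :: "'a \<Rightarrow> real"
  assumes [measurable]: "f \<in> borel_measurable M" "g \<in> borel_measurable M"
    and f: "(\<integral>\<^sup>+\<omega>. ennreal (\<bar>f \<omega>\<bar>^2) \<partial>M) \<le> ennreal (A^2)" and g: "(\<integral>\<^sup>+\<omega>. ennreal (\<bar>g \<omega>\<bar>^2) \<partial>M) \<le> ennreal (B^2)"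
    and AB: "A \<ge> 0" "B \<ge> 0"
  shows "(\<integral>\<^sup>+\<omega>. ennreal (\<bar>f \<omega>\<bar> * \<bar>g \<omega>\<bar>) \<partial>M) \<le> ennreal (A * B)"
proof -
  have "(\<integral>\<^sup>+\<omega>. ennreal \<bar>f \<omega>\<bar> * ennreal \<bar>g \<omega>\<bar> \<partial>M)\<^sup>2
      \<le> (\<integral>\<^sup>+\<omega>. (ennreal \<bar>f \<omega>\<bar>)\<^sup>2 \<partial>M) * (\<integral>\<^sup>+\<omega>. (ennreal \<bar>g \<omega>\<bar>)\<^sup>2 \<partial>M)"
    by (rule Cauchy_Schwarz_nn_integral) measurable
  also have "\<dots> \<le> ennreal (A^2) * ennreal (B^2)"
    using f g by (intro mult_mono) (auto simp: ennreal_power)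
  also have "\<dots> = (ennreal (A * B))\<^sup>2"
    using AB by (simp add: ennreal_mult'[symmetric] ennreal_power power_mult_distrib)
  finally have le: "(\<integral>\<^sup>+\<omega>. ennreal \<bar>f \<omega>\<bar> * ennreal \<bar>g \<omega>\<bar> \<partial>M)\<^sup>2 \<le> (ennreal (A * B))\<^sup>2" .
  have "(\<integral>\<^sup>+\<omega>. ennreal \<bar>f \<omega>\<bar> * ennreal \<bar>g \<omega>\<bar> \<partial>M) \<le> ennreal (A * B)"
  proof (cases "\<integral>\<^sup>+\<omega>. ennreal \<bar>f \<omega>\<bar> * ennreal \<bar>g \<omega>\<bar> \<partial>M")
    case (real x)
    then show ?thesis
    proof -
      have "ennreal (x\<^sup>2) \<le> ennreal ((A * B)\<^sup>2)"
        using le unfolding real(2) using real(1) AB by (simp add: ennreal_power)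
      then have "x\<^sup>2 \<le> (A * B)\<^sup>2" by (subst (asm) ennreal_le_iff) auto
      then have "x \<le> A * B" using AB by (metis mult_nonneg_nonneg power2_le_imp_le)
      then show ?thesis unfolding real(2) by (rule ennreal_leI)
    qed
  next
    case top
    then show ?thesis using le AB by (simp add: ennreal_power top_unique)
  qed
  then show ?thesis by (simp add: ennreal_mult')
qed

lemma power_add_le:
  fixes a b :: real
  assumes "a \<ge> 0" "b \<ge> 0"
  shows "(a + b) ^ p \<le> 2 ^ p * (a ^ p + b ^ p)"
proof -
  have "(a + b) ^ p \<le> (2 * max a b) ^ p" using assms by (intro power_mono) auto
  also have "\<dots> = 2 ^ p * max a b ^ p" by (simp add: power_mult_distrib)
  also have "\<dots> \<le> 2 ^ p * (a ^ p + b ^ p)" using assms by (auto simp: max_def)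
  finally show ?thesis .
qed

text \<open>
  The index set \<open>I\<close> parametrises a family of one-step experiments, and \<open>r i\<close> is the square root of the step size of
  the experiment \<open>i\<close>. Estimates are uniform over \<open>I\<close>, which replaces Landau symbols in the step size and at the same
  time makes the constants independent of the starting state.
\<close>

locale small_steps = prob_space M for M :: "'w measure" +
  fixes I :: "'i set" and r :: "'i \<Rightarrow> real" and R :: real
  assumes r_pos: "i \<in> I \<Longrightarrow> 0 < r i" and r_le: "i \<in> I \<Longrightarrow> r i \<le> R"
begin

text \<open>
  All absolute moments of \<open>X i\<close> are bounded by the powers of \<open>s i\<close>, uniformly in \<open>i\<close>. Moments are taken as nonnegative
  integrals so that the bound includes integrability.
\<close>

definition order :: "('i \<Rightarrow> real) \<Rightarrow> ('i \<Rightarrow> 'w \<Rightarrow> 'b::euclidean_space) \<Rightarrow> bool"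
  where "order s X \<longleftrightarrow> (\<forall>i\<in>I. X i \<in> borel_measurable M \<and> 0 \<le> s i) \<and>
    (\<forall>p::nat. \<exists>C\<ge>0. \<forall>i\<in>I. (\<integral>\<^sup>+\<omega>. ennreal (norm (X i \<omega>) ^ p) \<partial>M) \<le> ennreal (C * s i ^ p))"

lemma orderI:
  assumes "\<And>i. i \<in> I \<Longrightarrow> X i \<in> borel_measurable M" "\<And>i. i \<in> I \<Longrightarrow> 0 \<le> s i"
    and "\<And>p::nat. \<exists>C\<ge>0. \<forall>i\<in>I. (\<integral>\<^sup>+\<omega>. ennreal (norm (X i \<omega>) ^ p) \<partial>M) \<le> ennreal (C * s i ^ p)"
  shows "order s X"
  using assms by (auto simp: order_def)

lemma order_measurable: "order s X \<Longrightarrow> i \<in> I \<Longrightarrow> X i \<in> borel_measurable M"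
  by (simp add: order_def)

lemma order_nonneg: "order s X \<Longrightarrow> i \<in> I \<Longrightarrow> 0 \<le> s i"
  by (simp add: order_def)

lemma orderE:
  assumes "order s X"
  obtains C where "C \<ge> 0" "\<And>i. i \<in> I \<Longrightarrow> (\<integral>\<^sup>+\<omega>. ennreal (norm (X i \<omega>) ^ p) \<partial>M) \<le> ennreal (C * s i ^ p)"
  using assms unfolding order_def by metis

lemma order_dominated:
  fixes X :: "'i \<Rightarrow> 'w \<Rightarrow> 'b::euclidean_space" and Y :: "'i \<Rightarrow> 'w \<Rightarrow> 'c::euclidean_space"
  assumes Y: "order s Y" and X: "\<And>i. i \<in> I \<Longrightarrow> X i \<in> borel_measurable M"
    and le: "\<And>i \<omega>. i \<in> I \<Longrightarrow> \<omega> \<in> space M \<Longrightarrow> norm (X i \<omega>) \<le> K * norm (Y i \<omega>)" and K: "K \<ge> 0"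
  shows "order s X"
proof (rule orderI)
  fix p
  obtain C where C: "C \<ge> 0" "\<And>i. i \<in> I \<Longrightarrow> (\<integral>\<^sup>+\<omega>. ennreal (norm (Y i \<omega>) ^ p) \<partial>M) \<le> ennreal (C * s i ^ p)"
    using orderE[OF Y] by metis
  show "\<exists>C\<ge>0. \<forall>i\<in>I. (\<integral>\<^sup>+\<omega>. ennreal (norm (X i \<omega>) ^ p) \<partial>M) \<le> ennreal (C * s i ^ p)"
  proof (intro exI[of _ "K^p * C"] conjI ballI)
    fix i assume i: "i \<in> I"
    note [measurable] = order_measurable[OF Y i]
    have "(\<integral>\<^sup>+\<omega>. ennreal (norm (X i \<omega>) ^ p) \<partial>M) \<le> (\<integral>\<^sup>+\<omega>. ennreal (K^p) * ennreal (norm (Y i \<omega>) ^ p) \<partial>M)"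
      using power_mono[OF le[OF i], of _ p] K
      by (intro nn_integral_mono) (auto simp: ennreal_mult'[symmetric] power_mult_distrib)
    also have "\<dots> = ennreal (K^p) * (\<integral>\<^sup>+\<omega>. ennreal (norm (Y i \<omega>) ^ p) \<partial>M)"
      by (rule nn_integral_cmult) measurable
    also have "\<dots> \<le> ennreal (K^p) * ennreal (C * s i ^ p)"
      by (intro mult_left_mono C i) simp
    also have "\<dots> = ennreal (K^p * C * s i ^ p)"
      using K C(1) by (simp add: ennreal_mult'[symmetric] mult.assoc)
    finally show "(\<integral>\<^sup>+\<omega>. ennreal (norm (X i \<omega>) ^ p) \<partial>M) \<le> ennreal (K^p * C * s i ^ p)" .
  qed (use K C in simp)
qed (use X order_nonneg[OF Y] in auto)

lemma order_mono:
  assumes X: "order s X" and le: "\<And>i. i \<in> I \<Longrightarrow> s i \<le> K * s' i" and K: "K \<ge> 0"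
    and nn: "\<And>i. i \<in> I \<Longrightarrow> 0 \<le> s' i"
  shows "order s' X"
proof (rule orderI)
  fix p
  obtain C where C: "C \<ge> 0" "\<And>i. i \<in> I \<Longrightarrow> (\<integral>\<^sup>+\<omega>. ennreal (norm (X i \<omega>) ^ p) \<partial>M) \<le> ennreal (C * s i ^ p)"
    using orderE[OF X] by metis
  show "\<exists>C\<ge>0. \<forall>i\<in>I. (\<integral>\<^sup>+\<omega>. ennreal (norm (X i \<omega>) ^ p) \<partial>M) \<le> ennreal (C * s' i ^ p)"
  proof (intro exI[of _ "C * K^p"] conjI ballI)
    fix i assume i: "i \<in> I"
    have "C * s i ^ p \<le> C * K^p * s' i ^ p"
      using power_mono[OF le[OF i] order_nonneg[OF X i], of p] C(1)
      by (simp add: power_mult_distrib mult.assoc mult_left_mono)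
    with C(2)[OF i] show "(\<integral>\<^sup>+\<omega>. ennreal (norm (X i \<omega>) ^ p) \<partial>M) \<le> ennreal (C * K^p * s' i ^ p)"
      by (meson ennreal_leI order_trans)
  qed (use K C in simp)
qed (use order_measurable[OF X] nn in auto)

lemma order_cong:
  assumes "order s X" "\<And>i \<omega>. i \<in> I \<Longrightarrow> \<omega> \<in> space M \<Longrightarrow> X i \<omega> = Y i \<omega>"
  shows "order s Y"
proof (rule order_dominated[OF assms(1), where K = 1])
  show "Y i \<in> borel_measurable M" if "i \<in> I" for i
    using order_measurable[OF assms(1) that] assms(2)[OF that] measurable_cong[of M "X i" "Y i" borel] by simp
qed (use assms(2) in auto)

lemma order_const:
  fixes g :: "'i \<Rightarrow> 'b::euclidean_space"
  assumes "\<And>i. i \<in> I \<Longrightarrow> norm (g i) \<le> K * s i" and nn: "\<And>i. i \<in> I \<Longrightarrow> 0 \<le> s i"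
  shows "order s (\<lambda>i \<omega>. g i)"
proof (rule orderI)
  fix p
  have "norm (g i) ^ p \<le> \<bar>K\<bar> ^ p * s i ^ p" if "i \<in> I" for i
  proof -
    have "norm (g i) \<le> \<bar>K\<bar> * s i"
      using assms(1)[OF that] mult_right_mono[OF abs_ge_self[of K] nn[OF that]] by linarith
    then show ?thesis using power_mono[of "norm (g i)" "\<bar>K\<bar> * s i" p] by (simp add: power_mult_distrib)
  qed
  then show "\<exists>C\<ge>0. \<forall>i\<in>I. (\<integral>\<^sup>+\<omega>. ennreal (norm (g i) ^ p) \<partial>M) \<le> ennreal (C * s i ^ p)"
    by (intro exI[of _ "\<bar>K\<bar>^p"]) (simp add: emeasure_space_1 ennreal_leI)
qed (use nn in auto)

lemma order_add:
  fixes X Y :: "'i \<Rightarrow> 'w \<Rightarrow> 'b::euclidean_space"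
  assumes X: "order s X" and Y: "order s Y"
  shows "order s (\<lambda>i \<omega>. X i \<omega> + Y i \<omega>)"
proof (rule orderI)
  show "(\<lambda>\<omega>. X i \<omega> + Y i \<omega>) \<in> borel_measurable M" if "i \<in> I" for i
    using order_measurable[OF X that] order_measurable[OF Y that] by measurable
  fix p
  obtain C where C: "C \<ge> 0" "\<And>i. i \<in> I \<Longrightarrow> (\<integral>\<^sup>+\<omega>. ennreal (norm (X i \<omega>) ^ p) \<partial>M) \<le> ennreal (C * s i ^ p)"
    using orderE[OF X] by metis
  obtain D where D: "D \<ge> 0" "\<And>i. i \<in> I \<Longrightarrow> (\<integral>\<^sup>+\<omega>. ennreal (norm (Y i \<omega>) ^ p) \<partial>M) \<le> ennreal (D * s i ^ p)"
    using orderE[OF Y] by metis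
  show "\<exists>C\<ge>0. \<forall>i\<in>I. (\<integral>\<^sup>+\<omega>. ennreal (norm (X i \<omega> + Y i \<omega>) ^ p) \<partial>M) \<le> ennreal (C * s i ^ p)"
  proof (intro exI[of _ "2^p * (C + D)"] conjI ballI)
    fix i assume i: "i \<in> I"
    note [measurable] = order_measurable[OF X i] order_measurable[OF Y i]
    have "norm (X i \<omega> + Y i \<omega>) ^ p \<le> 2^p * (norm (X i \<omega>) ^ p + norm (Y i \<omega>) ^ p)" for \<omega>
      using power_mono[OF norm_triangle_ineq[of "X i \<omega>" "Y i \<omega>"], of p]
        power_add_le[of "norm (X i \<omega>)" "norm (Y i \<omega>)" p] by simp
    then have "(\<integral>\<^sup>+\<omega>. ennreal (norm (X i \<omega> + Y i \<omega>) ^ p) \<partial>M)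
        \<le> (\<integral>\<^sup>+\<omega>. ennreal (2^p) * (ennreal (norm (X i \<omega>) ^ p) + ennreal (norm (Y i \<omega>) ^ p)) \<partial>M)"
      by (intro nn_integral_mono) (simp add: ennreal_mult'[symmetric] flip: ennreal_plus)
    also have "\<dots> = ennreal (2^p) * ((\<integral>\<^sup>+\<omega>. ennreal (norm (X i \<omega>) ^ p) \<partial>M) + (\<integral>\<^sup>+\<omega>. ennreal (norm (Y i \<omega>) ^ p) \<partial>M))"
      by (simp add: nn_integral_cmult nn_integral_add)
    also have "\<dots> \<le> ennreal (2^p) * (ennreal (C * s i ^ p) + ennreal (D * s i ^ p))"
      by (intro mult_left_mono add_mono C D i) simp
    also have "\<dots> = ennreal (2^p * (C + D) * s i ^ p)"
      using C(1) D(1) order_nonneg[OF X i]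
      by (simp add: ennreal_mult'[symmetric] algebra_simps flip: ennreal_plus)
    finally show "(\<integral>\<^sup>+\<omega>. ennreal (norm (X i \<omega> + Y i \<omega>) ^ p) \<partial>M) \<le> ennreal (2^p * (C + D) * s i ^ p)" .
  qed (use C D in simp)
qed (use order_nonneg[OF X] in auto)

lemma order_zero: "(\<And>i. i \<in> I \<Longrightarrow> 0 \<le> s i) \<Longrightarrow> order s (\<lambda>i \<omega>. 0)"
  by (rule order_const[of _ 0]) auto

lemma order_sum:
  assumes "\<And>k. k \<in> A \<Longrightarrow> order s (X k)" "\<And>i. i \<in> I \<Longrightarrow> 0 \<le> s i"
  shows "order s (\<lambda>i \<omega>. \<Sum>k\<in>A. X k i \<omega>)"
  using assms by (induction A rule: infinite_finite_induct) (auto intro: order_zero order_add)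

text \<open>
  Cauchy-Schwarz, applied to the \<open>p\<close>-th powers, asks for moments of order \<open>2 p\<close> of the factors. Closure under products is the
  reason for requiring all moments in the definition.
\<close>

lemma order_scaleR:
  fixes X :: "'i \<Rightarrow> 'w \<Rightarrow> real" and Y :: "'i \<Rightarrow> 'w \<Rightarrow> 'b::euclidean_space"
  assumes X: "order s X" and Y: "order s' Y"
  shows "order (\<lambda>i. s i * s' i) (\<lambda>i \<omega>. X i \<omega> *\<^sub>R Y i \<omega>)"
proof (rule orderI)
  show "(\<lambda>\<omega>. X i \<omega> *\<^sub>R Y i \<omega>) \<in> borel_measurable M" if "i \<in> I" for i
    using order_measurable[OF X that] order_measurable[OF Y that] by measurable
  fix p
  obtain C where C: "C \<ge> 0" "\<And>i. i \<in> I \<Longrightarrow> (\<integral>\<^sup>+\<omega>. ennreal (norm (X i \<omega>) ^ (p*2)) \<partial>M) \<le> ennreal (C * s i ^ (p*2))"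
    using orderE[OF X] by metis
  obtain D where D: "D \<ge> 0" "\<And>i. i \<in> I \<Longrightarrow> (\<integral>\<^sup>+\<omega>. ennreal (norm (Y i \<omega>) ^ (p*2)) \<partial>M) \<le> ennreal (D * s' i ^ (p*2))"
    using orderE[OF Y] by metis
  show "\<exists>C\<ge>0. \<forall>i\<in>I. (\<integral>\<^sup>+\<omega>. ennreal (norm (X i \<omega> *\<^sub>R Y i \<omega>) ^ p) \<partial>M) \<le> ennreal (C * (s i * s' i) ^ p)"
  proof (intro exI[of _ "sqrt C * sqrt D"] conjI ballI)
    fix i assume i: "i \<in> I"
    note [measurable] = order_measurable[OF X i] order_measurable[OF Y i]
    have nn: "s i \<ge> 0" "s' i \<ge> 0" using order_nonneg[OF X i] order_nonneg[OF Y i] by auto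
    have "(\<integral>\<^sup>+\<omega>. ennreal (\<bar>norm (X i \<omega>) ^ p\<bar> * \<bar>norm (Y i \<omega>) ^ p\<bar>) \<partial>M)
      \<le> ennreal ((sqrt C * s i ^ p) * (sqrt D * s' i ^ p))"
      using C(2)[OF i] D(2)[OF i] C(1) D(1) nn
      by (intro nn_integral_norm_mult_sqr_le) (simp_all add: power_mult_distrib power_mult)
    then show "(\<integral>\<^sup>+\<omega>. ennreal (norm (X i \<omega> *\<^sub>R Y i \<omega>) ^ p) \<partial>M) \<le> ennreal (sqrt C * sqrt D * (s i * s' i) ^ p)"
      by (simp add: power_mult_distrib power_abs mult_ac)
  qed (use C D in simp)
qed (use order_nonneg[OF X] order_nonneg[OF Y] in auto)

lemma order_mult:
  "order s X \<Longrightarrow> order s' Y \<Longrightarrow> order (\<lambda>i. s i * s' i) (\<lambda>i \<omega>. X i \<omega> * (Y i \<omega> :: real))"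
  using order_scaleR[of s X s' Y] by simp

lemma order_norm:
  assumes "order s X" shows "order s (\<lambda>i \<omega>. norm (X i \<omega>))"
proof (rule order_dominated[OF assms, where K = 1])
  show "(\<lambda>\<omega>. norm (X i \<omega>)) \<in> borel_measurable M" if "i \<in> I" for i
    using order_measurable[OF assms that] by measurable
qed auto

lemma order_minus:
  assumes "order s X" shows "order s (\<lambda>i \<omega>. - X i \<omega>)"
proof (rule order_dominated[OF assms, where K = 1])
  show "(\<lambda>\<omega>. - X i \<omega>) \<in> borel_measurable M" if "i \<in> I" for i
    using order_measurable[OF assms that] by measurable
qed auto

lemma order_diff: "order s X \<Longrightarrow> order s Y \<Longrightarrow> order s (\<lambda>i \<omega>. X i \<omega> - Y i \<omega>)"
  using order_add[OF _ order_minus, of s X Y] by simp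

lemma order_power:
  fixes X :: "'i \<Rightarrow> 'w \<Rightarrow> real"
  assumes "order s X" shows "order (\<lambda>i. s i ^ k) (\<lambda>i \<omega>. X i \<omega> ^ k)"
proof (induction k)
  case 0 show ?case using order_const[of "\<lambda>_. 1::real" 1 "\<lambda>_. 1"] by simp
qed (simp add: order_mult assms)

lemma order_integrable:
  assumes X: "order s X" and i: "i \<in> I"
  shows "integrable M (X i)"
proof (rule integrableI_bounded)
  obtain C where "C \<ge> 0" "\<And>i. i \<in> I \<Longrightarrow> (\<integral>\<^sup>+\<omega>. ennreal (norm (X i \<omega>) ^ 1) \<partial>M) \<le> ennreal (C * s i ^ 1)"
    using orderE[OF X] by metis
  from this(2)[OF i] show "(\<integral>\<^sup>+\<omega>. norm (X i \<omega>) \<partial>M) < \<infinity>"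
    by (simp add: order.strict_trans1 ennreal_less_top)
qed (rule order_measurable[OF X i])

lemma order_expectation:
  assumes X: "order s X"
  obtains C where "C \<ge> 0" "\<And>i. i \<in> I \<Longrightarrow> norm (expectation (X i)) \<le> C * s i"
proof -
  obtain C where C: "C \<ge> 0" "\<And>i. i \<in> I \<Longrightarrow> (\<integral>\<^sup>+\<omega>. ennreal (norm (X i \<omega>) ^ 1) \<partial>M) \<le> ennreal (C * s i ^ 1)"
    using orderE[OF X] by metis
  have "norm (expectation (X i)) \<le> C * s i" if i: "i \<in> I" for i
  proof -
    have "ennreal (expectation (\<lambda>\<omega>. norm (X i \<omega>))) = (\<integral>\<^sup>+\<omega>. ennreal (norm (X i \<omega>)) \<partial>M)"
      using order_integrable[OF X i] by (subst nn_integral_eq_integral) auto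
    then have "ennreal (expectation (\<lambda>\<omega>. norm (X i \<omega>))) \<le> ennreal (C * s i)"
      using C(2)[OF i] by simp
    with C(1) order_nonneg[OF X i] have "expectation (\<lambda>\<omega>. norm (X i \<omega>)) \<le> C * s i"
      by (subst (asm) ennreal_le_iff) auto
    with integral_norm_bound show ?thesis by (rule order_trans)
  qed
  with C(1) that show ?thesis by blast
qed

subsection \<open>Increments with a small mean\<close>

text \<open>
  The decomposition behind a martingale argument: the centered part may be larger by the factor \<open>1 / r\<close>, because
  it contributes to even moments only at second order, and \<open>r * r\<close> is one step size.
\<close>

definition increment :: "('i \<Rightarrow> real) \<Rightarrow> ('i \<Rightarrow> 'w \<Rightarrow> 'b::euclidean_space) \<Rightarrow> bool"
  where "increment w X \<longleftrightarrow> (\<exists>m q. order (\<lambda>i. r i * w i) m \<and> order (\<lambda>i. (r i)\<^sup>2 * w i) q \<and>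
    (\<forall>i\<in>I. expectation (m i) = 0 \<and> 0 \<le> w i \<and> (\<forall>\<omega>\<in>space M. X i \<omega> = m i \<omega> + q i \<omega>)))"

lemma r_nonneg: "i \<in> I \<Longrightarrow> 0 \<le> r i"
  using r_pos by (simp add: less_imp_le)

lemma increment_centered:
  assumes "order (\<lambda>i. r i * w i) m" "\<And>i. i \<in> I \<Longrightarrow> expectation (m i) = 0" "\<And>i. i \<in> I \<Longrightarrow> 0 \<le> w i"
  shows "increment w m"
proof -
  have "order (\<lambda>i. (r i)\<^sup>2 * w i) (\<lambda>i \<omega>. 0)" using assms(3) by (intro order_zero) simp
  with assms show ?thesis unfolding increment_def by (intro exI[of _ m] exI[of _ "\<lambda>i \<omega>. 0"]) auto
qed

lemma increment_small:
  assumes "order (\<lambda>i. (r i)\<^sup>2 * w i) q" "\<And>i. i \<in> I \<Longrightarrow> 0 \<le> w i"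
  shows "increment w q"
proof -
  have "order (\<lambda>i. r i * w i) (\<lambda>i \<omega>. 0)" using assms(2) r_nonneg by (intro order_zero) auto
  with assms show ?thesis unfolding increment_def by (intro exI[of _ "\<lambda>i \<omega>. 0"] exI[of _ q]) auto
qed

lemma increment_order:
  assumes "increment w X" shows "order (\<lambda>i. r i * w i) X"
proof -
  obtain m q where *: "order (\<lambda>i. r i * w i) m" "order (\<lambda>i. (r i)\<^sup>2 * w i) q"
    "\<And>i. i \<in> I \<Longrightarrow> 0 \<le> w i" "\<And>i \<omega>. i \<in> I \<Longrightarrow> \<omega> \<in> space M \<Longrightarrow> X i \<omega> = m i \<omega> + q i \<omega>"
    using assms unfolding increment_def by blast
  have "order (\<lambda>i. r i * w i) q"
  proof (rule order_mono[OF *(2), where K = "\<bar>R\<bar>"])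
    fix i assume i: "i \<in> I"
    show "(r i)\<^sup>2 * w i \<le> \<bar>R\<bar> * (r i * w i)"
      using r_le[OF i] r_nonneg[OF i] *(3)[OF i] by (auto simp: power2_eq_square mult.assoc intro!: mult_right_mono)
    show "0 \<le> r i * w i" using r_nonneg[OF i] *(3)[OF i] by simp
  qed simp
  then have "order (\<lambda>i. r i * w i) (\<lambda>i \<omega>. m i \<omega> + q i \<omega>)" by (rule order_add[OF *(1)])
  then show ?thesis by (rule order_cong) (simp add: *(4))
qed

lemma increment_cong:
  assumes "increment w X" "\<And>i \<omega>. i \<in> I \<Longrightarrow> \<omega> \<in> space M \<Longrightarrow> X i \<omega> = Y i \<omega>"
  shows "increment w Y"
  using assms(1) unfolding increment_def by (elim exE) (intro exI, auto simp flip: assms(2))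

lemma increment_mono:
  assumes X: "increment w X" and le: "\<And>i. i \<in> I \<Longrightarrow> w i \<le> K * w' i" and K: "K \<ge> 0"
    and nn: "\<And>i. i \<in> I \<Longrightarrow> 0 \<le> w' i"
  shows "increment w' X"
proof -
  obtain m q where *: "order (\<lambda>i. r i * w i) m" "order (\<lambda>i. (r i)\<^sup>2 * w i) q"
    "\<And>i. i \<in> I \<Longrightarrow> expectation (m i) = 0 \<and> 0 \<le> w i" "\<And>i \<omega>. i \<in> I \<Longrightarrow> \<omega> \<in> space M \<Longrightarrow> X i \<omega> = m i \<omega> + q i \<omega>"
    using X unfolding increment_def by blast
  have "order (\<lambda>i. r i * w' i) m"
    by (rule order_mono[OF *(1), where K = K]) (use mult_left_mono[OF le r_nonneg] K nn r_nonneg in \<open>auto simp: mult_ac\<close>)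
  moreover have "order (\<lambda>i. (r i)\<^sup>2 * w' i) q"
    by (rule order_mono[OF *(2), where K = K]) (use mult_left_mono[OF le, of _ "(r _)\<^sup>2"] K nn in \<open>auto simp: mult_ac\<close>)
  ultimately show ?thesis unfolding increment_def using * nn by blast
qed

lemma increment_add:
  fixes X Y :: "'i \<Rightarrow> 'w \<Rightarrow> 'b::euclidean_space"
  assumes X: "increment w X" and Y: "increment w Y"
  shows "increment w (\<lambda>i \<omega>. X i \<omega> + Y i \<omega>)"
proof -
  obtain m q where *: "order (\<lambda>i. r i * w i) m" "order (\<lambda>i. (r i)\<^sup>2 * w i) q"
    "\<And>i. i \<in> I \<Longrightarrow> expectation (m i) = 0 \<and> 0 \<le> w i" "\<And>i \<omega>. i \<in> I \<Longrightarrow> \<omega> \<in> space M \<Longrightarrow> X i \<omega> = m i \<omega> + q i \<omega>"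
    using X unfolding increment_def by blast
  obtain m' q' where **: "order (\<lambda>i. r i * w i) m'" "order (\<lambda>i. (r i)\<^sup>2 * w i) q'"
    "\<And>i. i \<in> I \<Longrightarrow> expectation (m' i) = 0" "\<And>i \<omega>. i \<in> I \<Longrightarrow> \<omega> \<in> space M \<Longrightarrow> Y i \<omega> = m' i \<omega> + q' i \<omega>"
    using Y unfolding increment_def by blast
  have "expectation (\<lambda>\<omega>. m i \<omega> + m' i \<omega>) = 0" if "i \<in> I" for i
    using *(3)[OF that] **(3)[OF that] order_integrable[OF *(1) that] order_integrable[OF **(1) that] by simp
  with * ** order_add[OF *(1) **(1)] order_add[OF *(2) **(2)] show ?thesis
    unfolding increment_def
    by (intro exI[of _ "\<lambda>i \<omega>. m i \<omega> + m' i \<omega>"] exI[of _ "\<lambda>i \<omega>. q i \<omega> + q' i \<omega>"]) simp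
qed

lemma increment_scaleR:
  fixes X :: "'i \<Rightarrow> 'w \<Rightarrow> real" and g :: "'i \<Rightarrow> 'b::euclidean_space"
  assumes X: "increment w X" and g: "\<And>i. i \<in> I \<Longrightarrow> norm (g i) \<le> K * c i" and c: "\<And>i. i \<in> I \<Longrightarrow> 0 \<le> c i"
  shows "increment (\<lambda>i. w i * c i) (\<lambda>i \<omega>. X i \<omega> *\<^sub>R g i)"
proof -
  obtain m q where *: "order (\<lambda>i. r i * w i) m" "order (\<lambda>i. (r i)\<^sup>2 * w i) q"
    "\<And>i. i \<in> I \<Longrightarrow> expectation (m i) = 0 \<and> 0 \<le> w i" "\<And>i \<omega>. i \<in> I \<Longrightarrow> \<omega> \<in> space M \<Longrightarrow> X i \<omega> = m i \<omega> + q i \<omega>"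
    using X unfolding increment_def by blast
  have g': "order c (\<lambda>i \<omega>. g i)" by (rule order_const[OF g c])
  have "expectation (\<lambda>\<omega>. m i \<omega> *\<^sub>R g i) = 0" if "i \<in> I" for i
    using *(3)[OF that] order_integrable[OF *(1) that] by (subst integral_scaleR_left) auto
  with * order_scaleR[OF *(1) g'] order_scaleR[OF *(2) g'] c show ?thesis
    unfolding increment_def
    by (intro exI[of _ "\<lambda>i \<omega>. m i \<omega> *\<^sub>R g i"] exI[of _ "\<lambda>i \<omega>. q i \<omega> *\<^sub>R g i"])
      (auto simp: mult.assoc scaleR_left.add)
qed

lemma increment_bounded_scaleR:
  fixes X :: "'i \<Rightarrow> 'w \<Rightarrow> real" and g :: "'i \<Rightarrow> 'b::euclidean_space"
  assumes "increment w X" "\<And>i. i \<in> I \<Longrightarrow> norm (g i) \<le> K"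
  shows "increment w (\<lambda>i \<omega>. X i \<omega> *\<^sub>R g i)"
  using increment_scaleR[OF assms(1), of g K "\<lambda>_. 1"] assms(2) by simp

lemma increment_zero: "(\<And>i. i \<in> I \<Longrightarrow> 0 \<le> w i) \<Longrightarrow> increment w (\<lambda>i \<omega>. 0)"
  by (rule increment_small[OF order_zero]) auto

lemma increment_sum:
  assumes "\<And>k. k \<in> A \<Longrightarrow> increment w (X k)" "\<And>i. i \<in> I \<Longrightarrow> 0 \<le> w i"
  shows "increment w (\<lambda>i \<omega>. \<Sum>k\<in>A. X k i \<omega>)"
  using assms by (induction A rule: infinite_finite_induct) (auto intro: increment_zero increment_add)

lemma increment_cmult:
  fixes X :: "'i \<Rightarrow> 'w \<Rightarrow> 'b::euclidean_space"
  assumes X: "increment w X"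
  shows "increment w (\<lambda>i \<omega>. a *\<^sub>R X i \<omega>)"
proof -
  obtain m q where *: "order (\<lambda>i. r i * w i) m" "order (\<lambda>i. (r i)\<^sup>2 * w i) q"
    "\<And>i. i \<in> I \<Longrightarrow> expectation (m i) = 0 \<and> 0 \<le> w i" "\<And>i \<omega>. i \<in> I \<Longrightarrow> \<omega> \<in> space M \<Longrightarrow> X i \<omega> = m i \<omega> + q i \<omega>"
    using X unfolding increment_def by blast
  have "order (\<lambda>i. r i * w i) (\<lambda>i \<omega>. a *\<^sub>R m i \<omega>)" "order (\<lambda>i. (r i)\<^sup>2 * w i) (\<lambda>i \<omega>. a *\<^sub>R q i \<omega>)"
    using order_dominated[OF *(1), of "\<lambda>i \<omega>. a *\<^sub>R m i \<omega>" "\<bar>a\<bar>"] order_measurable[OF *(1)]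
      order_dominated[OF *(2), of "\<lambda>i \<omega>. a *\<^sub>R q i \<omega>" "\<bar>a\<bar>"] order_measurable[OF *(2)] by auto
  with * show ?thesis unfolding increment_def
    by (intro exI[of _ "\<lambda>i \<omega>. a *\<^sub>R m i \<omega>"] exI[of _ "\<lambda>i \<omega>. a *\<^sub>R q i \<omega>"]) (auto simp: algebra_simps)
qed

lemma increment_diff:
  "increment w X \<Longrightarrow> increment w Y \<Longrightarrow> increment w (\<lambda>i \<omega>. X i \<omega> - Y i \<omega>)"
  using increment_add[OF _ increment_cmult, of w X Y "-1"] by simp

subsection \<open>Growth of moments in one step\<close>

text \<open>
  Here \<open>a\<close> plays the role of a squared norm before the step and \<open>a + b\<close> that of the squared norm after it. Only the mean of \<open>b\<close>
  has to be of order \<open>r^2 v\<close>, its size may be \<open>r v\<close>.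
\<close>

lemma power_growth:
  fixes a v :: "'i \<Rightarrow> real" and b :: "'i \<Rightarrow> 'w \<Rightarrow> real"
  assumes b: "order (\<lambda>i. r i * v i) b"
    and Eb: "\<And>i. i \<in> I \<Longrightarrow> expectation (b i) \<le> C1 * (r i)\<^sup>2 * v i" and C1: "C1 \<ge> 0"
    and av: "\<And>i. i \<in> I \<Longrightarrow> 0 \<le> a i \<and> a i \<le> v i"
    and nn: "\<And>i \<omega>. i \<in> I \<Longrightarrow> \<omega> \<in> space M \<Longrightarrow> 0 \<le> a i + b i \<omega>"
  obtains C where "C \<ge> 0"
    "\<And>i. i \<in> I \<Longrightarrow> (\<integral>\<^sup>+\<omega>. ennreal ((a i + b i \<omega>) ^ m) \<partial>M) \<le> ennreal (a i ^ m + C * (r i)\<^sup>2 * v i ^ m)"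
proof -
  \<comment> \<open>binomial expansion; the term of degree one is controlled by its mean, the others by size\<close>
  have "\<exists>C\<ge>0. \<forall>i\<in>I. real (m choose k) * (expectation (\<lambda>\<omega>. b i \<omega> ^ k) * a i ^ (m - k)) \<le>
     (if k = 0 then a i ^ m else C * (r i)\<^sup>2 * v i ^ m)" if k: "k \<le> m" for k
  proof -
    consider "k = 0" | "k = 1" | "k \<ge> 2" by linarith
    then show ?thesis
    proof cases
      case 1
      then show ?thesis by (auto simp: prob_space intro: exI[of _ 0])
    next
      case 2
      show ?thesis
      proof (intro exI[of _ "real m * C1"] conjI ballI)
        fix i assume i: "i \<in> I"
        have v: "0 \<le> v i" "a i ^ (m-1) \<le> v i ^ (m-1)" "0 \<le> a i" using av[OF i] by (auto intro: power_mono)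
        have "real m * (expectation (b i) * a i ^ (m-1)) \<le> real m * ((C1 * (r i)\<^sup>2 * v i) * v i ^ (m-1))"
          using v C1 Eb[OF i]
          by (intro mult_left_mono order_trans[OF mult_right_mono[OF Eb[OF i]] mult_left_mono]) auto
        also have "\<dots> = real m * C1 * (r i)\<^sup>2 * v i ^ m"
          using k 2 by (cases m) auto
        finally show "real (m choose k) * (expectation (\<lambda>\<omega>. b i \<omega> ^ k) * a i ^ (m - k)) \<le>
          (if k = 0 then a i ^ m else real m * C1 * (r i)\<^sup>2 * v i ^ m)" using 2 by simp
      qed (use C1 in simp)
    next
      case 3
      obtain C where C: "C \<ge> 0" "\<And>i. i \<in> I \<Longrightarrow> norm (expectation (\<lambda>\<omega>. b i \<omega> ^ k)) \<le> C * (r i * v i) ^ k"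
        using order_expectation[OF order_power[OF b, of k]] by metis
      show ?thesis
      proof (intro exI[of _ "real (m choose k) * (C * \<bar>R\<bar> ^ (k - 2))"] conjI ballI)
        fix i assume i: "i \<in> I"
        have v: "0 \<le> v i" "a i ^ (m-k) \<le> v i ^ (m-k)" "0 \<le> a i" "0 \<le> r i" "r i \<le> \<bar>R\<bar>"
          using av[OF i] r_nonneg[OF i] r_le[OF i] by (auto intro: power_mono)
        have "expectation (\<lambda>\<omega>. b i \<omega> ^ k) * a i ^ (m - k) \<le> (C * (r i * v i) ^ k) * v i ^ (m - k)"
          using v C(1) abs_le_D1[OF C(2)[OF i, unfolded real_norm_def]]
          by (intro order_trans[OF mult_right_mono mult_left_mono]) auto
        also have "\<dots> = C * (r i ^ (k - 2)) * (r i)\<^sup>2 * v i ^ m"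
        proof -
          obtain j n where "k = j + 2" "m = j + 2 + n" using 3 k by (metis le_Suc_ex add.commute)
          then show ?thesis by (simp add: power_mult_distrib power_add power2_eq_square)
        qed
        also have "\<dots> \<le> C * (\<bar>R\<bar> ^ (k - 2)) * (r i)\<^sup>2 * v i ^ m"
          using v C(1) by (intro mult_right_mono mult_left_mono power_mono) auto
        finally have "real (m choose k) * (expectation (\<lambda>\<omega>. b i \<omega> ^ k) * a i ^ (m - k))
          \<le> real (m choose k) * (C * (\<bar>R\<bar> ^ (k - 2)) * (r i)\<^sup>2 * v i ^ m)"
          by (rule mult_left_mono) simp
        then show "real (m choose k) * (expectation (\<lambda>\<omega>. b i \<omega> ^ k) * a i ^ (m - k)) \<le>
          (if k = 0 then a i ^ m else real (m choose k) * (C * \<bar>R\<bar> ^ (k - 2)) * (r i)\<^sup>2 * v i ^ m)"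
          using 3 by (simp add: mult.assoc)
      qed (use C in simp)
    qed
  qed
  then obtain c where c: "\<And>k. k \<le> m \<Longrightarrow> c k \<ge> 0"
    "\<And>k i. k \<le> m \<Longrightarrow> i \<in> I \<Longrightarrow> real (m choose k) * (expectation (\<lambda>\<omega>. b i \<omega> ^ k) * a i ^ (m - k)) \<le>
     (if k = 0 then a i ^ m else c k * (r i)\<^sup>2 * v i ^ m)" by metis
  have ge: "(\<Sum>k=1..m. c k) \<ge> 0" using c(1) by (auto intro: sum_nonneg)
  show ?thesis
  proof (rule that[OF ge])
    fix i assume i: "i \<in> I"
    have int: "integrable M (\<lambda>\<omega>. b i \<omega> ^ k)" for k
      using order_integrable[OF order_power[OF b] i] by simp
    have eq: "(a i + b i \<omega>) ^ m = (\<Sum>k\<le>m. real (m choose k) * (b i \<omega> ^ k * a i ^ (m - k)))" for \<omega>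
      using binomial_ring[of "b i \<omega>" "a i" m] by (simp add: add.commute mult.assoc)
    have "(\<integral>\<^sup>+\<omega>. ennreal ((a i + b i \<omega>) ^ m) \<partial>M) = ennreal (expectation (\<lambda>\<omega>. (a i + b i \<omega>) ^ m))"
    proof (rule nn_integral_eq_integral)
      show "integrable M (\<lambda>\<omega>. (a i + b i \<omega>) ^ m)"
        unfolding eq by (intro Bochner_Integration.integrable_sum integrable_mult_right integrable_mult_left int)
      show "AE \<omega> in M. 0 \<le> (a i + b i \<omega>) ^ m" using nn[OF i] by (intro AE_I2) simp
    qed
    also have "expectation (\<lambda>\<omega>. (a i + b i \<omega>) ^ m)
        = (\<Sum>k\<le>m. real (m choose k) * (expectation (\<lambda>\<omega>. b i \<omega> ^ k) * a i ^ (m - k)))"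
      unfolding eq by (subst Bochner_Integration.integral_sum) (auto simp: int)
    also have "\<dots> \<le> (\<Sum>k\<le>m. if k = 0 then a i ^ m else c k * (r i)\<^sup>2 * v i ^ m)"
      using c(2) i by (intro sum_mono) auto
    also have "\<dots> = a i ^ m + (\<Sum>k=1..m. c k) * (r i)\<^sup>2 * v i ^ m"
    proof -
      have "{..m} = insert 0 {1..m}" by auto
      then show ?thesis by (simp add: sum_distrib_right)
    qed
    finally show "(\<integral>\<^sup>+\<omega>. ennreal ((a i + b i \<omega>) ^ m) \<partial>M)
      \<le> ennreal (a i ^ m + (\<Sum>k=1..m. c k) * (r i)\<^sup>2 * v i ^ m)" by (simp add: ennreal_leI)
  qed
qed

text \<open>
  The squared norm changes by \<open>2 (U \<bullet> X) + \<bar>X\<bar>^2\<close>; the centered part of \<open>X\<close> drops out of the mean of the first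
  summand, so that this mean is of order \<open>r^2 (\<bar>U\<bar> + e)^2\<close>.
\<close>

lemma moment_growth:
  fixes U :: "'i \<Rightarrow> 'b::euclidean_space" and X :: "'i \<Rightarrow> 'w \<Rightarrow> 'b"
  assumes X: "increment (\<lambda>i. norm (U i) + e i) X" and e: "\<And>i. i \<in> I \<Longrightarrow> 0 \<le> e i"
  obtains C where "C \<ge> 0"
    "\<And>i. i \<in> I \<Longrightarrow> (\<integral>\<^sup>+\<omega>. ennreal (norm (U i + X i \<omega>) ^ (2*m)) \<partial>M)
       \<le> ennreal ((1 + C * (r i)\<^sup>2) * norm (U i) ^ (2*m) + C * (r i)\<^sup>2 * e i ^ (2*m))"
proof -
  define w where "w i = norm (U i) + e i" for i
  obtain M' q where *: "order (\<lambda>i. r i * w i) M'" "order (\<lambda>i. (r i)\<^sup>2 * w i) q"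
    "\<And>i. i \<in> I \<Longrightarrow> expectation (M' i) = 0" "\<And>i \<omega>. i \<in> I \<Longrightarrow> \<omega> \<in> space M \<Longrightarrow> X i \<omega> = M' i \<omega> + q i \<omega>"
    using X unfolding increment_def w_def by blast
  have w0: "0 \<le> w i" if "i \<in> I" for i using e[OF that] by (simp add: w_def)
  have oX: "order (\<lambda>i. r i * w i) X" using increment_order[OF X] unfolding w_def .
  have nX: "order (\<lambda>i. (r i * w i)\<^sup>2) (\<lambda>i \<omega>. (norm (X i \<omega>))\<^sup>2)"
    by (rule order_power[OF order_norm[OF oX]])
  have iU: "order (\<lambda>i. w i * s i) (\<lambda>i \<omega>. U i \<bullet> Y i \<omega>)" if Y: "order s Y" for s Y
  proof -
    have "order w (\<lambda>i \<omega>. norm (U i))" using e w0 by (intro order_const[of _ 1]) (auto simp: w_def)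
    from order_mult[OF this order_norm[OF Y]] show ?thesis
      by (rule order_dominated[where K = 1])
        (use order_measurable[OF Y] Cauchy_Schwarz_ineq2 in \<open>auto intro!: borel_measurable_inner\<close>)
  qed
  \<comment> \<open>the change of the squared norm in the step\<close>
  define b where "b i \<omega> = 2 * (U i \<bullet> X i \<omega>) + (norm (X i \<omega>))\<^sup>2" for i \<omega>
  define v where "v i = (w i)\<^sup>2" for i
  have sq: "(norm (U i + X i \<omega>))\<^sup>2 = (norm (U i))\<^sup>2 + b i \<omega>" for i \<omega>
    unfolding b_def power2_norm_eq_inner by (simp add: inner_add inner_commute)
  have ob: "order (\<lambda>i. r i * v i) b"
    unfolding b_def
  proof (intro order_add)
    have "order (\<lambda>i. 1 * (w i * (r i * w i))) (\<lambda>i \<omega>. 2 * (U i \<bullet> X i \<omega>))"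
      by (intro order_mult order_const[of _ 2] iU oX) auto
    then show "order (\<lambda>i. r i * v i) (\<lambda>i \<omega>. 2 * (U i \<bullet> X i \<omega>))"
      by (simp add: v_def power2_eq_square mult_ac)
    show "order (\<lambda>i. r i * v i) (\<lambda>i \<omega>. (norm (X i \<omega>))\<^sup>2)"
    proof (rule order_mono[OF nX, where K = "\<bar>R\<bar>"])
      fix i assume i: "i \<in> I"
      have "r i * (r i * v i) \<le> \<bar>R\<bar> * (r i * v i)"
        using r_nonneg[OF i] r_le[OF i] by (intro mult_right_mono) (auto simp: v_def)
      then show "(r i * w i)\<^sup>2 \<le> \<bar>R\<bar> * (r i * v i)" by (simp add: v_def power2_eq_square mult_ac)
      show "0 \<le> r i * v i" using r_nonneg[OF i] by (simp add: v_def)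
    qed simp
  qed
  obtain C2 where C2: "C2 \<ge> 0" "\<And>i. i \<in> I \<Longrightarrow> norm (expectation (\<lambda>\<omega>. U i \<bullet> q i \<omega>)) \<le> C2 * (w i * ((r i)\<^sup>2 * w i))"
    using order_expectation[OF iU[OF *(2)]] by metis
  obtain C3 where C3: "C3 \<ge> 0" "\<And>i. i \<in> I \<Longrightarrow> norm (expectation (\<lambda>\<omega>. (norm (X i \<omega>))\<^sup>2)) \<le> C3 * (r i * w i)\<^sup>2"
    using order_expectation[OF nX] by metis
  have Eb: "expectation (b i) \<le> (2 * C2 + C3) * (r i)\<^sup>2 * v i" if i: "i \<in> I" for i
  proof -
    have "expectation (b i) = expectation (\<lambda>\<omega>. 2 * (U i \<bullet> M' i \<omega>) + 2 * (U i \<bullet> q i \<omega>) + (norm (X i \<omega>))\<^sup>2)"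
      unfolding b_def by (rule Bochner_Integration.integral_cong) (auto simp: *(4)[OF i] inner_add)
    also have "\<dots> = 2 * (U i \<bullet> expectation (M' i)) + 2 * expectation (\<lambda>\<omega>. U i \<bullet> q i \<omega>) + expectation (\<lambda>\<omega>. (norm (X i \<omega>))\<^sup>2)"
      using order_integrable[OF iU[OF *(1)] i] order_integrable[OF iU[OF *(2)] i] order_integrable[OF nX i]
        order_integrable[OF *(1) i] by simp
    also have "\<dots> \<le> 2 * (C2 * (w i * ((r i)\<^sup>2 * w i))) + C3 * (r i * w i)\<^sup>2"
      using *(3)[OF i] C2(2)[OF i] C3(2)[OF i] by simp
    also have "\<dots> = (2 * C2 + C3) * (r i)\<^sup>2 * v i" by (simp add: v_def power2_eq_square algebra_simps)
    finally show ?thesis .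
  qed
  obtain C where C: "C \<ge> 0" "\<And>i. i \<in> I \<Longrightarrow> (\<integral>\<^sup>+\<omega>. ennreal (((norm (U i))\<^sup>2 + b i \<omega>) ^ m) \<partial>M)
      \<le> ennreal (((norm (U i))\<^sup>2) ^ m + C * (r i)\<^sup>2 * v i ^ m)"
  proof (rule power_growth[OF ob Eb, where a="\<lambda>i. (norm (U i))\<^sup>2" and m=m])
    show "0 \<le> (norm (U i))\<^sup>2 \<and> (norm (U i))\<^sup>2 \<le> v i" if "i \<in> I" for i
      using e[OF that] by (auto simp: v_def w_def intro!: power_mono)
    show "0 \<le> (norm (U i))\<^sup>2 + b i \<omega>" for i \<omega> unfolding sq[symmetric] by simp
  qed (use C2 C3 in auto)
  show ?thesis
  proof (rule that[of "C * 2^(2*m)"])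
    fix i assume i: "i \<in> I"
    have "(\<integral>\<^sup>+\<omega>. ennreal (norm (U i + X i \<omega>) ^ (2*m)) \<partial>M)
        \<le> ennreal (norm (U i) ^ (2*m) + C * (r i)\<^sup>2 * w i ^ (2*m))"
      using C(2)[OF i] unfolding power_mult sq v_def .
    also have "\<dots> \<le> ennreal (norm (U i) ^ (2*m) + C * (r i)\<^sup>2 * (2^(2*m) * (norm (U i) ^ (2*m) + e i ^ (2*m))))"
      unfolding w_def using C(1) e[OF i]
      by (intro ennreal_leI add_left_mono mult_left_mono power_add_le) auto
    also have "\<dots> = ennreal ((1 + C * 2^(2*m) * (r i)\<^sup>2) * norm (U i) ^ (2*m) + C * 2^(2*m) * (r i)\<^sup>2 * e i ^ (2*m))"
      by (simp add: algebra_simps)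
    finally show "(\<integral>\<^sup>+\<omega>. ennreal (norm (U i + X i \<omega>) ^ (2*m)) \<partial>M)
       \<le> ennreal ((1 + C * 2^(2*m) * (r i)\<^sup>2) * norm (U i) ^ (2*m) + C * 2^(2*m) * (r i)\<^sup>2 * e i ^ (2*m))" .
  qed (use C in simp)
qed

end

section \<open>Independent sub-sigma-algebras\<close>

lemma (in prob_space) indep_var_subalgebra:
  assumes ind: "indep_set (sets G) (sets H)" and G: "subalgebra M G" and H: "subalgebra M H"
    and X: "X \<in> measurable G S" and Y: "Y \<in> measurable H T"
  shows "indep_var S X T Y"
  unfolding indep_var_eq
proof (intro conjI)
  show "random_variable S X" "random_variable T Y"
    using measurable_from_subalg[OF G X] measurable_from_subalg[OF H Y] by auto
  have GX: "sigma_sets (space M) {X -` A \<inter> space M |A. A \<in> sets S} \<subseteq> sets G"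
    using X G measurable_sets[OF X] sets.sigma_sets_subset[of "{X -` A \<inter> space M |A. A \<in> sets S}" G]
    by (auto simp: subalgebra_def)
  have HY: "sigma_sets (space M) {Y -` A \<inter> space M |A. A \<in> sets T} \<subseteq> sets H"
    using Y H measurable_sets[OF Y] sets.sigma_sets_subset[of "{Y -` A \<inter> space M |A. A \<in> sets T}" H]
    by (auto simp: subalgebra_def)
  show "indep_set (sigma_sets (space M) {X -` A \<inter> space M |A. A \<in> sets S})
     (sigma_sets (space M) {Y -` A \<inter> space M |A. A \<in> sets T})"
    using ind GX HY unfolding indep_sets2_eq by (meson subset_iff)
qed

lemma (in prob_space) indep_set_commute: "indep_set A B \<Longrightarrow> indep_set B A"
  unfolding indep_sets2_eq by (metis Int_commute mult.commute)

lemma (in prob_space) expectation_indep_scaleR: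
  fixes X :: "'a \<Rightarrow> 'b::euclidean_space" and n :: "'a \<Rightarrow> real"
  assumes ind: "indep_set (sets G) (sets H)" and G: "subalgebra M G" and H: "subalgebra M H"
    and X: "X \<in> borel_measurable G" "integrable M X" and n: "n \<in> borel_measurable H" "integrable M n"
    and int: "integrable M (\<lambda>\<omega>. n \<omega> *\<^sub>R X \<omega>)"
  shows "expectation (\<lambda>\<omega>. n \<omega> *\<^sub>R X \<omega>) = expectation n *\<^sub>R expectation X"
proof (rule euclidean_eqI)
  fix v :: 'b assume "v \<in> Basis"
  have Xv: "(\<lambda>\<omega>. X \<omega> \<bullet> v) \<in> borel_measurable G" using X(1) by measurable
  have "expectation (\<lambda>\<omega>. n \<omega> *\<^sub>R X \<omega>) \<bullet> v = expectation (\<lambda>\<omega>. n \<omega> *\<^sub>R X \<omega> \<bullet> v)"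
    using int by (rule integral_inner_left[symmetric])
  also have "\<dots> = expectation (\<lambda>\<omega>. (X \<omega> \<bullet> v) * n \<omega>)"
    by (simp add: mult.commute)
  also have "\<dots> = expectation (\<lambda>\<omega>. X \<omega> \<bullet> v) * expectation n"
    using X n by (intro indep_var_lebesgue_integral indep_var_subalgebra[OF ind G H Xv]) auto
  also have "\<dots> = expectation n *\<^sub>R expectation X \<bullet> v"
    using X(2) by simp
  finally show "expectation (\<lambda>\<omega>. n \<omega> *\<^sub>R X \<omega>) \<bullet> v = expectation n *\<^sub>R expectation X \<bullet> v" .
qed

lemma borel_measurable_vec_nth:
  fixes f :: "'a \<Rightarrow> real^'n::finite"
  assumes "f \<in> borel_measurable N" shows "(\<lambda>x. f x $ k) \<in> borel_measurable N"
  by (rule measurable_compose[OF assms borel_measurable_continuous_onI])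
    (intro continuous_intros)

section \<open>One step of the scheme\<close>

definition second_part ::
  "real \<Rightarrow> nat \<Rightarrow> (nat \<Rightarrow> real^'n::finite \<Rightarrow> real^'n) \<Rightarrow> (nat \<Rightarrow> nat \<Rightarrow> real) \<Rightarrow> (nat \<Rightarrow> nat \<Rightarrow> real) \<Rightarrow> real^'n \<Rightarrow> real^'n"
  where "second_part \<theta> d \<sigma> e a z =
    (\<Sum>j1=0..d. \<Sum>j2=0..d. e j1 j2 *\<^sub>R lie_op d \<sigma> j1 (\<sigma> j2) z)
    + (\<theta> / 2) *\<^sub>R (\<Sum>j2=1..d. \<Sum>j1=1..<j2. a j1 j2 *\<^sub>R lie_bracket d \<sigma> j1 j2 z)"

text \<open>
  The integrator as a function of the numerical values of its noise: first order weights \<open>b\<close>, iterated integrals \<open>e\<close>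
  and area products \<open>a\<close>. This form allows replacing the iterated integrals by almost surely equal versions.
\<close>

definition ito_step ::
  "real \<Rightarrow> nat \<Rightarrow> (nat \<Rightarrow> real^'n::finite \<Rightarrow> real^'n) \<Rightarrow> (nat \<Rightarrow> real) \<Rightarrow> (nat \<Rightarrow> nat \<Rightarrow> real) \<Rightarrow>
    (nat \<Rightarrow> nat \<Rightarrow> real) \<Rightarrow> real^'n \<Rightarrow> real^'n"
  where "ito_step \<theta> d \<sigma> b e a z = z + (\<Sum>j=0..d. b j *\<^sub>R \<sigma> j z) + second_part \<theta> d \<sigma> e a z"

lemma integrator_eq_ito_step:
  "integrator \<theta> M F N d \<sigma> B Bt \<omega> t s = ito_step \<theta> d \<sigma> (\<lambda>j. incr B j t s \<omega>)
     (\<lambda>j1 j2. eta_incr M F N B j1 j2 t s \<omega>) (\<lambda>j1 j2. area_incr B Bt j1 j2 t s \<omega>)"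
  by (simp add: integrator_def ito_step_def second_part_def fun_eq_iff add.assoc)

context small_steps
begin

text \<open>
  Of the weights of second order, only the one with both indices zero has a mean; it is a multiple of the squared
  step size, that is, of order \<open>r^4\<close>.
\<close>

definition second_order :: "('i \<Rightarrow> 'w measure) \<Rightarrow> ('i \<Rightarrow> 'w \<Rightarrow> real) \<Rightarrow> bool"
  where "second_order H n \<longleftrightarrow> order (\<lambda>i. (r i)\<^sup>2) n \<and> (\<forall>i\<in>I. n i \<in> borel_measurable (H i)) \<and>
    ((\<forall>i\<in>I. expectation (n i) = 0) \<or> order (\<lambda>i. r i ^ 4) n)"

text \<open>
  What the expansions need to know about the weights of one (half) step: their size, their means and the
  sigma-algebra in which they live. The weights with a time index are smaller by one order of \<open>r\<close>, which makes
  them negligible increments of order \<open>r^2\<close>.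
\<close>

definition noise ::
  "nat \<Rightarrow> ('i \<Rightarrow> 'w measure) \<Rightarrow> (nat \<Rightarrow> 'i \<Rightarrow> 'w \<Rightarrow> real) \<Rightarrow>
    (nat \<Rightarrow> nat \<Rightarrow> 'i \<Rightarrow> 'w \<Rightarrow> real) \<Rightarrow> (nat \<Rightarrow> nat \<Rightarrow> 'i \<Rightarrow> 'w \<Rightarrow> real) \<Rightarrow> bool"
  where "noise d H b e a \<longleftrightarrow>
    (\<forall>i\<in>I. subalgebra M (H i)) \<and>
    (\<forall>j\<in>{0..d}. order r (b j) \<and> (\<forall>i\<in>I. b j i \<in> borel_measurable (H i))) \<and>
    (\<forall>j\<in>{1..d}. \<forall>i\<in>I. expectation (b j i) = 0) \<and>
    order (\<lambda>i. (r i)\<^sup>2) (b 0) \<and>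
    (\<forall>j1\<in>{0..d}. \<forall>j2\<in>{0..d}. second_order H (e j1 j2)) \<and>
    (\<forall>j\<in>{0..d}. increment (\<lambda>i. (r i)\<^sup>2) (e 0 j) \<and> increment (\<lambda>i. (r i)\<^sup>2) (e j 0)) \<and>
    (\<forall>j2\<in>{1..d}. \<forall>j1\<in>{1..<j2}. second_order H (a j1 j2))"

lemma r_power_mono:
  assumes X: "order (\<lambda>i. r i ^ n) X" and nm: "m \<le> n"
  shows "order (\<lambda>i. r i ^ m) X"
proof (rule order_mono[OF X, where K = "\<bar>R\<bar> ^ (n - m)"])
  fix i assume i: "i \<in> I"
  have "r i ^ (n - m) * r i ^ m \<le> \<bar>R\<bar> ^ (n - m) * r i ^ m"
    using r_nonneg[OF i] r_le[OF i] by (intro mult_right_mono power_mono) auto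
  then show "r i ^ n \<le> \<bar>R\<bar> ^ (n - m) * r i ^ m"
    using nm by (simp flip: power_add)
qed (use r_nonneg in auto)

lemma second_order_increment:
  assumes "second_order H n" shows "increment r n"
proof -
  have "increment r n" if "\<forall>i\<in>I. expectation (n i) = 0"
    using assms that r_nonneg unfolding second_order_def
    by (intro increment_centered) (auto simp: power2_eq_square)
  moreover have "increment r n" if "order (\<lambda>i. r i ^ 4) n"
    using r_power_mono[OF that, of 3] r_nonneg
    by (intro increment_small) (auto simp: power2_eq_square power3_eq_cube)
  ultimately show ?thesis using assms unfolding second_order_def by blast
qed

lemma order_bdd_lip_shift:
  fixes g :: "'a::euclidean_space \<Rightarrow> 'b::euclidean_space"
  assumes g: "bdd_lip g" and P: "order s P"
  shows "order s (\<lambda>i \<omega>. g (f i + P i \<omega>) - g (f i))"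
proof -
  obtain K where K: "K \<ge> 0" "\<And>a b. norm (g a - g b) \<le> K * norm (a - b)"
    using bdd_lipE[OF g] by metis
  show ?thesis
  proof (rule order_dominated[OF P _ _ K(1)])
    show "(\<lambda>\<omega>. g (f i + P i \<omega>) - g (f i)) \<in> borel_measurable M" if "i \<in> I" for i
      using order_measurable[OF P that] bdd_lip_measurable[OF g] by measurable
    show "norm (g (f i + P i \<omega>) - g (f i)) \<le> K * norm (P i \<omega>)" for i \<omega>
      using K(2)[of "f i + P i \<omega>" "f i"] by simp
  qed
qed

lemma expectation_indep_zero:
  fixes X :: "'i \<Rightarrow> 'w \<Rightarrow> 'b::euclidean_space"
  assumes X: "order s X" "\<And>i. i \<in> I \<Longrightarrow> X i \<in> borel_measurable (G i)"
    and n: "order s' n" "\<And>i. i \<in> I \<Longrightarrow> n i \<in> borel_measurable (H i)"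
    and sub: "\<And>i. i \<in> I \<Longrightarrow> subalgebra M (G i)" "\<And>i. i \<in> I \<Longrightarrow> subalgebra M (H i)"
    and ind: "\<And>i. i \<in> I \<Longrightarrow> indep_set (sets (G i)) (sets (H i))"
    and zero: "expectation (n i) = 0 \<or> expectation (X i) = 0" and i: "i \<in> I"
  shows "expectation (\<lambda>\<omega>. n i \<omega> *\<^sub>R X i \<omega>) = 0"
  using expectation_indep_scaleR[OF ind[OF i] sub(1)[OF i] sub(2)[OF i] X(2)[OF i] order_integrable[OF X(1) i]
      n(2)[OF i] order_integrable[OF n(1) i] order_integrable[OF order_scaleR[OF n(1) X(1)] i]] zero
  by auto

text \<open>
  The factor depends on the first half step and the weight on the second one. So the product stays centered, and
  the Lipschitz bound yields one additional order.
\<close>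

lemma second_order_shift:
  fixes g :: "'a::euclidean_space \<Rightarrow> 'b::euclidean_space"
  assumes n: "second_order H n" and g: "bdd_lip g"
    and P: "order r P" "\<And>i. i \<in> I \<Longrightarrow> P i \<in> borel_measurable (G i)"
    and sub: "\<And>i. i \<in> I \<Longrightarrow> subalgebra M (G i)" "\<And>i. i \<in> I \<Longrightarrow> subalgebra M (H i)"
    and ind: "\<And>i. i \<in> I \<Longrightarrow> indep_set (sets (G i)) (sets (H i))"
  shows "increment (\<lambda>i. (r i)\<^sup>2) (\<lambda>i \<omega>. n i \<omega> *\<^sub>R (g (f i + P i \<omega>) - g (f i)))"
proof -
  define X where "X i \<omega> = g (f i + P i \<omega>) - g (f i)" for i \<omega>
  have X: "order r X" unfolding X_def by (rule order_bdd_lip_shift[OF g P(1)])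
  have Xm: "X i \<in> borel_measurable (G i)" if "i \<in> I" for i
    using P(2)[OF that] bdd_lip_measurable[OF g] unfolding X_def by measurable
  have n': "order (\<lambda>i. (r i)\<^sup>2) n" "\<And>i. i \<in> I \<Longrightarrow> n i \<in> borel_measurable (H i)"
    using n by (auto simp: second_order_def)
  have "increment (\<lambda>i. (r i)\<^sup>2) (\<lambda>i \<omega>. n i \<omega> *\<^sub>R X i \<omega>)"
  proof (cases "\<forall>i\<in>I. expectation (n i) = 0")
    case True
    have "order (\<lambda>i. r i * (r i)\<^sup>2) (\<lambda>i \<omega>. n i \<omega> *\<^sub>R X i \<omega>)"
      using order_scaleR[OF n'(1) X] by (simp add: mult.commute)
    then show ?thesis
      using expectation_indep_zero[OF X Xm n' sub ind] True by (intro increment_centered) auto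
  next
    case False
    with n have "order (\<lambda>i. r i ^ 4) n" by (auto simp: second_order_def)
    from order_scaleR[OF this X] have "order (\<lambda>i. r i ^ 5) (\<lambda>i \<omega>. n i \<omega> *\<^sub>R X i \<omega>)"
      by (simp add: eval_nat_numeral mult_ac)
    from r_power_mono[OF this, of 4] show ?thesis
      by (intro increment_small) (auto simp: eval_nat_numeral mult_ac)
  qed
  then show ?thesis unfolding X_def .
qed

lemma order_bounded_scaleR:
  fixes X :: "'i \<Rightarrow> 'w \<Rightarrow> real" and g :: "'i \<Rightarrow> 'b::euclidean_space"
  assumes X: "order s X" and g: "\<And>i. i \<in> I \<Longrightarrow> norm (g i) \<le> K"
  shows "order s (\<lambda>i \<omega>. X i \<omega> *\<^sub>R g i)"
proof -
  have "order (\<lambda>_. 1) (\<lambda>i \<omega>. g i)" using g by (intro order_const[of _ K]) auto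
  from order_scaleR[OF X this] show ?thesis by simp
qed

end

locale coefficients = small_steps M I r R for M :: "'w measure" and I :: "'i set" and r R +
  fixes d :: nat and \<sigma> :: "nat \<Rightarrow> real^'n::finite \<Rightarrow> real^'n"
  assumes \<sigma>: "\<And>j. j \<in> {0..d} \<Longrightarrow> Cb_inf (\<sigma> j)"
begin

lemma \<sigma>_bdd_lip: "j \<le> d \<Longrightarrow> bdd_lip (\<sigma> j)"
  using \<sigma> by (intro Cb_inf_bdd_lip) auto

lemma lie_op_bdd_lip: "i \<le> d \<Longrightarrow> j \<le> d \<Longrightarrow> bdd_lip (lie_op d \<sigma> i (\<sigma> j))"
  using \<sigma> by (intro bdd_lip_lie_op) auto

lemma lie_bracket_bdd_lip: "i \<le> d \<Longrightarrow> j \<le> d \<Longrightarrow> bdd_lip (lie_bracket d \<sigma> i j)"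
  using \<sigma> by (intro bdd_lip_lie_bracket) auto

lemma second_part_measurable:
  assumes "Z \<in> borel_measurable N"
    and "\<And>j1 j2. j1 \<le> d \<Longrightarrow> j2 \<le> d \<Longrightarrow> (\<lambda>\<omega>. e j1 j2 \<omega>) \<in> borel_measurable N"
    and "\<And>j1 j2. 1 \<le> j1 \<Longrightarrow> j1 < j2 \<Longrightarrow> j2 \<le> d \<Longrightarrow> (\<lambda>\<omega>. a j1 j2 \<omega>) \<in> borel_measurable N"
  shows "(\<lambda>\<omega>. second_part \<theta> d \<sigma> (\<lambda>j1 j2. e j1 j2 \<omega>) (\<lambda>j1 j2. a j1 j2 \<omega>) (Z \<omega>)) \<in> borel_measurable N"
  unfolding second_part_def
  by (intro borel_measurable_add borel_measurable_scaleR borel_measurable_sum borel_measurable_const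
      measurable_compose[OF assms(1) bdd_lip_measurable[OF lie_op_bdd_lip]]
      measurable_compose[OF assms(1) bdd_lip_measurable[OF lie_bracket_bdd_lip]] assms(2,3)) auto

lemma ito_step_measurable:
  assumes "Z \<in> borel_measurable N"
    and "\<And>j. j \<le> d \<Longrightarrow> (\<lambda>\<omega>. b j \<omega>) \<in> borel_measurable N"
    and "\<And>j1 j2. j1 \<le> d \<Longrightarrow> j2 \<le> d \<Longrightarrow> (\<lambda>\<omega>. e j1 j2 \<omega>) \<in> borel_measurable N"
    and "\<And>j1 j2. 1 \<le> j1 \<Longrightarrow> j1 < j2 \<Longrightarrow> j2 \<le> d \<Longrightarrow> (\<lambda>\<omega>. a j1 j2 \<omega>) \<in> borel_measurable N"
  shows "(\<lambda>\<omega>. ito_step \<theta> d \<sigma> (\<lambda>j. b j \<omega>) (\<lambda>j1 j2. e j1 j2 \<omega>) (\<lambda>j1 j2. a j1 j2 \<omega>) (Z \<omega>)) \<in> borel_measurable N"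
  unfolding ito_step_def
  by (intro borel_measurable_add borel_measurable_scaleR borel_measurable_sum
      measurable_compose[OF assms(1) bdd_lip_measurable[OF \<sigma>_bdd_lip]]
      second_part_measurable assms) auto

lemma increment_coefficient:
  assumes "increment w X" "bdd_lip g"
  shows "increment w (\<lambda>i \<omega>. X i \<omega> *\<^sub>R g (z i))"
proof -
  obtain K where "\<And>a. norm (g a) \<le> K" using bdd_lipE[OF assms(2)] by metis
  then show ?thesis by (intro increment_bounded_scaleR[OF assms(1)])
qed

lemma order_coefficient:
  assumes "order w X" "bdd_lip g"
  shows "order w (\<lambda>i \<omega>. X i \<omega> *\<^sub>R g (z i))"
proof -
  obtain K where "\<And>a. norm (g a) \<le> K" using bdd_lipE[OF assms(2)] by metis
  then show ?thesis by (intro order_bounded_scaleR[OF assms(1)])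
qed

abbreviation second_at where
  "second_at \<theta> e a i \<omega> \<equiv> second_part \<theta> d \<sigma> (\<lambda>j1 j2. e j1 j2 i \<omega>) (\<lambda>j1 j2. a j1 j2 i \<omega>)"

abbreviation step_at where
  "step_at \<theta> b e a i \<omega> \<equiv> ito_step \<theta> d \<sigma> (\<lambda>j. b j i \<omega>) (\<lambda>j1 j2. e j1 j2 i \<omega>) (\<lambda>j1 j2. a j1 j2 i \<omega>)"

lemma second_part_order:
  assumes "noise d H b e a"
  shows "order (\<lambda>i. (r i)\<^sup>2) (\<lambda>i \<omega>. second_at \<theta> e a i \<omega> (z i))"
proof -
  have e: "order (\<lambda>i. (r i)\<^sup>2) (e j1 j2)" if "j1 \<le> d" "j2 \<le> d" for j1 j2
    using assms that by (auto simp: noise_def second_order_def)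
  have a: "order (\<lambda>i. (r i)\<^sup>2) (a j1 j2)" if "1 \<le> j1" "j1 < j2" "j2 \<le> d" for j1 j2
    using assms that by (auto simp: noise_def second_order_def)
  have t: "order (\<lambda>_. 1) (\<lambda>i \<omega>. \<theta> / 2)" by (rule order_const[of _ "\<bar>\<theta> / 2\<bar>"]) auto
  have ee: "order (\<lambda>i. (r i)\<^sup>2) (\<lambda>i \<omega>. \<Sum>j1=0..d. \<Sum>j2=0..d. e j1 j2 i \<omega> *\<^sub>R lie_op d \<sigma> j1 (\<sigma> j2) (z i))"
    by (intro order_sum order_coefficient e lie_op_bdd_lip) auto
  have "order (\<lambda>i. (r i)\<^sup>2) (\<lambda>i \<omega>. \<Sum>j2=1..d. \<Sum>j1=1..<j2. a j1 j2 i \<omega> *\<^sub>R lie_bracket d \<sigma> j1 j2 (z i))"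
    by (intro order_sum order_coefficient a lie_bracket_bdd_lip) auto
  from order_add[OF ee order_scaleR[OF t this, simplified]] show ?thesis
    unfolding second_part_def by simp
qed

text \<open>
  The operators with positive index are directional derivatives along the diffusion fields.
\<close>

lemma lie_op_sum:
  assumes "\<And>i. i \<in> A \<Longrightarrow> i \<noteq> 0"
  shows "(\<Sum>k\<in>UNIV. ((\<Sum>i\<in>A. b i *\<^sub>R \<sigma> i z) $ k) *\<^sub>R pderiv_at k g z) = (\<Sum>i\<in>A. b i *\<^sub>R lie_op d \<sigma> i g z)"
proof -
  have "(\<Sum>i\<in>A. b i *\<^sub>R lie_op d \<sigma> i g z) = (\<Sum>i\<in>A. \<Sum>k\<in>UNIV. (b i * \<sigma> i z $ k) *\<^sub>R pderiv_at k g z)"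
    using assms by (intro sum.cong) (auto simp: lie_op_def scaleR_sum_right)
  also have "\<dots> = (\<Sum>k\<in>UNIV. \<Sum>i\<in>A. (b i * \<sigma> i z $ k) *\<^sub>R pderiv_at k g z)"
    by (rule sum.swap)
  finally show ?thesis by (simp add: scaleR_sum_left)
qed

text \<open>
  The linear part of the Taylor expansion sees the half step \<open>P\<close> only through its leading part, the Brownian increments;
  everything else in \<open>P\<close> is of order \<open>r^2\<close>. Derivatives along these increments are the operators
  \<open>lie_op\<close> of positive index.
\<close>

lemma coefficient_after_step:
  fixes z :: "'i \<Rightarrow> real^'n" and \<theta> :: real
  assumes N: "noise d G b e a" and j: "j \<le> d"
  defines "P \<equiv> \<lambda>i \<omega>. (\<Sum>k=0..d. b k i \<omega> *\<^sub>R \<sigma> k (z i)) + second_at \<theta> e a i \<omega> (z i)"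
  shows "order r P" "\<And>i. i \<in> I \<Longrightarrow> P i \<in> borel_measurable (G i)"
    "order (\<lambda>i. (r i)\<^sup>2) (\<lambda>i \<omega>. \<sigma> j (z i + P i \<omega>) - \<sigma> j (z i) - (\<Sum>k=1..d. b k i \<omega> *\<^sub>R lie_op d \<sigma> k (\<sigma> j) (z i)))"
proof -
  \<comment> \<open>the part of the half step beyond the Brownian increments\<close>
  define P2 where "P2 i \<omega> = b 0 i \<omega> *\<^sub>R \<sigma> 0 (z i) + second_at \<theta> e a i \<omega> (z i)" for i \<omega>
  have b: "order r (b k)" "\<And>i. i \<in> I \<Longrightarrow> b k i \<in> borel_measurable (G i)" if "k \<le> d" for k
    using N that by (auto simp: noise_def)
  have b0: "order (\<lambda>i. (r i)\<^sup>2) (b 0)" using N by (simp add: noise_def)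
  have P2: "order (\<lambda>i. (r i)\<^sup>2) P2" unfolding P2_def
    by (intro order_add order_coefficient b0 second_part_order[OF N] \<sigma>_bdd_lip) simp
  have P12: "P i \<omega> = (\<Sum>k=1..d. b k i \<omega> *\<^sub>R \<sigma> k (z i)) + P2 i \<omega>" for i \<omega>
  proof -
    have "{0..d} = insert 0 {1..d}" by auto
    then show ?thesis by (simp add: P_def P2_def algebra_simps)
  qed
  have "order r (\<lambda>i \<omega>. \<Sum>k=1..d. b k i \<omega> *\<^sub>R \<sigma> k (z i))"
    by (intro order_sum order_coefficient b \<sigma>_bdd_lip r_nonneg) auto
  from order_add[OF this r_power_mono[OF P2, of 1, simplified]] show P: "order r P"
    by (simp add: P12[abs_def])
  show "P i \<in> borel_measurable (G i)" if i: "i \<in> I" for i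
  proof -
    have "second_order G (e j1 j2)" if "j1 \<le> d" "j2 \<le> d" for j1 j2 using N that by (auto simp: noise_def)
    then have e: "e j1 j2 i \<in> borel_measurable (G i)" if "j1 \<le> d" "j2 \<le> d" for j1 j2
      using i that by (auto simp: second_order_def)
    have "second_order G (a j1 j2)" if "1 \<le> j1" "j1 < j2" "j2 \<le> d" for j1 j2 using N that by (auto simp: noise_def)
    then have a: "a j1 j2 i \<in> borel_measurable (G i)" if "1 \<le> j1" "j1 < j2" "j2 \<le> d" for j1 j2
      using i that by (auto simp: second_order_def)
    show ?thesis unfolding P_def
      by (intro borel_measurable_add borel_measurable_sum borel_measurable_scaleR
         borel_measurable_const b(2) i second_part_measurable e a) auto
  qed
  obtain K where K: "K \<ge> 0" "\<And>x y. norm (\<sigma> j y - \<sigma> j x - (\<Sum>k\<in>UNIV. ((y - x) $ k) *\<^sub>R pderiv_at k (\<sigma> j) x)) \<le> K * (norm (y - x))\<^sup>2"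
    using Cb_2_taylor[OF Cb_inf_Cb[OF \<sigma>[of j]]] j by auto
  define T where "T i \<omega> = \<sigma> j (z i + P i \<omega>) - \<sigma> j (z i) - (\<Sum>k\<in>UNIV. (P i \<omega> $ k) *\<^sub>R pderiv_at k (\<sigma> j) (z i))" for i \<omega>
  have T: "order (\<lambda>i. (r i)\<^sup>2) T"
  proof (rule order_dominated[OF order_power[OF order_norm[OF P], of 2] _ _ K(1)])
    show "norm (T i \<omega>) \<le> K * norm ((norm (P i \<omega>))\<^sup>2)" for i \<omega>
      using K(2)[of "z i + P i \<omega>" "z i"] by (simp add: T_def)
    show "T i \<in> borel_measurable M" if "i \<in> I" for i
      unfolding T_def
      by (intro borel_measurable_diff borel_measurable_sum borel_measurable_scaleR borel_measurable_add
        borel_measurable_const borel_measurable_vec_nth order_measurable[OF P that]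
        measurable_compose[OF _ bdd_lip_measurable[OF \<sigma>_bdd_lip[OF j]]])
  qed
  have "order (\<lambda>i. (r i)\<^sup>2) (\<lambda>i \<omega>. \<Sum>k\<in>UNIV. (P2 i \<omega> $ k) *\<^sub>R pderiv_at k (\<sigma> j) (z i))"
  proof (intro order_sum order_coefficient[where z=z])
    show "order (\<lambda>i. (r i)\<^sup>2) (\<lambda>i \<omega>. P2 i \<omega> $ k)" for k
      using order_measurable[OF P2] component_le_norm_cart
      by (intro order_dominated[OF P2, where K=1]) (auto intro: borel_measurable_vec_nth)
    show "bdd_lip (pderiv_at k (\<sigma> j))" for k using \<sigma> j by (auto intro!: Cb_inf_bdd_lip Cb_inf_pderiv_at)
  qed auto
  from order_add[OF T this]
  show "order (\<lambda>i. (r i)\<^sup>2) (\<lambda>i \<omega>. \<sigma> j (z i + P i \<omega>) - \<sigma> j (z i) - (\<Sum>k=1..d. b k i \<omega> *\<^sub>R lie_op d \<sigma> k (\<sigma> j) (z i)))"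
  proof (rule order_cong)
    fix i \<omega>
    have "(\<Sum>k\<in>UNIV. (P i \<omega> $ k) *\<^sub>R pderiv_at k (\<sigma> j) (z i))
       = (\<Sum>k=1..d. b k i \<omega> *\<^sub>R lie_op d \<sigma> k (\<sigma> j) (z i)) + (\<Sum>k\<in>UNIV. (P2 i \<omega> $ k) *\<^sub>R pderiv_at k (\<sigma> j) (z i))"
      unfolding P12 by (subst lie_op_sum[symmetric]) (auto simp: scaleR_left.add sum.distrib)
    then show "T i \<omega> + (\<Sum>k\<in>UNIV. (P2 i \<omega> $ k) *\<^sub>R pderiv_at k (\<sigma> j) (z i)) =
      \<sigma> j (z i + P i \<omega>) - \<sigma> j (z i) - (\<Sum>k=1..d. b k i \<omega> *\<^sub>R lie_op d \<sigma> k (\<sigma> j) (z i))"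
      by (simp add: T_def algebra_simps)
  qed
qed

lemma second_part_shift:
  assumes N: "noise d H b e a"
    and P: "order r P" "\<And>i. i \<in> I \<Longrightarrow> P i \<in> borel_measurable (G i)"
    and sub: "\<And>i. i \<in> I \<Longrightarrow> subalgebra M (G i)"
    and ind: "\<And>i. i \<in> I \<Longrightarrow> indep_set (sets (G i)) (sets (H i))"
  shows "increment (\<lambda>i. (r i)\<^sup>2) (\<lambda>i \<omega>. second_at \<theta> e a i \<omega> (z i + P i \<omega>)
      - second_at \<theta> e a i \<omega> (z i))"
proof -
  have sH: "\<And>i. i \<in> I \<Longrightarrow> subalgebra M (H i)" using N by (simp add: noise_def)
  note sh = second_order_shift[OF _ _ P sub sH ind]
  have e: "second_order H (e j1 j2)" if "j1 \<le> d" "j2 \<le> d" for j1 j2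
    using N that by (auto simp: noise_def)
  have a: "second_order H (a j1 j2)" if "1 \<le> j1" "j1 < j2" "j2 \<le> d" for j1 j2
    using N that by (auto simp: noise_def)
  have "increment (\<lambda>i. (r i)\<^sup>2) (\<lambda>i \<omega>.
     (\<Sum>j1=0..d. \<Sum>j2=0..d. e j1 j2 i \<omega> *\<^sub>R (lie_op d \<sigma> j1 (\<sigma> j2) (z i + P i \<omega>) - lie_op d \<sigma> j1 (\<sigma> j2) (z i)))
    + (\<theta> / 2) *\<^sub>R (\<Sum>j2=1..d. \<Sum>j1=1..<j2. a j1 j2 i \<omega> *\<^sub>R (lie_bracket d \<sigma> j1 j2 (z i + P i \<omega>) - lie_bracket d \<sigma> j1 j2 (z i))))"
    by (intro increment_add increment_cmult increment_sum sh e a lie_op_bdd_lip lie_bracket_bdd_lip) auto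
  then show ?thesis
    by (rule increment_cong) (simp add: second_part_def scaleR_diff_right sum_subtractf)
qed

text \<open>
  All coefficients of the second half step are moved back to the starting point. Shifting the Brownian terms creates the products
  \<open>b j1 * b' j2\<close>, which belong to the second order part of the full step. What is left over is either a
  second half weight times a function of the first half, hence centered, or of order \<open>r^4\<close>.
\<close>

lemma two_steps:
  assumes N1: "noise d G b e a" and N2: "noise d H b' e' a'"
    and ind: "\<And>i. i \<in> I \<Longrightarrow> indep_set (sets (G i)) (sets (H i))"
  shows "increment (\<lambda>i. (r i)\<^sup>2) (\<lambda>i \<omega>.
     step_at \<theta> b' e' a' i \<omega>
       (step_at \<theta> b e a i \<omega> (z i))
     - (z i + (\<Sum>j=0..d. (b j i \<omega> + b' j i \<omega>) *\<^sub>R \<sigma> j (z i))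
        + second_at \<theta> e a i \<omega> (z i)
        + second_at \<theta> e' a' i \<omega> (z i)
        + (\<Sum>j1=1..d. \<Sum>j2=1..d. (b j1 i \<omega> * b' j2 i \<omega>) *\<^sub>R lie_op d \<sigma> j1 (\<sigma> j2) (z i))))"
proof -
  define P where "P i \<omega> = (\<Sum>k=0..d. b k i \<omega> *\<^sub>R \<sigma> k (z i)) + second_at \<theta> e a i \<omega> (z i)" for i \<omega>
  define W where "W j i \<omega> = \<sigma> j (z i + P i \<omega>) - \<sigma> j (z i) - (\<Sum>k=1..d. b k i \<omega> *\<^sub>R lie_op d \<sigma> k (\<sigma> j) (z i))" for j i \<omega>
  have PP: "order r P" "\<And>i. i \<in> I \<Longrightarrow> P i \<in> borel_measurable (G i)"
    using coefficient_after_step(1,2)[OF N1, where j=0 and z=z and \<theta>=\<theta>] unfolding P_def by auto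
  have W: "order (\<lambda>i. (r i)\<^sup>2) (W j)" if "j \<le> d" for j
    using coefficient_after_step(3)[OF N1 that, where z=z and \<theta>=\<theta>] unfolding W_def P_def .
  have sG: "\<And>i. i \<in> I \<Longrightarrow> subalgebra M (G i)" using N1 by (simp add: noise_def)
  have sH: "\<And>i. i \<in> I \<Longrightarrow> subalgebra M (H i)" using N2 by (simp add: noise_def)
  have b: "order r (b k)" "\<And>i. i \<in> I \<Longrightarrow> b k i \<in> borel_measurable (G i)" if "k \<le> d" for k
    using N1 that by (auto simp: noise_def)
  have Eb: "expectation (b k i) = 0" if "k \<in> {1..d}" "i \<in> I" for k i
    using N1 that by (auto simp: noise_def)
  have b': "order r (b' k)" "\<And>i. i \<in> I \<Longrightarrow> b' k i \<in> borel_measurable (H i)" if "k \<le> d" for k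
    using N2 that by (auto simp: noise_def)
  have Eb': "expectation (b' k i) = 0" if "k \<in> {1..d}" "i \<in> I" for k i
    using N2 that by (auto simp: noise_def)
  have b0: "order (\<lambda>i. (r i)\<^sup>2) (b' 0)" using N2 by (simp add: noise_def)
  have Wm: "W j i \<in> borel_measurable (G i)" if "j \<le> d" "i \<in> I" for i j
    unfolding W_def
    by (intro borel_measurable_diff borel_measurable_sum borel_measurable_scaleR borel_measurable_add
        borel_measurable_const b(2)[OF _ that(2)] PP(2)[OF that(2)]
        measurable_compose[OF _ bdd_lip_measurable[OF \<sigma>_bdd_lip[OF that(1)]]]) auto
  have r2: "0 \<le> (r i)\<^sup>2" for i by simp
  have 1: "increment (\<lambda>i. (r i)\<^sup>2) (\<lambda>i \<omega>. b' j i \<omega> *\<^sub>R W j i \<omega>)" if j: "j \<in> {1..d}" for j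
  proof (rule increment_centered)
    have jd: "j \<le> d" using j by simp
    show "order (\<lambda>i. r i * (r i)\<^sup>2) (\<lambda>i \<omega>. b' j i \<omega> *\<^sub>R W j i \<omega>)"
      by (rule order_scaleR[OF b'(1)[OF jd] W[OF jd]])
    show "expectation (\<lambda>\<omega>. b' j i \<omega> *\<^sub>R W j i \<omega>) = 0" if "i \<in> I" for i
      by (rule expectation_indep_zero[OF W[OF jd] Wm[OF jd] b'[OF jd] sG sH ind _ that])
        (use Eb'[OF j that] in auto)
  qed simp
  have 2: "increment (\<lambda>i. (r i)\<^sup>2) (\<lambda>i \<omega>. b' 0 i \<omega> *\<^sub>R W 0 i \<omega>)"
    by (rule increment_small[OF order_scaleR[OF b0 W]]) auto
  have 3: "increment (\<lambda>i. (r i)\<^sup>2) (\<lambda>i \<omega>. (b' 0 i \<omega> * b k i \<omega>) *\<^sub>R lie_op d \<sigma> k (\<sigma> 0) (z i))" if k: "k \<in> {1..d}" for k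
  proof (rule increment_coefficient[OF increment_centered, where z=z])
    have kd: "k \<le> d" using k by simp
    show "order (\<lambda>i. r i * (r i)\<^sup>2) (\<lambda>i \<omega>. b' 0 i \<omega> * b k i \<omega>)"
      using order_mult[OF b0 b(1)[OF kd]] by (simp add: mult.commute)
    show "expectation (\<lambda>\<omega>. b' 0 i \<omega> * b k i \<omega>) = 0" if "i \<in> I" for i
      using expectation_indep_zero[OF b[OF kd] b'[of 0] sG sH ind _ that] Eb[OF k that] by simp
    show "bdd_lip (lie_op d \<sigma> k (\<sigma> 0))" using k by (intro lie_op_bdd_lip) auto
  qed simp
  have sum: "increment (\<lambda>i. (r i)\<^sup>2) (\<lambda>i \<omega>. (\<Sum>j=1..d. b' j i \<omega> *\<^sub>R W j i \<omega>) + b' 0 i \<omega> *\<^sub>R W 0 i \<omega>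
      + (\<Sum>k=1..d. (b' 0 i \<omega> * b k i \<omega>) *\<^sub>R lie_op d \<sigma> k (\<sigma> 0) (z i))
      + (second_at \<theta> e' a' i \<omega> (z i + P i \<omega>)
      - second_at \<theta> e' a' i \<omega> (z i)))"
    by (intro increment_add increment_sum 1 2 3 second_part_shift[OF N2 PP sG ind] r2)
  have z: "{0..d} = insert 0 {1..d}" by auto
  have half: "step_at \<theta> b e a i \<omega> (z i) = z i + P i \<omega>" for i \<omega>
    by (simp add: ito_step_def P_def)
  have split: "b' j i \<omega> *\<^sub>R \<sigma> j (z i + P i \<omega>) = b' j i \<omega> *\<^sub>R \<sigma> j (z i) + b' j i \<omega> *\<^sub>R W j i \<omega>
     + (\<Sum>k=1..d. (b k i \<omega> * b' j i \<omega>) *\<^sub>R lie_op d \<sigma> k (\<sigma> j) (z i))" for j i \<omega>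
    by (simp add: W_def algebra_simps scaleR_sum_right)
  have sw: "(\<Sum>j=1..d. \<Sum>k=1..d. (b k i \<omega> * b' j i \<omega>) *\<^sub>R lie_op d \<sigma> k (\<sigma> j) (z i))
    = (\<Sum>j1=1..d. \<Sum>j2=1..d. (b j1 i \<omega> * b' j2 i \<omega>) *\<^sub>R lie_op d \<sigma> j1 (\<sigma> j2) (z i))" for i \<omega>
    by (rule sum.swap)
  have full: "(\<Sum>j=0..d. b' j i \<omega> *\<^sub>R \<sigma> j (z i + P i \<omega>)) = (\<Sum>j=0..d. b' j i \<omega> *\<^sub>R \<sigma> j (z i))
    + (\<Sum>j=1..d. b' j i \<omega> *\<^sub>R W j i \<omega>) + b' 0 i \<omega> *\<^sub>R W 0 i \<omega>
    + (\<Sum>k=1..d. (b' 0 i \<omega> * b k i \<omega>) *\<^sub>R lie_op d \<sigma> k (\<sigma> 0) (z i))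
    + (\<Sum>j1=1..d. \<Sum>j2=1..d. (b j1 i \<omega> * b' j2 i \<omega>) *\<^sub>R lie_op d \<sigma> j1 (\<sigma> j2) (z i))" for i \<omega>
    unfolding split sum.distrib z sw[symmetric] by (simp add: sum.distrib mult.commute)
  show ?thesis unfolding half
    by (rule increment_cong[OF sum]) (unfold ito_step_def full, simp add: P_def scaleR_left.add sum.distrib)
qed

end

section \<open>One step of the four coupled schemes\<close>

context coefficients
begin

lemma noise_eta: "noise d H b e a \<Longrightarrow> j1 \<le> d \<Longrightarrow> j2 \<le> d \<Longrightarrow> second_order H (e j1 j2)"
  by (simp add: noise_def)

lemma noise_area: "noise d H b e a \<Longrightarrow> 1 \<le> j1 \<Longrightarrow> j1 < j2 \<Longrightarrow> j2 \<le> d \<Longrightarrow> second_order H (a j1 j2)"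
  by (simp add: noise_def)

text \<open>
  Weights carrying a time index may be dropped from the comparison.
\<close>

lemma second_part_main:
  assumes N: "noise d H b e a"
  shows "increment (\<lambda>i. (r i)\<^sup>2) (\<lambda>i \<omega>. second_at \<theta> e a i \<omega> (z i)
     - ((\<Sum>j1=1..d. \<Sum>j2=1..d. e j1 j2 i \<omega> *\<^sub>R lie_op d \<sigma> j1 (\<sigma> j2) (z i))
        + (\<theta> / 2) *\<^sub>R (\<Sum>j2=1..d. \<Sum>j1=1..<j2. a j1 j2 i \<omega> *\<^sub>R lie_bracket d \<sigma> j1 j2 (z i))))"
proof -
  have e: "increment (\<lambda>i. (r i)\<^sup>2) (e 0 j)" "increment (\<lambda>i. (r i)\<^sup>2) (e j 0)" if "j \<le> d" for j
    using N that by (auto simp: noise_def)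
  have "increment (\<lambda>i. (r i)\<^sup>2) (\<lambda>i \<omega>. (\<Sum>j2=0..d. e 0 j2 i \<omega> *\<^sub>R lie_op d \<sigma> 0 (\<sigma> j2) (z i))
     + (\<Sum>j1=1..d. e j1 0 i \<omega> *\<^sub>R lie_op d \<sigma> j1 (\<sigma> 0) (z i)))"
    by (intro increment_add increment_sum increment_coefficient[where z=z] e lie_op_bdd_lip) auto
  moreover have "(\<Sum>j1=0..d. \<Sum>j2=0..d. e j1 j2 i \<omega> *\<^sub>R lie_op d \<sigma> j1 (\<sigma> j2) (z i))
      = (\<Sum>j2=0..d. e 0 j2 i \<omega> *\<^sub>R lie_op d \<sigma> 0 (\<sigma> j2) (z i))
       + (\<Sum>j1=1..d. e j1 0 i \<omega> *\<^sub>R lie_op d \<sigma> j1 (\<sigma> 0) (z i))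
       + (\<Sum>j1=1..d. \<Sum>j2=1..d. e j1 j2 i \<omega> *\<^sub>R lie_op d \<sigma> j1 (\<sigma> j2) (z i))" for i \<omega>
  proof -
    have z: "{0..d} = insert 0 {1..d}" by auto
    show ?thesis unfolding z by (simp add: sum.distrib)
  qed
  ultimately show ?thesis unfolding second_part_def by (elim increment_cong) simp
qed

lemma increment_coefficient_diff:
  fixes g :: "real^'n \<Rightarrow> real^'n"
  assumes X: "increment w X" and g: "bdd_lip g"
  shows "increment (\<lambda>i. w i * norm (z i - z' i)) (\<lambda>i \<omega>. X i \<omega> *\<^sub>R g (z i) - X i \<omega> *\<^sub>R g (z' i))"
proof -
  obtain K where K: "\<And>a b. norm (g a - g b) \<le> K * norm (a - b)" using bdd_lipE[OF g] by metis
  show ?thesis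
    unfolding scaleR_diff_right[symmetric]
    by (rule increment_scaleR[OF X, of "\<lambda>i. g (z i) - g (z' i)" K]) (auto simp: K)
qed

lemma mult_le_sum_squares: "x * y \<le> x\<^sup>2 + (y::real)\<^sup>2"
proof -
  have "0 \<le> (x - y)\<^sup>2" "0 \<le> (x + y)\<^sup>2" by simp_all
  then show ?thesis unfolding power2_diff power2_sum by linarith
qed

end

text \<open>
  Index \<open>1\<close> refers to the first half, \<open>2\<close> to the second half of a coarse step, and unindexed weights to the full step. The
  relation \<open>e_eq\<close> is the polarised identity for the product of two sums of increments.
\<close>

locale coupled_step = coefficients M I r R d \<sigma>
  for M :: "'w measure" and I :: "'i set" and r R d and \<sigma> :: "nat \<Rightarrow> real^'n::finite \<Rightarrow> real^'n" +
  fixes H1 H2 H :: "'i \<Rightarrow> 'w measure" and b1 b2 :: "nat \<Rightarrow> 'i \<Rightarrow> 'w \<Rightarrow> real"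
    and e1 e2 e a1 a2 a :: "nat \<Rightarrow> nat \<Rightarrow> 'i \<Rightarrow> 'w \<Rightarrow> real"
  assumes N1: "noise d H1 b1 e1 a1" and N2: "noise d H2 b2 e2 a2"
    and N: "noise d H (\<lambda>j i \<omega>. b1 j i \<omega> + b2 j i \<omega>) e a"
    and ind: "\<And>i. i \<in> I \<Longrightarrow> indep_set (sets (H1 i)) (sets (H2 i))"
    and e_eq: "\<And>j1 j2 i \<omega>. j1 \<in> {1..d} \<Longrightarrow> j2 \<in> {1..d} \<Longrightarrow>
      e j1 j2 i \<omega> = e1 j1 j2 i \<omega> + e2 j1 j2 i \<omega> + (1/2) * (b1 j1 i \<omega> * b2 j2 i \<omega> + b2 j1 i \<omega> * b1 j2 i \<omega>)"
begin

abbreviation first_half where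
  "first_half \<theta> i \<omega> \<equiv> step_at \<theta> b1 e1 a1 i \<omega>"

abbreviation second_half where
  "second_half \<theta> i \<omega> \<equiv> step_at \<theta> b2 e2 a2 i \<omega>"

abbreviation whole where
  "whole \<theta> i \<omega> \<equiv> ito_step \<theta> d \<sigma> (\<lambda>j. b1 j i \<omega> + b2 j i \<omega>) (\<lambda>j1 j2. e j1 j2 i \<omega>) (\<lambda>j1 j2. a j1 j2 i \<omega>)"

text \<open>
  The part of the step that the fine and the coarse schemes and their partners share; it depends on the noise of the full step only.
\<close>

definition common where
  "common i \<omega> z = (\<Sum>j=0..d. (b1 j i \<omega> + b2 j i \<omega>) *\<^sub>R \<sigma> j z)
     + (\<Sum>j1=1..d. \<Sum>j2=1..d. e j1 j2 i \<omega> *\<^sub>R lie_op d \<sigma> j1 (\<sigma> j2) z)"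

text \<open>
  The contribution of the order of the half steps to an iterated integral (a discrete Levy area); it
  changes sign when the half steps are exchanged.
\<close>

definition antisym where
  "antisym j1 j2 i \<omega> = (1/2) * (b1 j1 i \<omega> * b2 j2 i \<omega> - b2 j1 i \<omega> * b1 j2 i \<omega>)"

definition fine_odd where
  "fine_odd i \<omega> z = (\<Sum>j1=1..d. \<Sum>j2=1..d. antisym j1 j2 i \<omega> *\<^sub>R lie_op d \<sigma> j1 (\<sigma> j2) z)
     + (1/2) *\<^sub>R (\<Sum>j2=1..d. \<Sum>j1=1..<j2. (a1 j1 j2 i \<omega> + a2 j1 j2 i \<omega>) *\<^sub>R lie_bracket d \<sigma> j1 j2 z)"

definition coarse_odd where
  "coarse_odd i \<omega> z = (1/2) *\<^sub>R (\<Sum>j2=1..d. \<Sum>j1=1..<j2. a j1 j2 i \<omega> *\<^sub>R lie_bracket d \<sigma> j1 j2 z)"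

lemma antisym_increment:
  assumes "j1 \<in> {1..d}" "j2 \<in> {1..d}" shows "increment r (antisym j1 j2)"
proof -
  have b: "order r (b1 j)" "order r (b2 j)" "\<And>i. i \<in> I \<Longrightarrow> b1 j i \<in> borel_measurable (H1 i)"
    "\<And>i. i \<in> I \<Longrightarrow> b2 j i \<in> borel_measurable (H2 i)" "\<And>i. i \<in> I \<Longrightarrow> expectation (b1 j i) = 0"
    if "j \<in> {1..d}" for j
    using N1 N2 that by (auto simp: noise_def)
  have sub: "\<And>i. i \<in> I \<Longrightarrow> subalgebra M (H1 i)" "\<And>i. i \<in> I \<Longrightarrow> subalgebra M (H2 i)"
    using N1 N2 by (auto simp: noise_def)
  have p: "increment r (\<lambda>i \<omega>. b2 k i \<omega> * b1 j i \<omega>)" if "j \<in> {1..d}" "k \<in> {1..d}" for j k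
  proof (rule increment_centered)
    show "order (\<lambda>i. r i * r i) (\<lambda>i \<omega>. b2 k i \<omega> * b1 j i \<omega>)"
      by (intro order_mult b that)
    show "expectation (\<lambda>\<omega>. b2 k i \<omega> * b1 j i \<omega>) = 0" if i: "i \<in> I" for i
      using expectation_indep_zero[OF b(1)[OF \<open>j \<in> {1..d}\<close>] b(3)[OF \<open>j \<in> {1..d}\<close>]
        b(2)[OF \<open>k \<in> {1..d}\<close>] b(4)[OF \<open>k \<in> {1..d}\<close>] sub ind _ i] b(5)[OF \<open>j \<in> {1..d}\<close> i] by simp
  qed (rule r_nonneg)
  have "increment r (\<lambda>i \<omega>. (1/2) *\<^sub>R (b2 j2 i \<omega> * b1 j1 i \<omega> - b2 j1 i \<omega> * b1 j2 i \<omega>))"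
    by (intro increment_cmult increment_diff p assms)
  then show ?thesis
    by (rule increment_cong) (simp add: antisym_def mult.commute)
qed

lemma area_increment:
  assumes "1 \<le> j1" "j1 < j2" "j2 \<le> d"
  shows "increment r (a j1 j2)" "increment r (a1 j1 j2)" "increment r (a2 j1 j2)"
  using noise_area[OF N] noise_area[OF N1] noise_area[OF N2] assms by (blast intro: second_order_increment)+

lemma eta_increment:
  assumes "j1 \<le> d" "j2 \<le> d" shows "increment r (e j1 j2)"
  by (rule second_order_increment[OF noise_eta[OF N assms]])

text \<open>
  Exchanging the half steps flips \<open>antisym\<close>, and the antithetic integrator flips the area products. Hence the two
  fine schemes share the even part and have opposite odd parts.
\<close>

lemma fine_expansion:
  "increment (\<lambda>i. (r i)\<^sup>2) (\<lambda>i \<omega>. second_half 1 i \<omega> (first_half 1 i \<omega> (z i))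
     - (z i + common i \<omega> (z i) + fine_odd i \<omega> (z i)))" (is ?A)
  "increment (\<lambda>i. (r i)\<^sup>2) (\<lambda>i \<omega>. first_half (-1) i \<omega> (second_half (-1) i \<omega> (z i))
     - (z i + common i \<omega> (z i) - fine_odd i \<omega> (z i)))" (is ?B)
proof -
  have e_sum: "e1 j1 j2 i \<omega> + e2 j1 j2 i \<omega> + b1 j1 i \<omega> * b2 j2 i \<omega> = e j1 j2 i \<omega> + antisym j1 j2 i \<omega>"
    "e2 j1 j2 i \<omega> + e1 j1 j2 i \<omega> + b2 j1 i \<omega> * b1 j2 i \<omega> = e j1 j2 i \<omega> - antisym j1 j2 i \<omega>"
    if "j1 \<in> {1..d}" "j2 \<in> {1..d}" for j1 j2 i \<omega>
    using e_eq[OF that] by (simp_all add: antisym_def algebra_simps)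
  let ?L = "\<lambda>j1 j2 i. lie_op d \<sigma> j1 (\<sigma> j2) (z i)"
  let ?br = "\<lambda>j1 j2 i. lie_bracket d \<sigma> j1 j2 (z i)"
  have L: "(\<Sum>j1=1..d. \<Sum>j2=1..d. e1 j1 j2 i \<omega> *\<^sub>R ?L j1 j2 i) + (\<Sum>j1=1..d. \<Sum>j2=1..d. e2 j1 j2 i \<omega> *\<^sub>R ?L j1 j2 i)
     + (\<Sum>j1=1..d. \<Sum>j2=1..d. (b1 j1 i \<omega> * b2 j2 i \<omega>) *\<^sub>R ?L j1 j2 i)
     = (\<Sum>j1=1..d. \<Sum>j2=1..d. e j1 j2 i \<omega> *\<^sub>R ?L j1 j2 i) + (\<Sum>j1=1..d. \<Sum>j2=1..d. antisym j1 j2 i \<omega> *\<^sub>R ?L j1 j2 i)"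
    (is "?l1 = ?r1")
    "(\<Sum>j1=1..d. \<Sum>j2=1..d. e2 j1 j2 i \<omega> *\<^sub>R ?L j1 j2 i) + (\<Sum>j1=1..d. \<Sum>j2=1..d. e1 j1 j2 i \<omega> *\<^sub>R ?L j1 j2 i)
     + (\<Sum>j1=1..d. \<Sum>j2=1..d. (b2 j1 i \<omega> * b1 j2 i \<omega>) *\<^sub>R ?L j1 j2 i)
     = (\<Sum>j1=1..d. \<Sum>j2=1..d. e j1 j2 i \<omega> *\<^sub>R ?L j1 j2 i) - (\<Sum>j1=1..d. \<Sum>j2=1..d. antisym j1 j2 i \<omega> *\<^sub>R ?L j1 j2 i)"
    (is "?l2 = ?r2") for i \<omega>
    unfolding sum.distrib[symmetric] sum_subtractf[symmetric]
    by (intro sum.cong refl; metis e_sum scaleR_left.add scaleR_left.diff)+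
  have br: "(\<Sum>j2=1..d. \<Sum>j1=1..<j2. (a1 j1 j2 i \<omega> + a2 j1 j2 i \<omega>) *\<^sub>R ?br j1 j2 i) =
    (\<Sum>j2=1..d. \<Sum>j1=1..<j2. a1 j1 j2 i \<omega> *\<^sub>R ?br j1 j2 i) + (\<Sum>j2=1..d. \<Sum>j1=1..<j2. a2 j1 j2 i \<omega> *\<^sub>R ?br j1 j2 i)" for i \<omega>
    by (simp add: scaleR_left.add sum.distrib)
  have b: "(\<Sum>j=0..d. (b2 j i \<omega> + b1 j i \<omega>) *\<^sub>R \<sigma> j (z i)) = (\<Sum>j=0..d. (b1 j i \<omega> + b2 j i \<omega>) *\<^sub>R \<sigma> j (z i))" for i \<omega>
    by (simp add: add.commute)
  have alg: "F - (x + B + S1 + S2 + l3) + ((S1 - (l1 + (h / 2) *\<^sub>R A1)) + (S2 - (l2 + (h / 2) *\<^sub>R A2)))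
      = F - (x + (B + en) + h *\<^sub>R (n + (1/2) *\<^sub>R (A1 + A2)))"
    if "l1 + l2 + l3 = en + h *\<^sub>R n" for F x B S1 S2 l1 l2 l3 A1 A2 en n :: "real^'n" and h :: real
  proof -
    have l3: "l3 = en + h *\<^sub>R n - l1 - l2" using that by (simp add: algebra_simps)
    show ?thesis unfolding l3 by (simp add: vec_eq_iff field_simps)
  qed
  have alg1: "F - (x + B + S1 + S2 + l3) + ((S1 - (l1 + (1 / 2) *\<^sub>R A1)) + (S2 - (l2 + (1 / 2) *\<^sub>R A2)))
      = F - (x + (B + en) + (n + (1/2) *\<^sub>R (A1 + A2)))"
    if "l1 + l2 + l3 = en + n" for F x B S1 S2 l1 l2 l3 A1 A2 en n :: "real^'n"
    using alg[of l1 l2 l3 en 1 n] that by simp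
  have alg2: "F - (x + B + S1 + S2 + l3) + ((S1 - (l1 + (-1 / 2) *\<^sub>R A1)) + (S2 - (l2 + (-1 / 2) *\<^sub>R A2)))
      = F - (x + (B + en) - (n + (1/2) *\<^sub>R (A2 + A1)))"
    if "l1 + l2 + l3 = en - n" for F x B S1 S2 l1 l2 l3 A1 A2 en n :: "real^'n"
    using alg[of l1 l2 l3 en "-1" n] that by (simp add: add.commute)
  note step1 = two_steps[OF N1 N2 ind, of 1 z]
  note step2 = two_steps[OF N2 N1 indep_set_commute[OF ind], of "-1" z]
  note m1 = second_part_main[OF N1] and m2 = second_part_main[OF N2]
  show ?A
    by (rule increment_cong[OF increment_add[OF step1 increment_add[OF m1[of 1 z] m2[of 1 z]]]])
      (assumption, unfold common_def fine_odd_def br, rule alg1[OF L(1)])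
  show ?B
    by (rule increment_cong[OF increment_add[OF step2 increment_add[OF m2[of "-1" z] m1[of "-1" z]]]])
      (assumption, unfold common_def fine_odd_def br b, rule alg2[OF L(2)])
qed

lemma coarse_expansion:
  "increment (\<lambda>i. (r i)\<^sup>2) (\<lambda>i \<omega>. whole \<theta> i \<omega> (z i) - (z i + common i \<omega> (z i) + \<theta> *\<^sub>R coarse_odd i \<omega> (z i)))"
  by (rule increment_cong[OF second_part_main[OF N, of \<theta> z]])
    (simp add: ito_step_def common_def coarse_odd_def algebra_simps)

lemma brownian_increment:
  assumes "j \<le> d" shows "increment (\<lambda>_. 1) (\<lambda>i \<omega>. b1 j i \<omega> + b2 j i \<omega>)"
proof (cases "j = 0")
  case True
  then show ?thesis using N by (intro increment_small) (auto simp: noise_def)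
next
  case False
  then show ?thesis using N assms by (intro increment_centered) (auto simp: noise_def)
qed

lemma increment_R_mono:
  assumes "increment (\<lambda>i. r i * w i) X" "\<And>i. i \<in> I \<Longrightarrow> 0 \<le> w i"
  shows "increment w X"
proof (rule increment_mono[OF assms(1), where K="\<bar>R\<bar>"])
  show "r i * w i \<le> \<bar>R\<bar> * w i" if "i \<in> I" for i
    using r_le[OF that] assms(2)[OF that] by (intro mult_right_mono) auto
qed (use assms(2) in auto)

lemma common_lip: "increment (\<lambda>i. norm (z i - z' i)) (\<lambda>i \<omega>. common i \<omega> (z i) - common i \<omega> (z' i))"
proof -
  have "increment (\<lambda>i. norm (z i - z' i)) (\<lambda>i \<omega>.
     (\<Sum>j=0..d. (b1 j i \<omega> + b2 j i \<omega>) *\<^sub>R \<sigma> j (z i) - (b1 j i \<omega> + b2 j i \<omega>) *\<^sub>R \<sigma> j (z' i))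
     + (\<Sum>j1=1..d. \<Sum>j2=1..d. e j1 j2 i \<omega> *\<^sub>R lie_op d \<sigma> j1 (\<sigma> j2) (z i) - e j1 j2 i \<omega> *\<^sub>R lie_op d \<sigma> j1 (\<sigma> j2) (z' i)))"
  proof (intro increment_add increment_sum)
    show "increment (\<lambda>i. norm (z i - z' i)) (\<lambda>i \<omega>. (b1 j i \<omega> + b2 j i \<omega>) *\<^sub>R \<sigma> j (z i) - (b1 j i \<omega> + b2 j i \<omega>) *\<^sub>R \<sigma> j (z' i))"
      if "j \<in> {0..d}" for j
      using increment_coefficient_diff[OF brownian_increment \<sigma>_bdd_lip, of j j z z'] that by simp
    show "increment (\<lambda>i. norm (z i - z' i)) (\<lambda>i \<omega>. e j1 j2 i \<omega> *\<^sub>R lie_op d \<sigma> j1 (\<sigma> j2) (z i) - e j1 j2 i \<omega> *\<^sub>R lie_op d \<sigma> j1 (\<sigma> j2) (z' i))"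
      if "j1 \<in> {1..d}" "j2 \<in> {1..d}" for j1 j2
      by (rule increment_R_mono[OF increment_coefficient_diff[OF eta_increment lie_op_bdd_lip]]) (use that in auto)
  qed auto
  then show ?thesis
    by (rule increment_cong) (simp add: common_def sum_subtractf)
qed

lemma increment_r_lip:
  assumes "increment (\<lambda>i. r i * norm (z i - z' i)) X"
  shows "increment (\<lambda>i. (r i)\<^sup>2 + (norm (z i - z' i))\<^sup>2) X"
  by (rule increment_mono[OF assms, where K=1]) (auto simp: mult_le_sum_squares)

text \<open>
  For the first order weights the midpoint rule gives the square of the distance. For the iterated integrals the Lipschitz bound
  suffices, because these weights are smaller by one order.
\<close>

lemma common_midpoint:
  "increment (\<lambda>i. (r i)\<^sup>2 + (norm (z i - z' i))\<^sup>2)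
     (\<lambda>i \<omega>. (1/2) *\<^sub>R (common i \<omega> (z i) + common i \<omega> (z' i)) - common i \<omega> ((1/2) *\<^sub>R (z i + z' i)))"
proof -
  let ?m = "\<lambda>i. (1/2) *\<^sub>R (z i + z' i)"
  have half: "norm (z i - ?m i) = norm (z i - z' i) / 2" "norm (z' i - ?m i) = norm (z i - z' i) / 2" for i
  proof -
    have "z i - ?m i = (1/2) *\<^sub>R (z i - z' i)" "z' i - ?m i = (1/2) *\<^sub>R (z' i - z i)" by (vector field_simps)+
    then show "norm (z i - ?m i) = norm (z i - z' i) / 2" "norm (z' i - ?m i) = norm (z i - z' i) / 2"
      by (simp_all add: norm_minus_commute)
  qed
  have 1: "increment (\<lambda>i. (r i)\<^sup>2 + (norm (z i - z' i))\<^sup>2) (\<lambda>i \<omega>. (b1 j i \<omega> + b2 j i \<omega>) *\<^sub>R ((1/2) *\<^sub>R (\<sigma> j (z i) + \<sigma> j (z' i)) - \<sigma> j (?m i)))"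
    if "j \<le> d" for j
  proof -
    have "Cb 2 (\<sigma> j)" using \<sigma> that by (intro Cb_inf_Cb) auto
    then obtain K where K: "K \<ge> 0"
      "\<And>a b. norm ((1/2) *\<^sub>R (\<sigma> j a + \<sigma> j b) - \<sigma> j ((1/2) *\<^sub>R (a + b))) \<le> K * (norm (a - b))\<^sup>2"
      using Cb_2_midpoint by metis
    have "increment (\<lambda>i. 1 * (norm (z i - z' i))\<^sup>2) (\<lambda>i \<omega>. (b1 j i \<omega> + b2 j i \<omega>) *\<^sub>R ((1/2) *\<^sub>R (\<sigma> j (z i) + \<sigma> j (z' i)) - \<sigma> j (?m i)))"
      by (rule increment_scaleR[OF brownian_increment[OF that] K(2)]) simp
    then show ?thesis by (rule increment_mono[where K=1]) auto
  qed
  have h: "increment (\<lambda>i. r i * norm (z i - z' i)) X" if "increment (\<lambda>i. r i * norm (y i - ?m i)) X" "y = z \<or> y = z'" for y X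
  proof (rule increment_mono[OF that(1), where K="1/2"])
    have y: "norm (y i - ?m i) = norm (z i - z' i) / 2" for i using that(2) half by blast
    show "r i * norm (y i - ?m i) \<le> 1 / 2 * (r i * norm (z i - z' i))" for i unfolding y by simp
  qed (simp_all add: r_nonneg)
  have 2: "increment (\<lambda>i. (r i)\<^sup>2 + (norm (z i - z' i))\<^sup>2) (\<lambda>i \<omega>. e j1 j2 i \<omega> *\<^sub>R lie_op d \<sigma> j1 (\<sigma> j2) (y i) - e j1 j2 i \<omega> *\<^sub>R lie_op d \<sigma> j1 (\<sigma> j2) (?m i))"
    if "j1 \<in> {1..d}" "j2 \<in> {1..d}" "y = z \<or> y = z'" for j1 j2 y
    using that by (intro increment_r_lip h[OF _ that(3)] increment_coefficient_diff eta_increment lie_op_bdd_lip) auto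
  have "increment (\<lambda>i. (r i)\<^sup>2 + (norm (z i - z' i))\<^sup>2) (\<lambda>i \<omega>.
      (\<Sum>j=0..d. (b1 j i \<omega> + b2 j i \<omega>) *\<^sub>R ((1/2) *\<^sub>R (\<sigma> j (z i) + \<sigma> j (z' i)) - \<sigma> j (?m i)))
     + (1/2) *\<^sub>R ((\<Sum>j1=1..d. \<Sum>j2=1..d. e j1 j2 i \<omega> *\<^sub>R lie_op d \<sigma> j1 (\<sigma> j2) (z i) - e j1 j2 i \<omega> *\<^sub>R lie_op d \<sigma> j1 (\<sigma> j2) (?m i))
       + (\<Sum>j1=1..d. \<Sum>j2=1..d. e j1 j2 i \<omega> *\<^sub>R lie_op d \<sigma> j1 (\<sigma> j2) (z' i) - e j1 j2 i \<omega> *\<^sub>R lie_op d \<sigma> j1 (\<sigma> j2) (?m i))))"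
    by (intro increment_add increment_cmult increment_sum 1 2) auto
  then show ?thesis
  proof (rule increment_cong)
    fix i \<omega>
    have "(1/2) *\<^sub>R (X + Y) - Z = (1/2) *\<^sub>R (X - Z + (Y - Z))" for X Y Z :: "real^'n"
      by (vector field_simps)
    moreover have "(\<Sum>j=0..d. (b1 j i \<omega> + b2 j i \<omega>) *\<^sub>R ((1/2) *\<^sub>R (\<sigma> j (z i) + \<sigma> j (z' i)) - \<sigma> j (?m i)))
      = (1/2) *\<^sub>R ((\<Sum>j=0..d. (b1 j i \<omega> + b2 j i \<omega>) *\<^sub>R \<sigma> j (z i)) + (\<Sum>j=0..d. (b1 j i \<omega> + b2 j i \<omega>) *\<^sub>R \<sigma> j (z' i)))
        - (\<Sum>j=0..d. (b1 j i \<omega> + b2 j i \<omega>) *\<^sub>R \<sigma> j (?m i))"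
      unfolding sum.distrib[symmetric] scaleR_sum_right sum_subtractf[symmetric]
      by (intro sum.cong refl) (simp add: scaleR_add_right scaleR_diff_right mult.commute)
    ultimately show "(\<Sum>j=0..d. (b1 j i \<omega> + b2 j i \<omega>) *\<^sub>R ((1/2) *\<^sub>R (\<sigma> j (z i) + \<sigma> j (z' i)) - \<sigma> j (?m i)))
     + (1/2) *\<^sub>R ((\<Sum>j1=1..d. \<Sum>j2=1..d. e j1 j2 i \<omega> *\<^sub>R lie_op d \<sigma> j1 (\<sigma> j2) (z i) - e j1 j2 i \<omega> *\<^sub>R lie_op d \<sigma> j1 (\<sigma> j2) (?m i))
       + (\<Sum>j1=1..d. \<Sum>j2=1..d. e j1 j2 i \<omega> *\<^sub>R lie_op d \<sigma> j1 (\<sigma> j2) (z' i) - e j1 j2 i \<omega> *\<^sub>R lie_op d \<sigma> j1 (\<sigma> j2) (?m i)))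
     = (1/2) *\<^sub>R (common i \<omega> (z i) + common i \<omega> (z' i)) - common i \<omega> (?m i)"
      unfolding common_def sum_subtractf by (simp only: scaleR_add_right) (simp add: algebra_simps)
  qed
qed

lemma odd_lip:
  "increment (\<lambda>i. (r i)\<^sup>2 + (norm (z i - z' i))\<^sup>2) (\<lambda>i \<omega>. fine_odd i \<omega> (z i) - fine_odd i \<omega> (z' i))"
  "increment (\<lambda>i. (r i)\<^sup>2 + (norm (z i - z' i))\<^sup>2) (\<lambda>i \<omega>. coarse_odd i \<omega> (z i) - coarse_odd i \<omega> (z' i))"
proof -
  have "increment (\<lambda>i. (r i)\<^sup>2 + (norm (z i - z' i))\<^sup>2) (\<lambda>i \<omega>.
      (\<Sum>j1=1..d. \<Sum>j2=1..d. antisym j1 j2 i \<omega> *\<^sub>R lie_op d \<sigma> j1 (\<sigma> j2) (z i) - antisym j1 j2 i \<omega> *\<^sub>R lie_op d \<sigma> j1 (\<sigma> j2) (z' i))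
     + (1/2) *\<^sub>R (\<Sum>j2=1..d. \<Sum>j1=1..<j2. (a1 j1 j2 i \<omega> + a2 j1 j2 i \<omega>) *\<^sub>R lie_bracket d \<sigma> j1 j2 (z i)
        - (a1 j1 j2 i \<omega> + a2 j1 j2 i \<omega>) *\<^sub>R lie_bracket d \<sigma> j1 j2 (z' i)))"
    by (intro increment_add increment_cmult increment_sum increment_r_lip increment_coefficient_diff
        antisym_increment lie_op_bdd_lip lie_bracket_bdd_lip area_increment) auto
  then show "increment (\<lambda>i. (r i)\<^sup>2 + (norm (z i - z' i))\<^sup>2) (\<lambda>i \<omega>. fine_odd i \<omega> (z i) - fine_odd i \<omega> (z' i))"
    by (rule increment_cong) (simp add: fine_odd_def sum_subtractf scaleR_diff_right)
  have "increment (\<lambda>i. (r i)\<^sup>2 + (norm (z i - z' i))\<^sup>2) (\<lambda>i \<omega>. 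
     (1/2) *\<^sub>R (\<Sum>j2=1..d. \<Sum>j1=1..<j2. a j1 j2 i \<omega> *\<^sub>R lie_bracket d \<sigma> j1 j2 (z i)
        - a j1 j2 i \<omega> *\<^sub>R lie_bracket d \<sigma> j1 j2 (z' i)))"
    by (intro increment_cmult increment_sum increment_r_lip increment_coefficient_diff
        lie_bracket_bdd_lip area_increment) auto
  then show "increment (\<lambda>i. (r i)\<^sup>2 + (norm (z i - z' i))\<^sup>2) (\<lambda>i \<omega>. coarse_odd i \<omega> (z i) - coarse_odd i \<omega> (z' i))"
    by (rule increment_cong) (simp add: coarse_odd_def sum_subtractf scaleR_diff_right)
qed

lemma odd_bounded:
  "increment r (\<lambda>i \<omega>. fine_odd i \<omega> (z i))" "increment r (\<lambda>i \<omega>. coarse_odd i \<omega> (z i))"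
  unfolding fine_odd_def coarse_odd_def
  by (intro increment_add increment_cmult increment_sum increment_coefficient[where z=z]
        antisym_increment lie_op_bdd_lip lie_bracket_bdd_lip area_increment r_nonneg; auto)+

text \<open>
  The even parts differ by a Lipschitz term, the odd parts add up to a bounded one; the latter limits the
  antithetic gaps to the order \<open>r\<close>.
\<close>

lemma antithetic_differences:
  fixes z z' :: "'i \<Rightarrow> real^'n"
  defines "F \<equiv> \<lambda>i \<omega>. second_half 1 i \<omega> (first_half 1 i \<omega> (z i)) - first_half (-1) i \<omega> (second_half (-1) i \<omega> (z' i))"
    and "C \<equiv> \<lambda>i \<omega>. whole 1 i \<omega> (z i) - whole (-1) i \<omega> (z' i)"
  shows "increment (\<lambda>i. norm (z i - z' i) + r i) (\<lambda>i \<omega>. F i \<omega> - (z i - z' i))"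
    and "increment (\<lambda>i. norm (z i - z' i) + r i) (\<lambda>i \<omega>. C i \<omega> - (z i - z' i))"
proof -
  have r: "increment (\<lambda>i. norm (z i - z' i) + r i) X" if "increment r X" for X :: "'i \<Rightarrow> 'w \<Rightarrow> real^'n"
    by (rule increment_mono[OF that, where K=1]) (auto simp: r_nonneg)
  have r2: "increment (\<lambda>i. norm (z i - z' i) + r i) X" if "increment (\<lambda>i. (r i)\<^sup>2) X" for X :: "'i \<Rightarrow> 'w \<Rightarrow> real^'n"
    by (rule r, rule increment_R_mono[OF that[unfolded power2_eq_square]]) (rule r_nonneg)
  have l: "increment (\<lambda>i. norm (z i - z' i) + r i) (\<lambda>i \<omega>. common i \<omega> (z i) - common i \<omega> (z' i))"
    by (rule increment_mono[OF common_lip, where K=1]) (auto simp: r_nonneg)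
  show "increment (\<lambda>i. norm (z i - z' i) + r i) (\<lambda>i \<omega>. F i \<omega> - (z i - z' i))"
    by (rule increment_cong[OF increment_add[OF increment_diff[OF r2[OF fine_expansion(1)[of z]] r2[OF fine_expansion(2)[of z']]]
      increment_add[OF l increment_add[OF r[OF odd_bounded(1)[of z]] r[OF odd_bounded(1)[of z']]]]]])
      (simp add: F_def algebra_simps)
  show "increment (\<lambda>i. norm (z i - z' i) + r i) (\<lambda>i \<omega>. C i \<omega> - (z i - z' i))"
    by (rule increment_cong[OF increment_add[OF increment_diff[OF r2[OF coarse_expansion[of 1 z]] r2[OF coarse_expansion[of "-1" z']]]
      increment_add[OF l increment_add[OF r[OF odd_bounded(2)[of z]] r[OF odd_bounded(2)[of z']]]]]])
      (simp add: C_def algebra_simps)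
qed

text \<open>
  In the mean of a scheme and its partner the even part is evaluated, up to a quadratic error, at the mean of the
  states, while the odd parts leave only the difference of their coefficients at the two states. The remaining
  even parts of the fine and the coarse mean differ by a Lipschitz term in the gap itself.
\<close>

lemma average_difference:
  fixes f f' c c' :: "'i \<Rightarrow> real^'n"
  defines "D \<equiv> \<lambda>i. (1/2) *\<^sub>R (f i + f' i) - (1/2) *\<^sub>R (c i + c' i)"
    and "D' \<equiv> \<lambda>i \<omega>. (1/2) *\<^sub>R (second_half 1 i \<omega> (first_half 1 i \<omega> (f i)) + first_half (-1) i \<omega> (second_half (-1) i \<omega> (f' i)))
      - (1/2) *\<^sub>R (whole 1 i \<omega> (c i) + whole (-1) i \<omega> (c' i))"
  shows "increment (\<lambda>i. norm (D i) + ((r i)\<^sup>2 + (norm (f i - f' i))\<^sup>2 + (norm (c i - c' i))\<^sup>2)) (\<lambda>i \<omega>. D' i \<omega> - D i)"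
    (is "increment ?w _")
proof -
  have F: "increment ?w X" if "increment (\<lambda>i. (r i)\<^sup>2 + (norm (f i - f' i))\<^sup>2) X" for X :: "'i \<Rightarrow> 'w \<Rightarrow> real^'n"
    by (rule increment_mono[OF that, where K=1]) auto
  have C: "increment ?w X" if "increment (\<lambda>i. (r i)\<^sup>2 + (norm (c i - c' i))\<^sup>2) X" for X :: "'i \<Rightarrow> 'w \<Rightarrow> real^'n"
    by (rule increment_mono[OF that, where K=1]) auto
  have E: "increment ?w X" if "increment (\<lambda>i. (r i)\<^sup>2) X" for X :: "'i \<Rightarrow> 'w \<Rightarrow> real^'n"
    by (rule increment_mono[OF that, where K=1]) auto
  have L: "increment ?w (\<lambda>i \<omega>. common i \<omega> ((1/2) *\<^sub>R (f i + f' i)) - common i \<omega> ((1/2) *\<^sub>R (c i + c' i)))"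
    by (rule increment_mono[OF common_lip, where K=1]) (auto simp: D_def)
  note rest = E[OF fine_expansion(1)[of f]] E[OF fine_expansion(2)[of f']]
    E[OF coarse_expansion[of 1 c]] E[OF coarse_expansion[of "-1" c']]
  note main = F[OF common_midpoint[of f f']] C[OF common_midpoint[of c c']]
    F[OF odd_lip(1)[of f f']] C[OF odd_lip(2)[of c c']]
  have "increment ?w (\<lambda>i \<omega>.
    (1/2) *\<^sub>R (((second_half 1 i \<omega> (first_half 1 i \<omega> (f i)) - (f i + common i \<omega> (f i) + fine_odd i \<omega> (f i)))
      + (first_half (-1) i \<omega> (second_half (-1) i \<omega> (f' i)) - (f' i + common i \<omega> (f' i) - fine_odd i \<omega> (f' i)))
      - ((whole 1 i \<omega> (c i) - (c i + common i \<omega> (c i) + 1 *\<^sub>R coarse_odd i \<omega> (c i)))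
       + (whole (-1) i \<omega> (c' i) - (c' i + common i \<omega> (c' i) + (-1) *\<^sub>R coarse_odd i \<omega> (c' i)))))
      + (fine_odd i \<omega> (f i) - fine_odd i \<omega> (f' i) - (coarse_odd i \<omega> (c i) - coarse_odd i \<omega> (c' i))))
    + (((1/2) *\<^sub>R (common i \<omega> (f i) + common i \<omega> (f' i)) - common i \<omega> ((1/2) *\<^sub>R (f i + f' i)))
     - ((1/2) *\<^sub>R (common i \<omega> (c i) + common i \<omega> (c' i)) - common i \<omega> ((1/2) *\<^sub>R (c i + c' i)))
     + (common i \<omega> ((1/2) *\<^sub>R (f i + f' i)) - common i \<omega> ((1/2) *\<^sub>R (c i + c' i)))))"
    by (intro increment_add increment_diff increment_cmult rest main L)
  moreover have alg: "(1/2) *\<^sub>R (((F1 - (f1 + A1 + G1)) + (F2 - (f2 + A2 - G2))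
      - ((C1 - (c1 + B1 + 1 *\<^sub>R K1)) + (C2 - (c2 + B2 + (-1) *\<^sub>R K2)))) + (G1 - G2 - (K1 - K2)))
    + (((1/2) *\<^sub>R (A1 + A2) - A) - ((1/2) *\<^sub>R (B1 + B2) - B) + (A - B))
    = (1/2) *\<^sub>R (F1 + F2) - (1/2) *\<^sub>R (C1 + C2) - ((1/2) *\<^sub>R (f1 + f2) - (1/2) *\<^sub>R (c1 + c2))"
    for F1 F2 f1 f2 A1 A2 G1 G2 C1 C2 c1 c2 B1 B2 K1 K2 A B :: "real^'n"
    by (simp add: vec_eq_iff field_simps)
  ultimately show ?thesis unfolding D_def D'_def by (rule increment_cong)
qed

end

section \<open>Brownian increments\<close>

lemma generated_events_sigma: "sets (sigma (space M) (generated_events M I X)) = generated_events M I X"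
proof -
  have "{X i -` A \<inter> space M | i A. i \<in> I \<and> A \<in> sets borel} \<subseteq> Pow (space M)" by auto
  then interpret sigma_algebra "space M" "generated_events M I X"
    unfolding generated_events_def by (rule sigma_algebra_sigma_sets)
  show ?thesis by (simp add: sigma_sets_eq space_closed)
qed

lemma generated_events_measurable:
  assumes "i \<in> I" shows "X i \<in> borel_measurable (sigma (space M) (generated_events M I X))"
proof (rule measurableI)
  fix A :: "real set" assume "A \<in> sets borel"
  then show "X i -` A \<inter> space (sigma (space M) (generated_events M I X)) \<in> sets (sigma (space M) (generated_events M I X))"
  proof -
    have "X i -` A \<inter> space M \<in> generated_events M I X"
      unfolding generated_events_def using assms \<open>A \<in> sets borel\<close> by (auto intro!: sigma_sets.Basic)
    then show ?thesis by (simp add: generated_events_sigma space_measure_of_conv)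
  qed
qed auto

lemma generated_events_subset:
  assumes "space N = space M" "\<And>i. i \<in> I \<Longrightarrow> X i \<in> borel_measurable N"
  shows "generated_events M I X \<subseteq> sets N"
  unfolding generated_events_def assms(1)[symmetric]
  by (rule sets.sigma_sets_subset) (use measurable_sets[OF assms(2)] in auto)

lemma normal_abs_moment:
  obtains C where "C \<ge> 0" "\<And>s::real. s > 0 \<Longrightarrow>
    (\<integral>\<^sup>+x. ennreal (normal_density 0 s x) * ennreal (\<bar>x\<bar> ^ p) \<partial>lborel) = ennreal (C * s ^ p)"
proof -
  have ex: "\<exists>C\<ge>0. \<forall>s::real. s > 0 \<longrightarrow> has_bochner_integral lborel (\<lambda>x. normal_density 0 s x * \<bar>x\<bar> ^ p) (C * s ^ p)"
  proof (cases "even p")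
    case True
    then obtain k where p: "p = 2 * k" by (auto elim: evenE)
    show ?thesis
    proof (intro exI[of _ "fact (2*k) / (2^k * fact k)"] conjI allI impI)
      fix s :: real assume s: "s > 0"
      have "fact (2 * k) / ((2 / s\<^sup>2)^k * fact k) = fact (2*k) / (2^k * fact k) * s ^ p"
        using s by (simp add: p power_divide field_simps flip: power_mult)
      then show "has_bochner_integral lborel (\<lambda>x. normal_density 0 s x * \<bar>x\<bar> ^ p) (fact (2*k) / (2^k * fact k) * s ^ p)"
        using normal_moment_even[OF s, of 0 k] by (simp add: p power_even_abs)
    qed simp
  next
    case False
    then obtain k where p: "p = 2 * k + 1" by (auto elim: oddE)
    show ?thesis
    proof (intro exI[of _ "2^k * fact k * sqrt (2 / pi)"] conjI allI impI)
      fix s :: real assume s: "s > 0"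
      show "has_bochner_integral lborel (\<lambda>x. normal_density 0 s x * \<bar>x\<bar> ^ p) (2^k * fact k * sqrt (2 / pi) * s ^ p)"
        using normal_moment_abs_odd[OF s, of 0 k] by (simp add: p mult_ac)
    qed simp
  qed
  then obtain C where C: "C \<ge> 0" "\<And>s::real. s > 0 \<Longrightarrow> has_bochner_integral lborel (\<lambda>x. normal_density 0 s x * \<bar>x\<bar> ^ p) (C * s ^ p)"
    by blast
  show ?thesis
  proof (rule that[OF C(1)])
    fix s :: real assume s: "s > 0"
    have "(\<integral>\<^sup>+x. ennreal (normal_density 0 s x) * ennreal (\<bar>x\<bar> ^ p) \<partial>lborel)
       = (\<integral>\<^sup>+x. ennreal (normal_density 0 s x * \<bar>x\<bar> ^ p) \<partial>lborel)"
      by (simp add: ennreal_mult')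
    also have "\<dots> = ennreal (C * s ^ p)"
      using C(2)[OF s] by (subst nn_integral_eq_integral) (auto simp: has_bochner_integral_iff)
    finally show "(\<integral>\<^sup>+x. ennreal (normal_density 0 s x) * ennreal (\<bar>x\<bar> ^ p) \<partial>lborel) = ennreal (C * s ^ p)" .
  qed
qed

lemma integrable_mult_squares:
  fixes f g :: "'a \<Rightarrow> real"
  assumes [measurable]: "f \<in> borel_measurable N" "g \<in> borel_measurable N"
    and "integrable N (\<lambda>x. (f x)\<^sup>2)" "integrable N (\<lambda>x. (g x)\<^sup>2)"
  shows "integrable N (\<lambda>x. f x * g x)"
proof (rule Bochner_Integration.integrable_bound[OF Bochner_Integration.integrable_add[OF assms(3,4)]])
  have "\<bar>f x * g x\<bar> \<le> (f x)\<^sup>2 + (g x)\<^sup>2" for x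
  proof -
    have "0 \<le> (f x - g x)\<^sup>2" "0 \<le> (f x + g x)\<^sup>2" by simp_all
    then show ?thesis unfolding power2_diff power2_sum by (simp add: abs_le_iff)
  qed
  then show "AE x in N. norm (f x * g x) \<le> norm ((f x)\<^sup>2 + (g x)\<^sup>2)" by simp
qed measurable

locale brownian = prob_space M for M :: "'w measure" +
  fixes F :: "real \<Rightarrow> 'w measure" and J :: "nat set" and W :: "nat \<Rightarrow> real \<Rightarrow> 'w \<Rightarrow> real"
  assumes filt: "filtered M F" and bm: "brownian_motion M F J W"
begin

lemma subalgebra_F: "t \<ge> 0 \<Longrightarrow> subalgebra M (F t)"
  using filt by (simp add: filtered_def)

lemma F_mono: "0 \<le> s \<Longrightarrow> s \<le> t \<Longrightarrow> f \<in> measurable (F s) N \<Longrightarrow> f \<in> measurable (F t) N"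
  using filt measurable_from_subalg unfolding filtered_def by blast

lemma W_measurable_F: "j \<in> J \<Longrightarrow> 0 \<le> s \<Longrightarrow> s \<le> t \<Longrightarrow> W j s \<in> borel_measurable (F t)"
  using bm F_mono[of s t "W j s"] by (auto simp: brownian_motion_def)

lemma W_measurable: "j \<in> J \<Longrightarrow> 0 \<le> s \<Longrightarrow> W j s \<in> borel_measurable M"
  using W_measurable_F[of j s s] subalgebra_F measurable_from_subalg by blast

text \<open>
  The information in the increments after time \<open>s\<close>, which is independent of \<open>F s\<close>.
\<close>

definition future :: "real \<Rightarrow> 'w measure"
  where "future s = sigma (space M) (generated_events M (J \<times> {s..}) (\<lambda>(j, u) \<omega>. W j u \<omega> - W j s \<omega>))"

lemma indep_future: "s \<ge> 0 \<Longrightarrow> indep_set (sets (F s)) (sets (future s))"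
  using bm unfolding future_def generated_events_sigma brownian_motion_def by blast

lemma subalgebra_future: "s \<ge> 0 \<Longrightarrow> subalgebra M (future s)"
  using indep_setD_ev2[OF indep_future] by (simp add: subalgebra_def future_def space_measure_of_conv)

lemma increment_future:
  assumes "j \<in> J" "s \<le> u" "s \<le> v"
  shows "(\<lambda>\<omega>. W j u \<omega> - W j v \<omega>) \<in> borel_measurable (future s)"
proof -
  have "(\<lambda>\<omega>. W j u \<omega> - W j s \<omega>) \<in> borel_measurable (future s)" if "s \<le> u" for u
    using generated_events_measurable[of "(j, u)" "J \<times> {s..}" "\<lambda>(j, u) \<omega>. W j u \<omega> - W j s \<omega>" M] assms(1) that
    by (simp add: future_def)
  from borel_measurable_diff[OF this[OF assms(2)] this[OF assms(3)]] show ?thesis by simp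
qed

text \<open>
  Gaussian scaling; the case \<open>s = t\<close> has no density and is treated separately.
\<close>

lemma increment_moments:
  obtains C where "C \<ge> 0" "\<And>j s t. j \<in> J \<Longrightarrow> 0 \<le> s \<Longrightarrow> s \<le> t \<Longrightarrow>
    (\<integral>\<^sup>+\<omega>. ennreal (\<bar>W j t \<omega> - W j s \<omega>\<bar> ^ p) \<partial>M) \<le> ennreal (C * sqrt (t - s) ^ p)"
proof -
  obtain C where C: "C \<ge> 0" "\<And>s::real. s > 0 \<Longrightarrow>
    (\<integral>\<^sup>+x. ennreal (normal_density 0 s x) * ennreal (\<bar>x\<bar> ^ p) \<partial>lborel) = ennreal (C * s ^ p)"
    using normal_abs_moment by metis
  show ?thesis
  proof (rule that[of "max 1 C"])
    fix j s t assume j: "j \<in> J" "0 \<le> s" "s \<le> (t::real)"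
    show "(\<integral>\<^sup>+\<omega>. ennreal (\<bar>W j t \<omega> - W j s \<omega>\<bar> ^ p) \<partial>M) \<le> ennreal (max 1 C * sqrt (t - s) ^ p)"
    proof (cases "s < t")
      case True
      then have D: "distributed M lborel (\<lambda>\<omega>. W j t \<omega> - W j s \<omega>) (\<lambda>y. ennreal (normal_density 0 (sqrt (t - s)) y))"
        using bm j by (auto simp: brownian_motion_def)
      have "(\<integral>\<^sup>+\<omega>. ennreal (\<bar>W j t \<omega> - W j s \<omega>\<bar> ^ p) \<partial>M) = ennreal (C * sqrt (t - s) ^ p)"
        using C(2)[of "sqrt (t - s)"] True by (subst distributed_nn_integral[OF D, symmetric]) auto
      also have "\<dots> \<le> ennreal (max 1 C * sqrt (t - s) ^ p)"
        using True by (intro ennreal_leI mult_right_mono) auto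
      finally show ?thesis .
    next
      case False
      then have "t = s" using j by simp
      then show ?thesis by (cases p) (auto simp: emeasure_space_1 one_ennreal_def[symmetric] intro!: ennreal_leI)
    qed
  qed (use C in auto)
qed

lemma increment_integrable:
  assumes "j \<in> J" "0 \<le> s" "s \<le> t"
  shows "integrable M (\<lambda>\<omega>. (W j t \<omega> - W j s \<omega>) ^ p)"
proof (rule integrableI_bounded)
  show "(\<lambda>\<omega>. (W j t \<omega> - W j s \<omega>) ^ p) \<in> borel_measurable M"
    using assms by (intro borel_measurable_power borel_measurable_diff W_measurable) auto
  obtain C where "(\<integral>\<^sup>+\<omega>. ennreal (\<bar>W j t \<omega> - W j s \<omega>\<bar> ^ p) \<partial>M) \<le> ennreal (C * sqrt (t - s) ^ p)"
    using increment_moments assms by metis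
  then show "(\<integral>\<^sup>+ \<omega>. ennreal (norm ((W j t \<omega> - W j s \<omega>) ^ p)) \<partial>M) < \<infinity>"
    by (simp add: power_abs order.strict_trans1)
qed

lemma increment_expectation:
  assumes "j \<in> J" "0 \<le> s" "s \<le> t"
  shows "expectation (\<lambda>\<omega>. W j t \<omega> - W j s \<omega>) = 0"
    and "expectation (\<lambda>\<omega>. (W j t \<omega> - W j s \<omega>)\<^sup>2) = t - s"
proof -
  have "expectation (\<lambda>\<omega>. W j t \<omega> - W j s \<omega>) = 0 \<and> expectation (\<lambda>\<omega>. (W j t \<omega> - W j s \<omega>)\<^sup>2) = t - s"
  proof (cases "s < t")
    case True
    then have D: "distributed M lborel (\<lambda>\<omega>. W j t \<omega> - W j s \<omega>) (normal_density 0 (sqrt (t - s)))"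
      using bm assms by (auto simp: brownian_motion_def)
    have s: "0 < sqrt (t - s)" using True by simp
    show ?thesis
      using normal_distributed_expectation[OF s D] normal_distributed_variance[OF s D] True by simp
  next
    case False
    then have "t = s" using assms by simp
    then show ?thesis by simp
  qed
  then show "expectation (\<lambda>\<omega>. W j t \<omega> - W j s \<omega>) = 0" "expectation (\<lambda>\<omega>. (W j t \<omega> - W j s \<omega>)\<^sup>2) = t - s"
    by auto
qed

lemma expectation_past_future:
  assumes "s \<ge> 0" "X \<in> borel_measurable (F s)" "integrable M X" "Y \<in> borel_measurable (future s)" "integrable M Y"
  shows "expectation (\<lambda>\<omega>. X \<omega> * Y \<omega>) = expectation X * expectation Y" "integrable M (\<lambda>\<omega>. X \<omega> * (Y \<omega>::real))"
proof -
  have ind: "indep_var borel X borel Y"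
    using assms by (intro indep_var_subalgebra[OF indep_future subalgebra_F subalgebra_future])
  show "expectation (\<lambda>\<omega>. X \<omega> * Y \<omega>) = expectation X * expectation Y" "integrable M (\<lambda>\<omega>. X \<omega> * Y \<omega>)"
    using indep_var_lebesgue_integral[OF ind assms(3,5)] indep_var_integrable[OF ind assms(3,5)] by auto
qed

lemma increment_mult_integrable:
  assumes "j \<in> J" "0 \<le> a" "a \<le> b" "0 \<le> a'" "a' \<le> b'"
  shows "integrable M (\<lambda>\<omega>. (W j b \<omega> - W j a \<omega>) * (W j b' \<omega> - W j a' \<omega>))"
proof -
  have m: "(\<lambda>\<omega>. W j v \<omega> - W j u \<omega>) \<in> borel_measurable M" if "0 \<le> u" "u \<le> v" for u v
    using that by (intro borel_measurable_diff W_measurable[OF assms(1)]) auto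
  show ?thesis using assms by (intro integrable_mult_squares m increment_integrable)
qed

lemma increment_covariance:
  assumes j: "j \<in> J" and "0 \<le> a" "a \<le> b" "a \<le> b'"
  shows "expectation (\<lambda>\<omega>. (W j b \<omega> - W j a \<omega>) * (W j b' \<omega> - W j a \<omega>)) = min b b' - a"
proof -
  have *: "expectation (\<lambda>\<omega>. (W j b \<omega> - W j a \<omega>) * (W j b' \<omega> - W j a \<omega>)) = b - a" if "a \<le> b" "b \<le> b'" for b b'
  proof -
    have "(W j b \<omega> - W j a \<omega>) * (W j b' \<omega> - W j a \<omega>) = (W j b \<omega> - W j a \<omega>)\<^sup>2 + (W j b \<omega> - W j a \<omega>) * (W j b' \<omega> - W j b \<omega>)" for \<omega>
      by (simp add: power2_eq_square algebra_simps)
    moreover have "(\<lambda>\<omega>. W j b \<omega> - W j a \<omega>) \<in> borel_measurable (F b)"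
      using W_measurable_F[OF j] assms that by (intro borel_measurable_diff) auto
    ultimately show ?thesis
      using expectation_past_future[of b "\<lambda>\<omega>. W j b \<omega> - W j a \<omega>" "\<lambda>\<omega>. W j b' \<omega> - W j b \<omega>"]
        increment_integrable[OF j, of a b 1] increment_integrable[OF j, of b b' 1] increment_integrable[OF j, of a b 2]
        increment_expectation[OF j, of b b'] increment_expectation[OF j, of a b] increment_future[OF j, of b b' b]
        assms that by simp
  qed
  show ?thesis
    using *[of b b'] *[of b' b] assms by (cases "b \<le> b'") (auto simp: mult.commute)
qed

definition bounded_rv :: "('w \<Rightarrow> real) \<Rightarrow> bool"
  where "bounded_rv X \<longleftrightarrow> (\<exists>K. \<forall>\<omega>\<in>space M. \<bar>X \<omega>\<bar> \<le> K)"

lemma bounded_rv_mult: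
  assumes "bounded_rv X" "bounded_rv Y" shows "bounded_rv (\<lambda>\<omega>. X \<omega> * Y \<omega>)"
proof -
  obtain K L where "\<And>\<omega>. \<omega> \<in> space M \<Longrightarrow> \<bar>X \<omega>\<bar> \<le> K" "\<And>\<omega>. \<omega> \<in> space M \<Longrightarrow> \<bar>Y \<omega>\<bar> \<le> L"
    using assms unfolding bounded_rv_def by auto
  then have "\<bar>X \<omega> * Y \<omega>\<bar> \<le> \<bar>K\<bar> * \<bar>L\<bar>" if "\<omega> \<in> space M" for \<omega>
    using that unfolding abs_mult by (intro mult_mono) fastforce+
  then show ?thesis unfolding bounded_rv_def by blast
qed

lemma bounded_rv_integrable:
  assumes "bounded_rv X" "X \<in> borel_measurable M" "integrable M (Y::_ \<Rightarrow> real)"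
  shows "integrable M (\<lambda>\<omega>. X \<omega> * Y \<omega>)"
proof -
  obtain K where K: "\<forall>\<omega>\<in>space M. \<bar>X \<omega>\<bar> \<le> K" using assms(1) by (auto simp: bounded_rv_def)
  show ?thesis
  proof (rule Bochner_Integration.integrable_bound[where f="\<lambda>\<omega>. K * Y \<omega>"])
    show "AE \<omega> in M. norm (X \<omega> * Y \<omega>) \<le> norm (K * Y \<omega>)"
    proof (rule AE_I2)
      fix \<omega> assume "\<omega> \<in> space M"
      then have "\<bar>X \<omega>\<bar> \<le> \<bar>K\<bar>" using K by fastforce
      then show "norm (X \<omega> * Y \<omega>) \<le> norm (K * Y \<omega>)" by (simp add: abs_mult mult_right_mono)
    qed
  qed (use assms in auto)
qed

text \<open>
  If the intervals overlap, the increment over the earlier one is cut at the left end point of the later one. The piece before the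
  cut is known when the later increment starts, hence uncorrelated with it. Both factors of the rest
  start at the cut, and their covariance is the length of the overlap.
\<close>

lemma isometry_pair:
  assumes j: "j \<in> J" and ab: "0 \<le> a" "a \<le> b" "0 \<le> a'" "a' \<le> b'"
    and X: "X \<in> borel_measurable (F a)" "bounded_rv X" and X': "X' \<in> borel_measurable (F a')" "bounded_rv X'"
  shows "expectation (\<lambda>\<omega>. (X \<omega> * (W j b \<omega> - W j a \<omega>)) * (X' \<omega> * (W j b' \<omega> - W j a' \<omega>)))
    = expectation (\<lambda>\<omega>. X \<omega> * X' \<omega>) * measure lborel ({a<..b} \<inter> {a'<..b'})"
    "integrable M (\<lambda>\<omega>. (X \<omega> * (W j b \<omega> - W j a \<omega>)) * (X' \<omega> * (W j b' \<omega> - W j a' \<omega>)))"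
proof -
  have int: "integrable M (\<lambda>\<omega>. (X \<omega> * X' \<omega>) * ((W j b \<omega> - W j a \<omega>) * (W j b' \<omega> - W j a' \<omega>)))"
    if "0 \<le> a" "a \<le> b" "0 \<le> a'" "a' \<le> b'"
      "X \<in> borel_measurable (F a)" "bounded_rv X" "X' \<in> borel_measurable (F a')" "bounded_rv X'" for a b a' b' X X'
  proof (rule bounded_rv_integrable[OF bounded_rv_mult])
    show "(\<lambda>\<omega>. X \<omega> * X' \<omega>) \<in> borel_measurable M"
      using that subalgebra_F by (intro borel_measurable_times) (auto intro: measurable_from_subalg)
  qed (use that in \<open>auto intro!: increment_mult_integrable j\<close>)
  show "integrable M (\<lambda>\<omega>. (X \<omega> * (W j b \<omega> - W j a \<omega>)) * (X' \<omega> * (W j b' \<omega> - W j a' \<omega>)))"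
    using int[OF ab X X'] by (simp add: mult_ac)
  have main: "expectation (\<lambda>\<omega>. (X \<omega> * X' \<omega>) * ((W j b \<omega> - W j a \<omega>) * (W j b' \<omega> - W j a' \<omega>)))
    = expectation (\<lambda>\<omega>. X \<omega> * X' \<omega>) * measure lborel ({a<..b} \<inter> {a'<..b'})"
    if ab: "0 \<le> a" "a \<le> b" "a \<le> a'" "a' \<le> b'"
      and X: "X \<in> borel_measurable (F a)" "bounded_rv X" and X': "X' \<in> borel_measurable (F a')" "bounded_rv X'" for a b a' b' X X'
  proof -
    have XX: "(\<lambda>\<omega>. X \<omega> * X' \<omega>) \<in> borel_measurable (F a')"
      using F_mono[OF ab(1,3) X(1)] X'(1) by measurable
    have a': "0 \<le> a'" using ab by simp
    have XXi: "integrable M (\<lambda>\<omega>. X \<omega> * X' \<omega>)"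
      using bounded_rv_integrable[OF bounded_rv_mult[OF X(2) X'(2)], of "\<lambda>_. 1"]
        measurable_from_subalg[OF subalgebra_F[OF a'] XX] by simp
    \<comment> \<open>an increment up to time \<open>a'\<close> is uncorrelated with the later one\<close>
    have zero: "expectation (\<lambda>\<omega>. (X \<omega> * X' \<omega>) * ((W j c \<omega> - W j a \<omega>) * (W j b' \<omega> - W j a' \<omega>))) = 0" if c: "a \<le> c" "c \<le> a'" for c
    proof -
      have P: "(\<lambda>\<omega>. (X \<omega> * X' \<omega>) * (W j c \<omega> - W j a \<omega>)) \<in> borel_measurable (F a')"
        using c ab by (intro borel_measurable_times[OF XX] borel_measurable_diff W_measurable_F[OF j]) auto
      have Pi: "integrable M (\<lambda>\<omega>. (X \<omega> * X' \<omega>) * (W j c \<omega> - W j a \<omega>))"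
        using c ab increment_integrable[OF j, of a c 1]
        by (intro bounded_rv_integrable bounded_rv_mult X(2) X'(2) measurable_from_subalg[OF subalgebra_F[OF a'] XX]) auto
      from expectation_past_future(1)[OF a' P Pi increment_future[OF j, of a' b' a']]
      show ?thesis using increment_integrable[OF j, of a' b' 1] increment_expectation(1)[OF j, of a' b'] a' ab
        by (simp add: mult.assoc)
    qed
    show ?thesis
    proof (cases "b \<le> a'")
      case True
      then have "{a<..b} \<inter> {a'<..b'} = {}" using ab by auto
      then show ?thesis using zero[of b] True ab by simp
    next
      case False
      then have b: "a' \<le> b" by simp
      have "{a<..b} \<inter> {a'<..b'} = {a'<..min b b'}" using ab b by auto
      then have m: "measure lborel ({a<..b} \<inter> {a'<..b'}) = min b b' - a'" using ab b by simp
      have "(X \<omega> * X' \<omega>) * ((W j b \<omega> - W j a \<omega>) * (W j b' \<omega> - W j a' \<omega>))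
        = (X \<omega> * X' \<omega>) * ((W j a' \<omega> - W j a \<omega>) * (W j b' \<omega> - W j a' \<omega>))
          + (X \<omega> * X' \<omega>) * ((W j b \<omega> - W j a' \<omega>) * (W j b' \<omega> - W j a' \<omega>))" for \<omega>
        by (simp add: algebra_simps)
      then have "expectation (\<lambda>\<omega>. (X \<omega> * X' \<omega>) * ((W j b \<omega> - W j a \<omega>) * (W j b' \<omega> - W j a' \<omega>)))
        = expectation (\<lambda>\<omega>. (X \<omega> * X' \<omega>) * ((W j a' \<omega> - W j a \<omega>) * (W j b' \<omega> - W j a' \<omega>)))
          + expectation (\<lambda>\<omega>. (X \<omega> * X' \<omega>) * ((W j b \<omega> - W j a' \<omega>) * (W j b' \<omega> - W j a' \<omega>)))"
        using int[of a a' a' b' X X'] int[of a' b a' b' X X'] ab X X' b F_mono[OF ab(1,3) X(1)] by simp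
      also have "\<dots> = expectation (\<lambda>\<omega>. X \<omega> * X' \<omega>) * expectation (\<lambda>\<omega>. (W j b \<omega> - W j a' \<omega>) * (W j b' \<omega> - W j a' \<omega>))"
        using zero[of a'] ab b
        by (subst expectation_past_future(1)[OF a' XX XXi])
          (auto intro!: borel_measurable_times increment_future[OF j] increment_mult_integrable j)
      finally show ?thesis using increment_covariance[OF j a' b ab(4)] m by simp
    qed
  qed
  have "expectation (\<lambda>\<omega>. (X \<omega> * X' \<omega>) * ((W j b \<omega> - W j a \<omega>) * (W j b' \<omega> - W j a' \<omega>)))
    = expectation (\<lambda>\<omega>. X \<omega> * X' \<omega>) * measure lborel ({a<..b} \<inter> {a'<..b'})"
  proof (cases "a \<le> a'")
    case True
    show ?thesis by (rule main[OF ab(1,2) True ab(4) X X'])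
  next
    case False
    then show ?thesis using main[OF ab(3,4) _ ab(2) X' X] by (simp add: mult_ac Int_commute)
  qed
  then show "expectation (\<lambda>\<omega>. (X \<omega> * (W j b \<omega> - W j a \<omega>)) * (X' \<omega> * (W j b' \<omega> - W j a' \<omega>)))
    = expectation (\<lambda>\<omega>. X \<omega> * X' \<omega>) * measure lborel ({a<..b} \<inter> {a'<..b'})"
    by (simp add: mult_ac)
qed

end

section \<open>Isometry and uniqueness of the Ito integral\<close>

lemma simple_value_sum:
  "simple_value h v \<omega> = (\<Sum>k<length h. snd (snd (h ! k)) \<omega> * indicator {fst (h ! k)<..fst (snd (h ! k))} v)"
  unfolding simple_value_def
  by (simp add: sum_list_sum_nth case_prod_beta atLeast0LessThan)

lemma simple_integral_sum:
  "simple_integral V h \<omega> = (\<Sum>k<length h. snd (snd (h ! k)) \<omega> * (V (fst (snd (h ! k))) \<omega> - V (fst (h ! k)) \<omega>))"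
  unfolding simple_integral_def
  by (simp add: sum_list_sum_nth case_prod_beta atLeast0LessThan)

definition neg_process :: "'w simple_process \<Rightarrow> 'w simple_process"
  where "neg_process h = map (\<lambda>(a, b, X). (a, b, \<lambda>\<omega>. - X \<omega>)) h"

lemma simple_value_diff: "simple_value (h @ neg_process g) v \<omega> = simple_value h v \<omega> - simple_value g v \<omega>"
proof -
  have "simple_value (neg_process g) v \<omega> = - simple_value g v \<omega>"
    by (induction g) (auto simp: simple_value_def neg_process_def)
  then show ?thesis by (simp add: simple_value_def)
qed

lemma simple_integral_diff:
  "simple_integral V (h @ neg_process g) \<omega> = simple_integral V h \<omega> - simple_integral V g \<omega>"
proof -
  have "simple_integral V (neg_process g) \<omega> = - simple_integral V g \<omega>"
    by (induction g) (auto simp: simple_integral_def neg_process_def algebra_simps)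
  then show ?thesis by (simp add: simple_integral_def)
qed

lemma simple_integrand_diff:
  assumes "simple_integrand M F s t h" "simple_integrand M F s t g"
  shows "simple_integrand M F s t (h @ neg_process g)"
  using assms unfolding simple_integrand_def neg_process_def
  by (fastforce simp: case_prod_beta)

lemma sum_three_squares: "(x + y + z)\<^sup>2 \<le> 3 * (x\<^sup>2 + y\<^sup>2 + (z::real)\<^sup>2)"
proof -
  have "0 \<le> (x - y)\<^sup>2" "0 \<le> (y - z)\<^sup>2" "0 \<le> (x - z)\<^sup>2" by simp_all
  then show ?thesis by (simp add: power2_eq_square algebra_simps)
qed

lemma sum_two_squares: "(x - y)\<^sup>2 \<le> 2 * ((x - z)\<^sup>2 + (y - (z::real))\<^sup>2)"
proof -
  have "0 \<le> (x + y - 2 * z)\<^sup>2" by simp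
  then show ?thesis by (simp add: power2_eq_square algebra_simps)
qed

lemma integral_double_sum:
  fixes f :: "nat \<Rightarrow> nat \<Rightarrow> 'a \<Rightarrow> real"
  assumes "\<And>k l. k < n \<Longrightarrow> l < n \<Longrightarrow> integrable N (f k l)"
  shows "(\<integral>x. (\<Sum>k<n. \<Sum>l<n. f k l x) \<partial>N) = (\<Sum>k<n. \<Sum>l<n. \<integral>x. f k l x \<partial>N)"
proof -
  have "(\<integral>x. (\<Sum>k<n. \<Sum>l<n. f k l x) \<partial>N) = (\<Sum>k<n. \<integral>x. (\<Sum>l<n. f k l x) \<partial>N)"
    by (rule Bochner_Integration.integral_sum) (auto intro!: Bochner_Integration.integrable_sum assms)
  also have "\<dots> = (\<Sum>k<n. \<Sum>l<n. \<integral>x. f k l x \<partial>N)"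
    by (intro sum.cong refl Bochner_Integration.integral_sum) (auto intro: assms)
  finally show ?thesis .
qed

context brownian
begin

lemma simple_integrand_nth:
  assumes "simple_integrand M F s t h" "k < length h"
  shows "s \<le> fst (h ! k)" "fst (h ! k) \<le> fst (snd (h ! k))" "fst (snd (h ! k)) \<le> t"
    "snd (snd (h ! k)) \<in> borel_measurable (F (fst (h ! k)))" "bounded_rv (snd (snd (h ! k)))"
  using assms(1)[unfolded simple_integrand_def, rule_format, OF nth_mem[OF assms(2)]]
  by (auto simp: case_prod_beta bounded_rv_def)

text \<open>
  Both sides are quadratic forms in the integrand, so the identity reduces to pairs of summands.
\<close>

lemma simple_isometry:
  assumes j: "j \<in> J" and s: "0 \<le> s" and h: "simple_integrand M F s t h"
  shows "(\<integral>\<^sup>+\<omega>. ennreal ((simple_integral (W j) h \<omega>)\<^sup>2) \<partial>M)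
    = (\<integral>\<^sup>+\<omega>. (\<integral>\<^sup>+v\<in>{s..t}. ennreal ((simple_value h v \<omega>)\<^sup>2) \<partial>lborel) \<partial>M)"
proof -
  define n where "n = length h"
  define a where "a k = fst (h ! k)" for k
  define b where "b k = fst (snd (h ! k))" for k
  define X where "X k = snd (snd (h ! k))" for k
  define D where "D k \<omega> = W j (b k) \<omega> - W j (a k) \<omega>" for k \<omega>
  define m where "m k l = measure lborel ({a k<..b k} \<inter> {a l<..b l})" for k l
  have h': "s \<le> a k" "0 \<le> a k" "a k \<le> b k" "b k \<le> t" "X k \<in> borel_measurable (F (a k))" "bounded_rv (X k)" if "k < n" for k
    using simple_integrand_nth[OF h] that s unfolding n_def a_def b_def X_def by force+
  have XM: "X k \<in> borel_measurable M" if "k < n" for k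
    using h'[OF that] subalgebra_F measurable_from_subalg by blast
  have XX: "integrable M (\<lambda>\<omega>. X k \<omega> * X l \<omega>)" if "k < n" "l < n" for k l
    using bounded_rv_integrable[OF bounded_rv_mult[OF h'(6) h'(6)], of k l "\<lambda>_. 1"] XM that by auto
  have si: "(simple_integral (W j) h \<omega>)\<^sup>2 = (\<Sum>k<n. \<Sum>l<n. (X k \<omega> * D k \<omega>) * (X l \<omega> * D l \<omega>))" for \<omega>
    unfolding simple_integral_sum power2_eq_square sum_product n_def X_def D_def a_def b_def ..
  have pair: "expectation (\<lambda>\<omega>. (X k \<omega> * D k \<omega>) * (X l \<omega> * D l \<omega>)) = expectation (\<lambda>\<omega>. X k \<omega> * X l \<omega>) * m k l"
    "integrable M (\<lambda>\<omega>. (X k \<omega> * D k \<omega>) * (X l \<omega> * D l \<omega>))" if "k < n" "l < n" for k l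
    unfolding D_def m_def
    using isometry_pair[OF j h'(2,3)[OF that(1)] h'(2,3)[OF that(2)] h'(5,6)[OF that(1)] h'(5,6)[OF that(2)]] by auto
  have "(\<integral>\<^sup>+\<omega>. ennreal ((simple_integral (W j) h \<omega>)\<^sup>2) \<partial>M) = ennreal (expectation (\<lambda>\<omega>. (simple_integral (W j) h \<omega>)\<^sup>2))"
  proof (rule nn_integral_eq_integral)
    show "integrable M (\<lambda>\<omega>. (simple_integral (W j) h \<omega>)\<^sup>2)"
      unfolding si by (intro Bochner_Integration.integrable_sum pair) auto
  qed simp
  also have "expectation (\<lambda>\<omega>. (simple_integral (W j) h \<omega>)\<^sup>2) = (\<Sum>k<n. \<Sum>l<n. expectation (\<lambda>\<omega>. X k \<omega> * X l \<omega>) * m k l)"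
    unfolding si by (subst integral_double_sum) (simp_all add: pair)
  also have "\<dots> = expectation (\<lambda>\<omega>. \<Sum>k<n. \<Sum>l<n. X k \<omega> * X l \<omega> * m k l)"
    by (subst integral_double_sum) (simp_all add: XX)
  finally have lhs: "(\<integral>\<^sup>+\<omega>. ennreal ((simple_integral (W j) h \<omega>)\<^sup>2) \<partial>M) = ennreal (expectation (\<lambda>\<omega>. \<Sum>k<n. \<Sum>l<n. X k \<omega> * X l \<omega> * m k l))" .
  have inner: "(\<integral>\<^sup>+v\<in>{s..t}. ennreal ((simple_value h v \<omega>)\<^sup>2) \<partial>lborel) = ennreal (\<Sum>k<n. \<Sum>l<n. X k \<omega> * X l \<omega> * m k l)"
    and nonneg: "0 \<le> (\<Sum>k<n. \<Sum>l<n. X k \<omega> * X l \<omega> * m k l)" for \<omega>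
  proof -
    have sv: "(simple_value h v \<omega>)\<^sup>2 = (\<Sum>k<n. \<Sum>l<n. (X k \<omega> * X l \<omega>) * indicator ({a k<..b k} \<inter> {a l<..b l}) v)" for v
      unfolding simple_value_sum power2_eq_square sum_product n_def X_def a_def b_def
      by (intro sum.cong refl) (simp add: indicator_inter_arith mult_ac del: Int_greaterThanAtMost)
    have fin: "integrable lborel (indicator ({a k<..b k} \<inter> {a l<..b l}) :: real \<Rightarrow> real)" for k l
    proof (rule integrable_real_indicator)
      show "emeasure lborel ({a k<..b k} \<inter> {a l<..b l}) < \<infinity>"
        by (rule order.strict_trans1[OF emeasure_mono[of _ "{a k..b k}"]]) (auto simp: emeasure_lborel_Icc_eq)
    qed simp
    have int: "integrable lborel (\<lambda>v. (simple_value h v \<omega>)\<^sup>2)"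
      unfolding sv by (intro Bochner_Integration.integrable_sum integrable_mult_right fin)
    have I: "(\<integral>v. (simple_value h v \<omega>)\<^sup>2 \<partial>lborel) = (\<Sum>k<n. \<Sum>l<n. X k \<omega> * X l \<omega> * m k l)"
      unfolding sv
      by (subst integral_double_sum) (simp_all add: fin m_def del: Int_greaterThanAtMost)
    have "simple_value h v \<omega> = 0" if "v \<notin> {s..t}" for v
      unfolding simple_value_sum using that h'(1,4) unfolding n_def a_def b_def
      by (intro sum.neutral) (force simp: indicator_def)
    then have "(\<integral>\<^sup>+v\<in>{s..t}. ennreal ((simple_value h v \<omega>)\<^sup>2) \<partial>lborel) = (\<integral>\<^sup>+v. ennreal ((simple_value h v \<omega>)\<^sup>2) \<partial>lborel)"
      by (intro nn_integral_cong) (auto simp: indicator_def)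
    also have "\<dots> = ennreal (\<integral>v. (simple_value h v \<omega>)\<^sup>2 \<partial>lborel)"
      by (rule nn_integral_eq_integral[OF int]) simp
    finally show "(\<integral>\<^sup>+v\<in>{s..t}. ennreal ((simple_value h v \<omega>)\<^sup>2) \<partial>lborel) = ennreal (\<Sum>k<n. \<Sum>l<n. X k \<omega> * X l \<omega> * m k l)"
      unfolding I .
    show "0 \<le> (\<Sum>k<n. \<Sum>l<n. X k \<omega> * X l \<omega> * m k l)"
      unfolding I[symmetric] by (rule Bochner_Integration.integral_nonneg) simp
  qed
  show ?thesis unfolding lhs inner
    by (rule nn_integral_eq_integral[symmetric]) (auto intro!: Bochner_Integration.integrable_sum XX nonneg)
qed

lemma simple_value_measurable:
  assumes "simple_integrand M F s t h" "0 \<le> s"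
  shows "(\<lambda>(\<omega>, v). simple_value h v \<omega>) \<in> borel_measurable (M \<Otimes>\<^sub>M lborel)"
proof -
  have m: "snd (snd (h ! k)) \<in> borel_measurable M" if "k < length h" for k
    using simple_integrand_nth[OF assms(1) that] assms(2) measurable_from_subalg[OF subalgebra_F] by (meson order_trans)
  show ?thesis unfolding simple_value_sum case_prod_beta
    by (intro borel_measurable_sum borel_measurable_times measurable_compose[OF measurable_fst])
      (auto intro!: m measurable_compose[OF measurable_snd])
qed

text \<open>
  If two sequences of simple integrands approximate the same process, then by the isometry their integrals have the same limit.
\<close>

lemma is_ito_integral_unique:
  assumes j: "j \<in> J" and s: "0 \<le> s"
    and H: "(\<lambda>(\<omega>, v). H v \<omega>) \<in> borel_measurable (M \<Otimes>\<^sub>M lborel)"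
    and I: "is_ito_integral M F (W j) H s t X" and I': "is_ito_integral M F (W j) H s t Y"
  shows "AE \<omega> in M. X \<omega> = Y \<omega>"
proof -
  have [measurable]: "X \<in> borel_measurable M" "Y \<in> borel_measurable M"
    using I I' by (auto simp: is_ito_integral_def)
  let ?dist = "\<lambda>k \<omega>. \<integral>\<^sup>+v\<in>{s..t}. ennreal ((simple_value k v \<omega> - H v \<omega>)\<^sup>2) \<partial>lborel"
  obtain h where h: "\<And>n. simple_integrand M F s t (h n)"
    "(\<lambda>n::nat. \<integral>\<^sup>+\<omega>. ?dist (h n) \<omega> \<partial>M) \<longlonglongrightarrow> 0"
    "(\<lambda>n::nat. \<integral>\<^sup>+\<omega>. ennreal ((simple_integral (W j) (h n) \<omega> - X \<omega>)\<^sup>2) \<partial>M) \<longlonglongrightarrow> 0"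
    using I unfolding is_ito_integral_def by blast
  obtain g where g: "\<And>n. simple_integrand M F s t (g n)"
    "(\<lambda>n::nat. \<integral>\<^sup>+\<omega>. ?dist (g n) \<omega> \<partial>M) \<longlonglongrightarrow> 0"
    "(\<lambda>n::nat. \<integral>\<^sup>+\<omega>. ennreal ((simple_integral (W j) (g n) \<omega> - Y \<omega>)\<^sup>2) \<partial>M) \<longlonglongrightarrow> 0"
    using I' unfolding is_ito_integral_def by blast
  have sm: "simple_integral (W j) k \<in> borel_measurable M" if "simple_integrand M F s t k" for k
    unfolding simple_integral_sum[abs_def]
  proof (intro borel_measurable_sum borel_measurable_times borel_measurable_diff W_measurable j)
    fix i assume "i \<in> {..<length k}"
    then have i: "i < length k" by simp
    note n = simple_integrand_nth[OF that i]
    show "0 \<le> fst (snd (k ! i))" "0 \<le> fst (k ! i)" using n s by linarith+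
    show "snd (snd (k ! i)) \<in> borel_measurable M"
      using n s measurable_from_subalg[OF subalgebra_F] by (meson order_trans)
  qed
  note [measurable] = sm[OF h(1)] sm[OF g(1)]
  have dm: "(\<lambda>\<omega>. ?dist k \<omega>) \<in> borel_measurable M"
    "\<And>\<omega>. \<omega> \<in> space M \<Longrightarrow> (\<lambda>v. (simple_value k v \<omega> - H v \<omega>)\<^sup>2) \<in> borel_measurable lborel"
    if "simple_integrand M F s t k" for k
  proof -
    have m: "(\<lambda>(\<omega>, v). simple_value k v \<omega> - H v \<omega>) \<in> borel_measurable (M \<Otimes>\<^sub>M lborel)"
      using borel_measurable_diff[OF simple_value_measurable[OF that s] H] by (simp add: case_prod_beta)
    then have "(\<lambda>(\<omega>, v). ennreal ((simple_value k v \<omega> - H v \<omega>)\<^sup>2) * indicator {s..t} v) \<in> borel_measurable (M \<Otimes>\<^sub>M lborel)"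
      by (simp add: case_prod_beta)
    then show "(\<lambda>\<omega>. ?dist k \<omega>) \<in> borel_measurable M"
      by (rule lborel.borel_measurable_nn_integral)
    show "(\<lambda>v. (simple_value k v \<omega> - H v \<omega>)\<^sup>2) \<in> borel_measurable lborel" if "\<omega> \<in> space M" for \<omega>
      using measurable_Pair2[OF m that] by simp
  qed
  note [measurable] = dm(1)[OF h(1)] dm(1)[OF g(1)]
  define dh where "dh n = (\<integral>\<^sup>+\<omega>. ?dist (h n) \<omega> \<partial>M)" for n
  define dg where "dg n = (\<integral>\<^sup>+\<omega>. ?dist (g n) \<omega> \<partial>M)" for n
  define eh where "eh n = (\<integral>\<^sup>+\<omega>. ennreal ((simple_integral (W j) (h n) \<omega> - X \<omega>)\<^sup>2) \<partial>M)" for n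
  define eg where "eg n = (\<integral>\<^sup>+\<omega>. ennreal ((simple_integral (W j) (g n) \<omega> - Y \<omega>)\<^sup>2) \<partial>M)" for n
  define G where "G = (\<integral>\<^sup>+\<omega>. ennreal ((X \<omega> - Y \<omega>)\<^sup>2) \<partial>M)"
  have bound: "G \<le> 3 * (eh n + 2 * (dh n + dg n) + eg n)" for n
  proof -
    have mid: "(\<integral>\<^sup>+\<omega>. ennreal ((simple_integral (W j) (h n) \<omega> - simple_integral (W j) (g n) \<omega>)\<^sup>2) \<partial>M) \<le> 2 * (dh n + dg n)"
    proof -
      have "(\<integral>\<^sup>+\<omega>. ennreal ((simple_integral (W j) (h n) \<omega> - simple_integral (W j) (g n) \<omega>)\<^sup>2) \<partial>M)
        = (\<integral>\<^sup>+\<omega>. (\<integral>\<^sup>+v\<in>{s..t}. ennreal ((simple_value (h n) v \<omega> - simple_value (g n) v \<omega>)\<^sup>2) \<partial>lborel) \<partial>M)"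
        using simple_isometry[OF j s simple_integrand_diff[OF h(1) g(1)], of n n]
        by (simp add: simple_integral_diff simple_value_diff)
      also have "\<dots> \<le> (\<integral>\<^sup>+\<omega>. 2 * (?dist (h n) \<omega>
          + ?dist (g n) \<omega>) \<partial>M)"
      proof (rule nn_integral_mono)
        fix \<omega> assume "\<omega> \<in> space M"
        note [measurable] = dm(2)[OF h(1) this] dm(2)[OF g(1) this]
        have le: "ennreal ((simple_value (h n) v \<omega> - simple_value (g n) v \<omega>)\<^sup>2)
            \<le> 2 * (ennreal ((simple_value (h n) v \<omega> - H v \<omega>)\<^sup>2) + ennreal ((simple_value (g n) v \<omega> - H v \<omega>)\<^sup>2))" for v
          using ennreal_leI[OF sum_two_squares[of "simple_value (h n) v \<omega>" "simple_value (g n) v \<omega>" "H v \<omega>"]]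
          by (simp add: ennreal_mult' ennreal_plus)
        have "(\<integral>\<^sup>+v\<in>{s..t}. ennreal ((simple_value (h n) v \<omega> - simple_value (g n) v \<omega>)\<^sup>2) \<partial>lborel)
          \<le> (\<integral>\<^sup>+v. 2 * (ennreal ((simple_value (h n) v \<omega> - H v \<omega>)\<^sup>2) * indicator {s..t} v
            + ennreal ((simple_value (g n) v \<omega> - H v \<omega>)\<^sup>2) * indicator {s..t} v) \<partial>lborel)"
          using le by (intro nn_integral_mono) (auto simp: indicator_def)
        also have "\<dots> = 2 * (?dist (h n) \<omega>
          + ?dist (g n) \<omega>)"
          by (simp add: nn_integral_cmult nn_integral_add)
        finally show "(\<integral>\<^sup>+v\<in>{s..t}. ennreal ((simple_value (h n) v \<omega> - simple_value (g n) v \<omega>)\<^sup>2) \<partial>lborel) \<le> \<dots>" .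
      qed
      also have "\<dots> = 2 * (dh n + dg n)"
        unfolding dh_def dg_def by (simp add: nn_integral_cmult nn_integral_add)
      finally show ?thesis .
    qed
    have le: "ennreal ((X \<omega> - Y \<omega>)\<^sup>2) \<le> 3 * (ennreal ((simple_integral (W j) (h n) \<omega> - X \<omega>)\<^sup>2)
      + ennreal ((simple_integral (W j) (h n) \<omega> - simple_integral (W j) (g n) \<omega>)\<^sup>2)
      + ennreal ((simple_integral (W j) (g n) \<omega> - Y \<omega>)\<^sup>2))" for \<omega>
      using ennreal_leI[OF sum_three_squares[of "X \<omega> - simple_integral (W j) (h n) \<omega>"
          "simple_integral (W j) (h n) \<omega> - simple_integral (W j) (g n) \<omega>" "simple_integral (W j) (g n) \<omega> - Y \<omega>"]]
      by (simp add: ennreal_mult' ennreal_plus power2_commute[of "X \<omega>"])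
    have "G \<le> (\<integral>\<^sup>+\<omega>. 3 * (ennreal ((simple_integral (W j) (h n) \<omega> - X \<omega>)\<^sup>2)
      + ennreal ((simple_integral (W j) (h n) \<omega> - simple_integral (W j) (g n) \<omega>)\<^sup>2)
      + ennreal ((simple_integral (W j) (g n) \<omega> - Y \<omega>)\<^sup>2)) \<partial>M)"
      unfolding G_def using le by (intro nn_integral_mono)
    also have "\<dots> = 3 * (eh n + (\<integral>\<^sup>+\<omega>. ennreal ((simple_integral (W j) (h n) \<omega> - simple_integral (W j) (g n) \<omega>)\<^sup>2) \<partial>M) + eg n)"
      unfolding eh_def eg_def by (simp add: nn_integral_cmult nn_integral_add)
    also have "\<dots> \<le> 3 * (eh n + 2 * (dh n + dg n) + eg n)"
      by (intro mult_left_mono add_mono mid) auto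
    finally show ?thesis .
  qed
  have "(\<lambda>n. 3 * (eh n + 2 * (dh n + dg n) + eg n)) \<longlonglongrightarrow> 3 * (0 + 2 * (0 + 0) + 0)"
    using h(2,3) g(2,3) unfolding dh_def dg_def eh_def eg_def
    by (intro ennreal_tendsto_cmult tendsto_add) auto
  then have "G \<le> 3 * (0 + 2 * (0 + 0) + 0)" using bound by (intro LIMSEQ_le_const) auto
  then have "G = 0" by simp
  then show ?thesis unfolding G_def by (subst (asm) nn_integral_0_iff_AE) auto
qed

end

section \<open>Time integrals of Brownian increments\<close>

definition riemann :: "(real \<Rightarrow> 'w \<Rightarrow> real) \<Rightarrow> real \<Rightarrow> real \<Rightarrow> nat \<Rightarrow> 'w \<Rightarrow> real"
  where "riemann V s t n \<omega> = (t - s) / n * (\<Sum>i<n. V (s + (real i + 1) * ((t - s) / n)) \<omega> - V s \<omega>)"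

text \<open>
  The limit exists almost surely by path continuity. As a limit of a sequence this version is measurable with respect to any
  sigma-algebra containing the increments on the interval, whatever the exceptional paths do.
\<close>

definition time_integral :: "(real \<Rightarrow> 'w \<Rightarrow> real) \<Rightarrow> real \<Rightarrow> real \<Rightarrow> 'w \<Rightarrow> real"
  where "time_integral V s t \<omega> = lim (\<lambda>n. riemann V s t n \<omega>)"

text \<open>
  On each piece of the partition the mean value theorem represents the integral by a value of \<open>f\<close>, and uniform continuity compares
  that value with the one at the right end point.
\<close>

lemma riemann_sum_tendsto:
  fixes f :: "real \<Rightarrow> real"
  assumes st: "s < t" and f: "continuous_on {s..t} f"
  shows "(\<lambda>n. (t - s) / real n * (\<Sum>i<n. f (s + (real i + 1) * ((t - s) / real n)))) \<longlonglongrightarrow> (LBINT v:{s..t}. f v)"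
proof -
  define G where "G x = integral {s..x} f" for x
  have I: "(LBINT v:{s..t}. f v) = G t"
    unfolding G_def using borel_integrable_atLeastAtMost'[OF f] by (rule set_borel_integral_eq_integral(2))
  have uc: "uniformly_continuous_on {s..t} f" by (rule compact_uniformly_continuous[OF f]) simp
  show ?thesis unfolding I
  proof (rule LIMSEQ_I)
    fix e :: real assume e: "e > 0"
    define e' where "e' = e / (2 * (t - s))"
    have e': "e' > 0" using e st by (simp add: e'_def)
    obtain \<delta> where \<delta>: "\<delta> > 0" "\<And>x y. x \<in> {s..t} \<Longrightarrow> y \<in> {s..t} \<Longrightarrow> dist y x < \<delta> \<Longrightarrow> dist (f y) (f x) < e'"
      using uc e' unfolding uniformly_continuous_on_def by metis
    \<comment> \<open>the mesh has to be smaller than \<open>\<delta>\<close>\<close>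
    obtain n0 :: nat where n0: "(t - s) / \<delta> < real n0" using reals_Archimedean2 by blast
    show "\<exists>no. \<forall>n\<ge>no. norm ((t - s) / real n * (\<Sum>i<n. f (s + (real i + 1) * ((t - s) / real n))) - G t) < e"
    proof (intro exI[of _ n0] allI impI)
      fix n assume n: "n0 \<le> n"
      have "0 < (t - s) / \<delta>" using \<delta>(1) st by simp
      with n0 n have np: "n > 0" and nn: "(t - s) / \<delta> < real n" by linarith+
      define h where "h = (t - s) / real n"
      have h: "0 < h" "h < \<delta>" "real n * h = t - s" using st np nn \<delta>(1) by (auto simp: h_def field_simps)
      define x where "x i = s + real i * h" for i :: nat
      have x: "s \<le> x i" "x i \<le> t" if "i \<le> n" for i
        using that h mult_right_mono[of "real i" "real n" h] by (auto simp: x_def)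
      have piece: "\<bar>h * f (x (Suc i)) - (G (x (Suc i)) - G (x i))\<bar> \<le> h * e'" if i: "i < n" for i
      proof -
        have xi: "x i < x (Suc i)" "x (Suc i) - x i = h" using h by (auto simp: x_def algebra_simps)
        have sub: "{x i..x (Suc i)} \<subseteq> {s..t}" using x[of i] x[of "Suc i"] i by auto
        have "\<exists>y\<in>{x i<..<x (Suc i)}. G (x (Suc i)) - G (x i) = (\<lambda>y h. h *\<^sub>R f y) y (x (Suc i) - x i)"
        proof (rule mvt_simple[OF xi(1)])
          fix y assume y: "x i \<le> y" "y \<le> x (Suc i)"
          have "(G has_vector_derivative f y) (at y within {s..t})"
            unfolding G_def using y sub by (intro integral_has_vector_derivative[OF f]) auto
          then show "(G has_derivative (\<lambda>h. h *\<^sub>R f y)) (at y within {x i..x (Suc i)})"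
            unfolding has_vector_derivative_def using sub by (rule has_derivative_subset)
        qed
        then obtain y where y: "y \<in> {x i<..<x (Suc i)}" "G (x (Suc i)) - G (x i) = h * f y"
          using xi by auto
        have "dist (f (x (Suc i))) (f y) < e'"
          using y(1) sub xi h(2) by (intro \<delta>(2)) (auto simp: dist_real_def)
        then have "\<bar>f (x (Suc i)) - f y\<bar> \<le> e'" by (simp add: dist_real_def)
        then have "h * \<bar>f (x (Suc i)) - f y\<bar> \<le> h * e'" using h(1) by (intro mult_left_mono) auto
        then show ?thesis unfolding y(2) using h(1) by (simp add: abs_mult flip: right_diff_distrib)
      qed
      have "G (x n) - G (x 0) = (\<Sum>i<n. G (x (Suc i)) - G (x i))" using sum_lessThan_telescope[of "\<lambda>i. G (x i)" n] by simp
      moreover have "x n = t" "x 0 = s" using h by (auto simp: x_def)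
      moreover have "G s = 0" by (simp add: G_def)
      ultimately have Gt: "G t = (\<Sum>i<n. G (x (Suc i)) - G (x i))" by simp
      have "\<bar>h * (\<Sum>i<n. f (x (Suc i))) - G t\<bar> = \<bar>\<Sum>i<n. h * f (x (Suc i)) - (G (x (Suc i)) - G (x i))\<bar>"
        unfolding Gt by (simp add: sum_distrib_left sum_subtractf)
      also have "\<dots> \<le> (\<Sum>i<n. h * e')" by (rule order_trans[OF sum_abs sum_mono]) (auto intro: piece)
      also have "\<dots> = (t - s) * e'" using h(3) by simp
      also have "\<dots> = e / 2" using st unfolding e'_def by (simp add: divide_simps)
      finally show "norm ((t - s) / real n * (\<Sum>i<n. f (s + (real i + 1) * ((t - s) / real n))) - G t) < e"
        using e by (simp add: x_def h_def add.commute)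
    qed
  qed
qed

lemma mean_power_le:
  fixes y :: "nat \<Rightarrow> real"
  assumes "n > 0" "\<And>i. y i \<ge> 0"
  shows "((\<Sum>i<n. y i) / n) ^ p \<le> (\<Sum>i<n. y i ^ p) / n"
proof -
  have conv: "convex_on {0..} (\<lambda>x::real. x ^ p)"
  proof (cases "even p")
    case True then show ?thesis using convex_on_subset[OF convex_power_even] by blast
  next
    case False then show ?thesis by (rule convex_power_odd)
  qed
  have "(\<Sum>i<n. (1 / real n) *\<^sub>R y i) ^ p \<le> (\<Sum>i<n. (1 / real n) * y i ^ p)"
    by (rule convex_on_sum[OF _ _ conv]) (use assms in auto)
  then show ?thesis by (simp add: sum_divide_distrib)
qed

context brownian
begin

lemma grid_point:
  fixes s t :: real
  assumes "i < n" "s < t"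
  shows "s \<le> s + (real i + 1) * ((t - s) / real n)" "s + (real i + 1) * ((t - s) / real n) \<le> t"
proof -
  have "(real i + 1) * ((t - s) / real n) \<le> real n * ((t - s) / real n)"
    using assms by (intro mult_right_mono) auto
  then show "s + (real i + 1) * ((t - s) / real n) \<le> t" using assms by simp
  show "s \<le> s + (real i + 1) * ((t - s) / real n)" using assms by simp
qed

lemma riemann_measurable:
  assumes "s < t" "\<And>v. s \<le> v \<Longrightarrow> v \<le> t \<Longrightarrow> (\<lambda>\<omega>. V v \<omega> - V s \<omega>) \<in> borel_measurable N"
  shows "riemann V s t n \<in> borel_measurable N" "time_integral V s t \<in> borel_measurable N"
proof -
  show m: "riemann V s t n \<in> borel_measurable N" for n
    unfolding riemann_def[abs_def]
    by (intro borel_measurable_times borel_measurable_const borel_measurable_sum assms(2) grid_point assms(1)) auto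
  show "time_integral V s t \<in> borel_measurable N"
    unfolding time_integral_def[abs_def] by (rule borel_measurable_lim_metric[OF m])
qed

lemma riemann_AE:
  assumes j: "j \<in> J" and st: "0 \<le> s" "s < t"
  shows "AE \<omega> in M. (\<lambda>n. riemann (W j) s t n \<omega>) \<longlonglongrightarrow> time_integral (W j) s t \<omega>
    \<and> time_integral (W j) s t \<omega> = (LBINT v:{s..t}. (W j v \<omega> - W j s \<omega>))"
proof -
  have "AE \<omega> in M. continuous_on {0..} (\<lambda>t. W j t \<omega>)"
    using bm j by (auto simp: brownian_motion_def)
  then show ?thesis
  proof (rule AE_mp, intro AE_I2 impI)
    fix \<omega> assume c: "continuous_on {0..} (\<lambda>t. W j t \<omega>)"
    have "continuous_on {s..t} (\<lambda>v. W j v \<omega> - W j s \<omega>)"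
      by (intro continuous_intros continuous_on_subset[OF c]) (use st in auto)
    from riemann_sum_tendsto[OF st(2) this]
    have l: "(\<lambda>n. riemann (W j) s t n \<omega>) \<longlonglongrightarrow> (LBINT v:{s..t}. (W j v \<omega> - W j s \<omega>))"
      unfolding riemann_def .
    from limI[OF this] have "time_integral (W j) s t \<omega> = (LBINT v:{s..t}. (W j v \<omega> - W j s \<omega>))"
      unfolding time_integral_def .
    with l show "(\<lambda>n. riemann (W j) s t n \<omega>) \<longlonglongrightarrow> time_integral (W j) s t \<omega>
      \<and> time_integral (W j) s t \<omega> = (LBINT v:{s..t}. (W j v \<omega> - W j s \<omega>))" by simp
  qed
qed

lemma W_riemann_measurable:
  assumes j: "j \<in> J" and st: "0 \<le> s" "s < t"
  shows "riemann (W j) s t n \<in> borel_measurable M" "time_integral (W j) s t \<in> borel_measurable M"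
  using st by (intro riemann_measurable borel_measurable_diff W_measurable j; simp)+

text \<open>
  A refinement by the factor \<open>q\<close> replaces the value at the right end point of each coarse piece by values at most one coarse
  mesh width away, so each summand changes by a variable of variance at most that width. The bound does not
  depend on \<open>q\<close>.
\<close>

lemma riemann_refine:
  assumes j: "j \<in> J" and st: "0 \<le> s" "s < t" and n: "n > 0" and q: "q > 0"
  shows "(\<integral>\<^sup>+\<omega>. ennreal ((riemann (W j) s t (n * q) \<omega> - riemann (W j) s t n \<omega>)\<^sup>2) \<partial>M) \<le> ennreal ((t - s)^3 / n)"
proof -
  \<comment> \<open>\<open>u m\<close> is the \<open>m\<close>-th node of the fine grid, \<open>v m\<close> the right end point of the coarse piece containing it\<close>
  define e where "e = (t - s) / real (n * q)"
  have e: "e > 0" "e * real q = (t - s) / real n" "real n * real q * e = t - s" using st n q by (auto simp: e_def)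
  define u where "u m = s + (real m + 1) * e" for m :: nat
  define v where "v m = s + (real (m div q) + 1) * (e * real q)" for m
  have uv: "s \<le> u m" "u m \<le> v m" "v m - u m \<le> e * real q" for m
  proof -
    have m: "real m = real (m div q) * real q + real (m mod q)"
      by (metis div_mult_mod_eq of_nat_add of_nat_mult)
    have d: "v m - u m = e * (real q - (real (m mod q) + 1))" unfolding u_def v_def m by (simp add: algebra_simps)
    have "m mod q < q" using q by simp
    then have "real (m mod q) + 1 \<le> real q" by linarith
    then show "u m \<le> v m" using d e(1) by (smt (verit) zero_le_mult_iff)
    show "v m - u m \<le> e * real q" unfolding d using e(1) by (intro mult_left_mono) auto
    show "s \<le> u m" using e(1) by (simp add: u_def)
  qed
  define y where "y m \<omega> = W j (v m) \<omega> - W j (u m) \<omega>" for m \<omega>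
  have coarse: "riemann (W j) s t n \<omega> = e * (\<Sum>m<n*q. W j (v m) \<omega> - W j s \<omega>)" for \<omega>
  proof -
    have "(\<Sum>m<n*q. W j (v m) \<omega> - W j s \<omega>) = (\<Sum>i<n. \<Sum>m\<in>{i*q..<i*q+q}. W j (v m) \<omega> - W j s \<omega>)"
      by (rule sum.nat_group[symmetric])
    also have "\<dots> = (\<Sum>i<n. \<Sum>m\<in>{i*q..<i*q+q}. W j (s + (real i + 1) * (e * real q)) \<omega> - W j s \<omega>)"
    proof (intro sum.cong refl)
      fix i m assume "m \<in> {i*q..<i*q+q}"
      then have "m div q = i" by (intro div_nat_eqI) (auto simp: algebra_simps)
      then show "W j (v m) \<omega> - W j s \<omega> = W j (s + (real i + 1) * (e * real q)) \<omega> - W j s \<omega>" by (simp add: v_def)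
    qed
    also have "\<dots> = real q * (\<Sum>i<n. W j (s + (real i + 1) * (e * real q)) \<omega> - W j s \<omega>)"
      by (simp add: sum_distrib_left)
    finally show ?thesis unfolding riemann_def e(2)[symmetric] by (simp add: mult.assoc)
  qed
  have diff: "riemann (W j) s t (n * q) \<omega> - riemann (W j) s t n \<omega> = - (e * (\<Sum>m<n*q. y m \<omega>))" for \<omega>
    unfolding coarse unfolding riemann_def e_def[symmetric] y_def u_def[symmetric]
    by (simp add: sum_subtractf algebra_simps)
  have int: "integrable M (\<lambda>\<omega>. (y m \<omega>)\<^sup>2)" and Ey: "expectation (\<lambda>\<omega>. (y m \<omega>)\<^sup>2) = v m - u m" for m
    unfolding y_def using uv[of m] st
    by (auto intro!: increment_integrable increment_expectation j)
  have "(\<integral>\<^sup>+\<omega>. ennreal ((riemann (W j) s t (n * q) \<omega> - riemann (W j) s t n \<omega>)\<^sup>2) \<partial>M)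
    \<le> (\<integral>\<^sup>+\<omega>. ennreal (e\<^sup>2 * (real (n * q) * (\<Sum>m<n*q. (y m \<omega>)\<^sup>2))) \<partial>M)"
  proof (intro nn_integral_mono ennreal_leI)
    fix \<omega>
    have "(\<Sum>m<n*q. y m \<omega>)\<^sup>2 \<le> real (n * q) * (\<Sum>m<n*q. (y m \<omega>)\<^sup>2)"
      using sum_squared_le_sum_of_squares[of "\<lambda>m. y m \<omega>" "{..<n*q}"] by (simp add: mult.commute)
    then show "(riemann (W j) s t (n * q) \<omega> - riemann (W j) s t n \<omega>)\<^sup>2 \<le> e\<^sup>2 * (real (n * q) * (\<Sum>m<n*q. (y m \<omega>)\<^sup>2))"
      unfolding diff by (simp add: power_mult_distrib mult_left_mono)
  qed
  also have "\<dots> = ennreal (expectation (\<lambda>\<omega>. e\<^sup>2 * (real (n * q) * (\<Sum>m<n*q. (y m \<omega>)\<^sup>2))))"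
    by (rule nn_integral_eq_integral)
      (auto intro!: integrable_mult_right Bochner_Integration.integrable_sum int AE_I2 mult_nonneg_nonneg sum_nonneg)
  also have "expectation (\<lambda>\<omega>. e\<^sup>2 * (real (n * q) * (\<Sum>m<n*q. (y m \<omega>)\<^sup>2))) = e\<^sup>2 * (real (n * q) * (\<Sum>m<n*q. v m - u m))"
    by (simp add: int Ey)
  also have "\<dots> \<le> e\<^sup>2 * (real (n * q) * (\<Sum>m<n*q. e * real q))"
    by (intro mult_left_mono sum_mono uv) auto
  also have "\<dots> = (t - s)^3 / n"
  proof -
    have "e\<^sup>2 * (real (n * q) * (\<Sum>m<n*q. e * real q)) = (real n * real q * e)\<^sup>2 * (e * real q)"
      by (simp add: power2_eq_square)
    then show ?thesis unfolding e(3) unfolding e(2) by (simp add: power2_eq_square power3_eq_cube)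
  qed
  finally show ?thesis by (simp add: ennreal_leI)
qed

text \<open>
  Fatou's lemma along the refinements \<open>n * Suc q\<close> of the partition into \<open>n\<close> pieces.
\<close>

lemma time_integral_approx:
  assumes j: "j \<in> J" and st: "0 \<le> s" "s < t" and n: "n > 0"
  shows "(\<integral>\<^sup>+\<omega>. ennreal ((time_integral (W j) s t \<omega> - riemann (W j) s t n \<omega>)\<^sup>2) \<partial>M) \<le> ennreal ((t - s)^3 / n)"
proof -
  note [measurable] = W_riemann_measurable[OF j st]
  let ?u = "\<lambda>q \<omega>. ennreal ((riemann (W j) s t (n * Suc q) \<omega> - riemann (W j) s t n \<omega>)\<^sup>2)"
  have "AE \<omega> in M. ennreal ((time_integral (W j) s t \<omega> - riemann (W j) s t n \<omega>)\<^sup>2) = liminf (\<lambda>q. ?u q \<omega>)"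
    using riemann_AE[OF j st]
  proof (rule AE_mp, intro AE_I2 impI)
    fix \<omega> assume "(\<lambda>n. riemann (W j) s t n \<omega>) \<longlonglongrightarrow> time_integral (W j) s t \<omega>
      \<and> time_integral (W j) s t \<omega> = (LBINT v:{s..t}. (W j v \<omega> - W j s \<omega>))"
    then have "(\<lambda>n. riemann (W j) s t n \<omega>) \<longlonglongrightarrow> time_integral (W j) s t \<omega>" by (rule conjunct1)
    moreover have "filterlim (\<lambda>q. n * Suc q) sequentially sequentially"
      using n by (intro filterlim_subseq strict_monoI) simp
    ultimately have "(\<lambda>q. riemann (W j) s t (n * Suc q) \<omega>) \<longlonglongrightarrow> time_integral (W j) s t \<omega>"
      by (rule filterlim_compose)
    then have "(\<lambda>q. ?u q \<omega>) \<longlonglongrightarrow> ennreal ((time_integral (W j) s t \<omega> - riemann (W j) s t n \<omega>)\<^sup>2)"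
      by (intro tendsto_ennrealI tendsto_intros)
    then show "ennreal ((time_integral (W j) s t \<omega> - riemann (W j) s t n \<omega>)\<^sup>2) = liminf (\<lambda>q. ?u q \<omega>)"
      using lim_imp_Liminf by (metis sequentially_bot)
  qed
  then have "(\<integral>\<^sup>+\<omega>. ennreal ((time_integral (W j) s t \<omega> - riemann (W j) s t n \<omega>)\<^sup>2) \<partial>M)
    = (\<integral>\<^sup>+\<omega>. liminf (\<lambda>q. ?u q \<omega>) \<partial>M)" by (rule nn_integral_cong_AE)
  also have "\<dots> \<le> liminf (\<lambda>q. \<integral>\<^sup>+\<omega>. ?u q \<omega> \<partial>M)"
    by (rule nn_integral_liminf) measurable
  also have "\<dots> \<le> liminf (\<lambda>q. ennreal ((t - s)^3 / n))"
    by (intro Liminf_mono always_eventually allI riemann_refine[OF j st n]) simp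
  finally show ?thesis by (simp add: Liminf_const)
qed

text \<open>
  Jensen's inequality for the Riemann sums, then Fatou's lemma. The exponent three reflects one integration in time of an increment
  of size \<open>sqrt (t - s)\<close>.
\<close>

lemma time_integral_moments:
  obtains C where "C \<ge> 0" "\<And>j s t. j \<in> J \<Longrightarrow> 0 \<le> s \<Longrightarrow> s < t \<Longrightarrow>
    (\<integral>\<^sup>+\<omega>. ennreal (\<bar>time_integral (W j) s t \<omega>\<bar> ^ p) \<partial>M) \<le> ennreal (C * (sqrt (t - s) ^ 3) ^ p)"
proof -
  obtain C where C: "C \<ge> 0" "\<And>j s t. j \<in> J \<Longrightarrow> 0 \<le> s \<Longrightarrow> s \<le> t \<Longrightarrow>
    (\<integral>\<^sup>+\<omega>. ennreal (\<bar>W j t \<omega> - W j s \<omega>\<bar> ^ p) \<partial>M) \<le> ennreal (C * sqrt (t - s) ^ p)"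
    using increment_moments by metis
  show ?thesis
  proof (rule that[OF C(1)])
    fix j s t assume j: "j \<in> J" and st: "0 \<le> s" "s < (t::real)"
    note [measurable] = W_riemann_measurable[OF j st]
    have bound: "(\<integral>\<^sup>+\<omega>. ennreal (\<bar>riemann (W j) s t n \<omega>\<bar> ^ p) \<partial>M) \<le> ennreal (C * (sqrt (t - s) ^ 3) ^ p)" if n: "n > 0" for n
    proof -
      define x where "x i = s + (real i + 1) * ((t - s) / real n)" for i
      have x: "s \<le> x i" "x i \<le> t" if "i < n" for i using grid_point[OF that st(2)] by (auto simp: x_def)
      have Wm: "(\<lambda>\<omega>. \<bar>W j (x i) \<omega> - W j s \<omega>\<bar>) \<in> borel_measurable M" if "i < n" for i
        using x[OF that] st by (intro borel_measurable_abs borel_measurable_diff W_measurable j) auto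
      have "(\<integral>\<^sup>+\<omega>. ennreal (\<bar>riemann (W j) s t n \<omega>\<bar> ^ p) \<partial>M)
        \<le> (\<integral>\<^sup>+\<omega>. (\<Sum>i<n. ennreal ((t - s) ^ p / n) * ennreal (\<bar>W j (x i) \<omega> - W j s \<omega>\<bar> ^ p)) \<partial>M)"
      proof (rule nn_integral_mono)
        fix \<omega>
        have "\<bar>riemann (W j) s t n \<omega>\<bar> \<le> (t - s) * ((\<Sum>i<n. \<bar>W j (x i) \<omega> - W j s \<omega>\<bar>) / n)"
        proof -
          have "\<bar>riemann (W j) s t n \<omega>\<bar> = (t - s) * (\<bar>\<Sum>i<n. W j (x i) \<omega> - W j s \<omega>\<bar> / n)"
            using st by (simp add: riemann_def x_def abs_mult)
          also have "\<dots> \<le> (t - s) * ((\<Sum>i<n. \<bar>W j (x i) \<omega> - W j s \<omega>\<bar>) / n)"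
            using st by (intro mult_left_mono divide_right_mono sum_abs) auto
          finally show ?thesis .
        qed
        then have "\<bar>riemann (W j) s t n \<omega>\<bar> ^ p \<le> (t - s) ^ p * ((\<Sum>i<n. \<bar>W j (x i) \<omega> - W j s \<omega>\<bar>) / n) ^ p"
          by (metis abs_ge_zero power_mono power_mult_distrib)
        also have "\<dots> \<le> (t - s) ^ p * ((\<Sum>i<n. \<bar>W j (x i) \<omega> - W j s \<omega>\<bar> ^ p) / n)"
          using st by (intro mult_left_mono mean_power_le n) auto
        also have "\<dots> = (\<Sum>i<n. ((t - s) ^ p / n) * \<bar>W j (x i) \<omega> - W j s \<omega>\<bar> ^ p)"
          by (simp add: sum_distrib_left sum_divide_distrib)
        finally have "ennreal (\<bar>riemann (W j) s t n \<omega>\<bar> ^ p) \<le> ennreal (\<Sum>i<n. ((t - s) ^ p / n) * \<bar>W j (x i) \<omega> - W j s \<omega>\<bar> ^ p)"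
          by (rule ennreal_leI)
        also have "\<dots> = (\<Sum>i<n. ennreal ((t - s) ^ p / n) * ennreal (\<bar>W j (x i) \<omega> - W j s \<omega>\<bar> ^ p))"
        proof -
          have "0 \<le> (t - s) ^ p / n" using st by simp
          then show ?thesis by (simp add: sum_ennreal[symmetric] ennreal_mult' del: times_divide_eq_left)
        qed
        finally show "ennreal (\<bar>riemann (W j) s t n \<omega>\<bar> ^ p) \<le> \<dots>" .
      qed
      also have "\<dots> = (\<Sum>i<n. ennreal ((t - s) ^ p / n) * (\<integral>\<^sup>+\<omega>. ennreal (\<bar>W j (x i) \<omega> - W j s \<omega>\<bar> ^ p) \<partial>M))"
        using Wm by (subst nn_integral_sum) (auto intro!: sum.cong nn_integral_cmult)
      also have "\<dots> \<le> (\<Sum>i<n. ennreal ((t - s) ^ p / n) * ennreal (C * sqrt (t - s) ^ p))"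
      proof (intro sum_mono mult_left_mono)
        fix i assume "i \<in> {..<n}"
        then have i: "s \<le> x i" "x i \<le> t" using x by auto
        have "(\<integral>\<^sup>+\<omega>. ennreal (\<bar>W j (x i) \<omega> - W j s \<omega>\<bar> ^ p) \<partial>M) \<le> ennreal (C * sqrt (x i - s) ^ p)"
          by (rule C(2)[OF j st(1) i(1)])
        also have "\<dots> \<le> ennreal (C * sqrt (t - s) ^ p)"
          using i C(1) by (intro ennreal_leI mult_left_mono power_mono) auto
        finally show "(\<integral>\<^sup>+\<omega>. ennreal (\<bar>W j (x i) \<omega> - W j s \<omega>\<bar> ^ p) \<partial>M) \<le> ennreal (C * sqrt (t - s) ^ p)" .
      qed simp
      also have "\<dots> = ennreal (C * (sqrt (t - s) ^ 3) ^ p)"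
      proof -
        have "(sqrt (t - s) ^ 3) ^ p = (t - s) ^ p * sqrt (t - s) ^ p"
          using st by (simp add: power3_eq_cube power_mult_distrib)
        moreover have "real n * ((t - s) ^ p / real n * (C * sqrt (t - s) ^ p)) = C * ((t - s) ^ p * sqrt (t - s) ^ p)"
          using n by simp
        ultimately show ?thesis
          using st C(1) by (simp add: ennreal_of_nat_eq_real_of_nat ennreal_mult'[symmetric] ennreal_mult''[symmetric])
      qed
      finally show ?thesis .
    qed
    have "AE \<omega> in M. ennreal (\<bar>time_integral (W j) s t \<omega>\<bar> ^ p) = liminf (\<lambda>n. ennreal (\<bar>riemann (W j) s t n \<omega>\<bar> ^ p))"
      using riemann_AE[OF j st]
    proof (rule AE_mp, intro AE_I2 impI)
      fix \<omega> assume "(\<lambda>n. riemann (W j) s t n \<omega>) \<longlonglongrightarrow> time_integral (W j) s t \<omega>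
        \<and> time_integral (W j) s t \<omega> = (LBINT v:{s..t}. (W j v \<omega> - W j s \<omega>))"
      then have "(\<lambda>n. ennreal (\<bar>riemann (W j) s t n \<omega>\<bar> ^ p)) \<longlonglongrightarrow> ennreal (\<bar>time_integral (W j) s t \<omega>\<bar> ^ p)"
        by (intro tendsto_ennrealI tendsto_intros) (rule conjunct1)
      then show "ennreal (\<bar>time_integral (W j) s t \<omega>\<bar> ^ p) = liminf (\<lambda>n. ennreal (\<bar>riemann (W j) s t n \<omega>\<bar> ^ p))"
        using lim_imp_Liminf by (metis sequentially_bot)
    qed
    then have "(\<integral>\<^sup>+\<omega>. ennreal (\<bar>time_integral (W j) s t \<omega>\<bar> ^ p) \<partial>M) = (\<integral>\<^sup>+\<omega>. liminf (\<lambda>n. ennreal (\<bar>riemann (W j) s t n \<omega>\<bar> ^ p)) \<partial>M)"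
      by (rule nn_integral_cong_AE)
    also have "\<dots> \<le> liminf (\<lambda>n. \<integral>\<^sup>+\<omega>. ennreal (\<bar>riemann (W j) s t n \<omega>\<bar> ^ p) \<partial>M)"
      by (rule nn_integral_liminf) measurable
    also have "\<dots> \<le> liminf (\<lambda>n. ennreal (C * (sqrt (t - s) ^ 3) ^ p))"
      by (intro Liminf_mono) (auto intro: bound eventually_mono[OF eventually_gt_at_top[of 0]])
    finally show "(\<integral>\<^sup>+\<omega>. ennreal (\<bar>time_integral (W j) s t \<omega>\<bar> ^ p) \<partial>M) \<le> ennreal (C * (sqrt (t - s) ^ 3) ^ p)"
      by (simp add: Liminf_const)
  qed
qed

lemma time_integral_integrable:
  assumes j: "j \<in> J" and st: "0 \<le> s" "s < t"
  shows "integrable M (\<lambda>\<omega>. time_integral (W j) s t \<omega> ^ p)"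
proof (rule integrableI_bounded)
  note [measurable] = W_riemann_measurable[OF j st]
  show "(\<lambda>\<omega>. time_integral (W j) s t \<omega> ^ p) \<in> borel_measurable M" by measurable
  obtain C where "(\<integral>\<^sup>+\<omega>. ennreal (\<bar>time_integral (W j) s t \<omega>\<bar> ^ p) \<partial>M) \<le> ennreal (C * (sqrt (t - s) ^ 3) ^ p)"
    using time_integral_moments assms by metis
  then show "(\<integral>\<^sup>+ \<omega>. ennreal (norm (time_integral (W j) s t \<omega> ^ p)) \<partial>M) < \<infinity>"
    by (simp add: power_abs order.strict_trans1)
qed

text \<open>
  Riemann sums are centered and converge in mean square.
\<close>

lemma time_integral_expectation:
  assumes j: "j \<in> J" and st: "0 \<le> s" "s < t"
  shows "expectation (time_integral (W j) s t) = 0"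
proof -
  note [measurable] = W_riemann_measurable[OF j st]
  have ti: "integrable M (time_integral (W j) s t)" using time_integral_integrable[OF assms, of 1] by simp
  have le: "(expectation (time_integral (W j) s t))\<^sup>2 \<le> (t - s)^3 / real n" if n: "n > 0" for n
  proof -
    have ri: "integrable M (\<lambda>\<omega>. W j (s + (real i + 1) * ((t - s) / real n)) \<omega> - W j s \<omega>)"
      "expectation (\<lambda>\<omega>. W j (s + (real i + 1) * ((t - s) / real n)) \<omega> - W j s \<omega>) = 0" if "i < n" for i
      using increment_integrable[OF j st(1) grid_point(1)[OF that st(2)], of 1]
        increment_expectation(1)[OF j st(1) grid_point(1)[OF that st(2)]] by auto
    have r: "integrable M (riemann (W j) s t n)" "expectation (riemann (W j) s t n) = 0"
    proof -
      show "integrable M (riemann (W j) s t n)" unfolding riemann_def[abs_def]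
        by (intro integrable_mult_right Bochner_Integration.integrable_sum ri) simp
      have "expectation (riemann (W j) s t n) = (t - s) / n * expectation (\<lambda>\<omega>. \<Sum>i<n. W j (s + (real i + 1) * ((t - s) / real n)) \<omega> - W j s \<omega>)"
        unfolding riemann_def[abs_def] by simp
      also have "expectation (\<lambda>\<omega>. \<Sum>i<n. W j (s + (real i + 1) * ((t - s) / real n)) \<omega> - W j s \<omega>) = 0"
        by (subst Bochner_Integration.integral_sum, rule ri(1), simp) (rule sum.neutral, use ri(2) in blast)
      finally show "expectation (riemann (W j) s t n) = 0" by simp
    qed
    define D where "D \<omega> = time_integral (W j) s t \<omega> - riemann (W j) s t n \<omega>" for \<omega>
    have D: "integrable M D" unfolding D_def using ti r(1) by simp
    have [measurable]: "D \<in> borel_measurable M" using D by simp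
    have D2b: "(\<integral>\<^sup>+\<omega>. ennreal ((D \<omega>)\<^sup>2) \<partial>M) \<le> ennreal ((t - s)^3 / n)"
      using time_integral_approx[OF assms n] unfolding D_def .
    have D2: "integrable M (\<lambda>\<omega>. (D \<omega>)\<^sup>2)"
      by (rule integrableI_bounded) (use D2b in \<open>auto simp: order.strict_trans1\<close>)
    have "ennreal (expectation (\<lambda>\<omega>. (D \<omega>)\<^sup>2)) \<le> ennreal ((t - s)^3 / n)"
      using D2b nn_integral_eq_integral[OF D2] by simp
    then have "expectation (\<lambda>\<omega>. (D \<omega>)\<^sup>2) \<le> (t - s)^3 / n" using st by (subst (asm) ennreal_le_iff) auto
    moreover have "(expectation D)\<^sup>2 \<le> expectation (\<lambda>\<omega>. (D \<omega>)\<^sup>2)"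
      using variance_positive[of D] variance_eq[OF D D2] by simp
    moreover have "expectation D = expectation (time_integral (W j) s t)"
      unfolding D_def using ti r by simp
    ultimately show ?thesis by simp
  qed
  have "(\<lambda>n. (t - s)^3 / real n) \<longlonglongrightarrow> 0" by (rule lim_const_over_n)
  then have "(expectation (time_integral (W j) s t))\<^sup>2 \<le> 0"
    using le by (intro LIMSEQ_le_const) (auto intro!: exI[of _ 1])
  then show ?thesis by simp
qed

text \<open>
  Approximates the elapsed time \<open>v - s\<close> from below by its value at the left end point of each of the \<open>n\<close> pieces of length \<open>e\<close>, which makes it an
  admissible integrand.
\<close>

definition staircase :: "real \<Rightarrow> real \<Rightarrow> nat \<Rightarrow> 'w simple_process"
  where "staircase s e n = map (\<lambda>i. (s + real i * e, s + (real i + 1) * e, \<lambda>_. real i * e)) [0..<n]"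

lemma staircase_Suc:
  "staircase s e (Suc n) = staircase s e n @ [(s + real n * e, s + (real n + 1) * e, \<lambda>_. real n * e)]"
  by (simp add: staircase_def)

lemma staircase_value:
  assumes e: "e > 0"
  shows "(s < v \<longrightarrow> v \<le> s + real n * e \<longrightarrow> \<bar>simple_value (staircase s e n) v \<omega> - (v - s)\<bar> \<le> e)
    \<and> (v \<le> s \<or> s + real n * e < v \<longrightarrow> simple_value (staircase s e n) v \<omega> = 0)"
proof (induction n)
  case 0
  then show ?case by (simp add: staircase_def simple_value_def)
next
  case (Suc n)
  have eq: "simple_value (staircase s e (Suc n)) v \<omega> = simple_value (staircase s e n) v \<omega>
      + real n * e * indicator {s + real n * e<..s + (real n + 1) * e} v"
    by (simp add: staircase_Suc simple_value_def)
  have nn: "0 \<le> real n * e" "s + real n * e \<le> s + (real n + 1) * e" using e by (auto simp: algebra_simps)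
  consider "v \<le> s" | "s < v" "v \<le> s + real n * e" | "s + real n * e < v" "v \<le> s + (real n + 1) * e" | "s + (real n + 1) * e < v"
    by linarith
  then show ?case
  proof cases
    case 1
    then show ?thesis unfolding eq using Suc nn by simp
  next
    case 2
    then show ?thesis unfolding eq using Suc nn by (simp add: algebra_simps)
  next
    case 3
    have sv: "s < v" using 3 nn by linarith
    have z: "simple_value (staircase s e n) v \<omega> = 0" using Suc 3 by simp
    show ?thesis unfolding eq z using 3 sv nn e by (simp add: algebra_simps abs_if)
  next
    case 4
    then show ?thesis unfolding eq using Suc nn e by (simp add: algebra_simps)
  qed
qed

text \<open>
  Summation by parts.
\<close>

lemma staircase_integral:
  "simple_integral V (staircase s e n) \<omega> = real n * e * (V (s + real n * e) \<omega> - V s \<omega>)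
     - e * (\<Sum>i<n. V (s + (real i + 1) * e) \<omega> - V s \<omega>)"
proof (induction n)
  case (Suc n)
  have "simple_integral V (staircase s e (Suc n)) \<omega> = simple_integral V (staircase s e n) \<omega>
     + real n * e * (V (s + (real n + 1) * e) \<omega> - V (s + real n * e) \<omega>)"
    by (simp add: staircase_Suc simple_integral_def)
  then show ?case unfolding Suc by (simp add: algebra_simps)
qed (simp add: staircase_def simple_integral_def)

lemma LBINT_one: "(LBINT u:{s..v}. 1) = (if s \<le> v then v - s else (0::real))"
  by (simp add: set_lebesgue_integral_def)

text \<open>
  By summation by parts the integral of the staircase differs from the claimed value by the error of a Riemann sum.
\<close>

lemma elapsed_time_is_ito_integral:
  assumes j: "j \<in> J" and st: "0 \<le> s" "s < t"
  shows "is_ito_integral M F (W j) (\<lambda>v _. LBINT u:{s..v}. 1) s t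
    (\<lambda>\<omega>. (t - s) * (W j t \<omega> - W j s \<omega>) - time_integral (W j) s t \<omega>)"
  unfolding is_ito_integral_def
proof (intro conjI exI allI)
  note [measurable] = W_riemann_measurable[OF j st]
  show "(\<lambda>\<omega>. (t - s) * (W j t \<omega> - W j s \<omega>) - time_integral (W j) s t \<omega>) \<in> borel_measurable M"
    using st by (intro borel_measurable_diff borel_measurable_times borel_measurable_const W_measurable j) auto
  define e where "e n = (t - s) / real (Suc n)" for n
  let ?val = "\<lambda>n \<omega>. \<integral>\<^sup>+v\<in>{s..t}. ennreal ((simple_value (staircase s (e n) (Suc n)) v \<omega> - (LBINT u:{s..v}. 1))\<^sup>2) \<partial>lborel"
  let ?err = "\<lambda>n \<omega>. simple_integral (W j) (staircase s (e n) (Suc n)) \<omega> - ((t - s) * (W j t \<omega> - W j s \<omega>) - time_integral (W j) s t \<omega>)"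
  have e: "e n > 0" "real (Suc n) * e n = t - s" for n using st by (auto simp: e_def)
  show "simple_integrand M F s t (staircase s (e n) (Suc n))" for n
    unfolding simple_integrand_def staircase_def
  proof (safe, unfold set_map set_upt)
    fix a b :: real and X :: "'w \<Rightarrow> real" assume "(a, b, X) \<in> (\<lambda>i. (s + real i * e n, s + (real i + 1) * e n, \<lambda>_. real i * e n)) ` {0..<Suc n}"
    then obtain i where i: "i < Suc n" "a = s + real i * e n" "b = s + (real i + 1) * e n" "X = (\<lambda>_. real i * e n)" by auto
    have "(real i + 1) * e n \<le> real (Suc n) * e n" using i(1) e(1)[of n] by (intro mult_right_mono) auto
    then show "b \<le> t" unfolding i e(2) by simp
    show "s \<le> a" "a \<le> b" unfolding i using e(1)[of n] by (auto simp: algebra_simps)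
    show "X \<in> borel_measurable (F a)" unfolding i by simp
    show "\<exists>K. \<forall>\<omega>\<in>space M. \<bar>X \<omega>\<bar> \<le> K" unfolding i by auto
  qed
  show "(\<lambda>n. \<integral>\<^sup>+\<omega>. ?val n \<omega> \<partial>M) \<longlonglongrightarrow> 0"
  proof (rule tendsto_sandwich[OF _ _ tendsto_const])
    have "(\<lambda>n. ennreal ((e n)\<^sup>2 * (t - s))) \<longlonglongrightarrow> ennreal (0\<^sup>2 * (t - s))"
    proof (intro tendsto_ennrealI tendsto_intros)
      show "e \<longlonglongrightarrow> 0" unfolding e_def by (rule LIMSEQ_Suc[OF lim_const_over_n])
    qed
    then show "(\<lambda>n. ennreal ((e n)\<^sup>2 * (t - s))) \<longlonglongrightarrow> 0" by simp
    show "\<forall>\<^sub>F n in sequentially. (\<integral>\<^sup>+\<omega>. ?val n \<omega> \<partial>M)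
       \<le> ennreal ((e n)\<^sup>2 * (t - s))"
    proof (intro always_eventually allI)
      fix n
      have "?val n \<omega>
         \<le> (\<integral>\<^sup>+v. ennreal ((e n)\<^sup>2) * indicator {s..t} v \<partial>lborel)" for \<omega>
      proof (rule nn_integral_mono)
        fix v
        have "(simple_value (staircase s (e n) (Suc n)) v \<omega> - (v - s))\<^sup>2 \<le> (e n)\<^sup>2" if "s \<le> v" "v \<le> t"
        proof -
          have "\<bar>simple_value (staircase s (e n) (Suc n)) v \<omega> - (v - s)\<bar> \<le> e n"
            using staircase_value[OF e(1)[of n], of s v "Suc n" \<omega>] that e(1)[of n] unfolding e(2)
            by (cases "v = s") auto
          then show ?thesis using e(1)[of n] by (intro abs_le_square_iff[THEN iffD1]) simp
        qed
        then show "ennreal ((simple_value (staircase s (e n) (Suc n)) v \<omega> - (LBINT u:{s..v}. 1))\<^sup>2) * indicator {s..t} v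
          \<le> ennreal ((e n)\<^sup>2) * indicator {s..t} v"
          unfolding LBINT_one by (auto simp: indicator_def intro: ennreal_leI)
      qed
      also have "(\<integral>\<^sup>+v. ennreal ((e n)\<^sup>2) * indicator {s..t} v \<partial>lborel) = ennreal ((e n)\<^sup>2 * (t - s))"
        using st by (subst nn_integral_cmult_indicator) (auto simp: ennreal_mult')
      finally have "?val n \<omega>
         \<le> ennreal ((e n)\<^sup>2 * (t - s))" for \<omega> .
      then have "(\<integral>\<^sup>+\<omega>. ?val n \<omega> \<partial>M)
         \<le> (\<integral>\<^sup>+\<omega>. ennreal ((e n)\<^sup>2 * (t - s)) \<partial>M)" by (intro nn_integral_mono)
      then show "(\<integral>\<^sup>+\<omega>. ?val n \<omega> \<partial>M)
         \<le> ennreal ((e n)\<^sup>2 * (t - s))" by (simp add: emeasure_space_1)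
    qed
  qed simp
  show "(\<lambda>n. \<integral>\<^sup>+\<omega>. ennreal ((?err n \<omega>)\<^sup>2) \<partial>M) \<longlonglongrightarrow> 0"
  proof (rule tendsto_sandwich[OF _ _ tendsto_const])
    have "(\<lambda>n. ennreal ((t - s)^3 / real (Suc n))) \<longlonglongrightarrow> ennreal 0"
      by (intro tendsto_ennrealI LIMSEQ_Suc[OF lim_const_over_n])
    then show "(\<lambda>n. ennreal ((t - s)^3 / real (Suc n))) \<longlonglongrightarrow> 0" by simp
    show "\<forall>\<^sub>F n in sequentially. (\<integral>\<^sup>+\<omega>. ennreal ((?err n \<omega>)\<^sup>2) \<partial>M) \<le> ennreal ((t - s)^3 / real (Suc n))"
    proof (intro always_eventually allI)
      fix n
      have eq: "?err n \<omega>
        = time_integral (W j) s t \<omega> - riemann (W j) s t (Suc n) \<omega>" for \<omega>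
        unfolding staircase_integral e(2) riemann_def e_def[symmetric] by simp
      show "(\<integral>\<^sup>+\<omega>. ennreal ((?err n \<omega>)\<^sup>2) \<partial>M) \<le> ennreal ((t - s)^3 / real (Suc n))"
        unfolding eq by (rule time_integral_approx[OF j st]) simp
    qed
  qed simp
qed

lemma ito_integral_elapsed_time:
  assumes j: "j \<in> J" and st: "0 \<le> s" "s < t"
  shows "AE \<omega> in M. ito_integral M F (W j) (\<lambda>v _. LBINT u:{s..v}. 1) s t \<omega>
    = (t - s) * (W j t \<omega> - W j s \<omega>) - time_integral (W j) s t \<omega>"
proof (rule is_ito_integral_unique[OF j st(1)])
  show "is_ito_integral M F (W j) (\<lambda>v _. LBINT u:{s..v}. 1) s t (ito_integral M F (W j) (\<lambda>v _. LBINT u:{s..v}. 1) s t)"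
    unfolding ito_integral_def 
    by (rule someI[where P="is_ito_integral M F (W j) (\<lambda>v _. LBINT u:{s..v}. 1) s t", OF elapsed_time_is_ito_integral[OF assms]])
  show "(\<lambda>(\<omega>, v). LBINT u:{s..v}. (1::real)) \<in> borel_measurable (M \<Otimes>\<^sub>M lborel)"
    unfolding LBINT_one by measurable
qed (rule elapsed_time_is_ito_integral[OF assms])

end

section \<open>The driving noise of one step\<close>

text \<open>
  The iterated integrals with the Ito integral and the Lebesgue integral replaced by almost surely equal versions
  that depend measurably on the increments in \<open>[s, t]\<close>.
\<close>

definition pathwise_eta ::
  "nat \<Rightarrow> (nat \<Rightarrow> real \<Rightarrow> 'w \<Rightarrow> real) \<Rightarrow> nat \<Rightarrow> nat \<Rightarrow> real \<Rightarrow> real \<Rightarrow> 'w \<Rightarrow> real"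
  where "pathwise_eta N B j1 j2 t s \<omega> =
    (if 1 \<le> N \<and> j1 = 0 \<and> 1 \<le> j2 then (t - s) * (B j2 t \<omega> - B j2 s \<omega>) - time_integral (B j2) s t \<omega>
     else if 1 \<le> N \<and> 1 \<le> j1 \<and> j2 = 0 then time_integral (B j1) s t \<omega>
     else (1/2) * (incr B j1 t s \<omega> * incr B j2 t s \<omega> - (if j1 = j2 \<and> j1 \<noteq> 0 then t - s else 0)))"

lemma sigma_algebra_generated_events: "sigma_algebra (space M) (generated_events M I X)"
  unfolding generated_events_def by (rule sigma_algebra_sigma_sets) auto

lemma generated_events_Int:
  "A \<in> generated_events M I X \<Longrightarrow> C \<in> generated_events M I X \<Longrightarrow> A \<inter> C \<in> generated_events M I X"
proof -
  interpret sigma_algebra "space M" "generated_events M I X" by (rule sigma_algebra_generated_events)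
  show "A \<in> generated_events M I X \<Longrightarrow> C \<in> generated_events M I X \<Longrightarrow> A \<inter> C \<in> generated_events M I X" by blast
qed

locale driving_noise = prob_space M for M :: "'w measure" +
  fixes F :: "real \<Rightarrow> 'w measure" and B Bt :: "nat \<Rightarrow> real \<Rightarrow> 'w \<Rightarrow> real" and d :: nat
  assumes filtration: "filtered M F"
    and bmB: "brownian_motion M F {1..d} B" and bmBt: "brownian_motion M F {2..d} Bt"
    and indB: "indep_set (generated_events M ({1..d} \<times> {0..}) (\<lambda>(j, t). B j t))
           (generated_events M ({2..d} \<times> {0..}) (\<lambda>(j, t). Bt j t))"
begin

sublocale B: brownian M F "{1..d}" B
  by unfold_locales (rule filtration bmB)+

sublocale Bt: brownian M F "{2..d}" Bt
  by unfold_locales (rule filtration bmBt)+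

definition increment_events :: "(nat \<Rightarrow> real \<Rightarrow> 'w \<Rightarrow> real) \<Rightarrow> nat set \<Rightarrow> real \<Rightarrow> real \<Rightarrow> 'w set set"
  where "increment_events W J a b = generated_events M (J \<times> {a..b} \<times> {a..b}) (\<lambda>(j, u, v) \<omega>. W j u \<omega> - W j v \<omega>)"

text \<open>
  Intersections of an event of either motion: a generator that is stable under intersection, on which independence can be checked.
\<close>

definition window_events :: "real \<Rightarrow> real \<Rightarrow> 'w set set"
  where "window_events a b = {A \<inter> A' | A A'. A \<in> increment_events B {1..d} a b \<and> A' \<in> increment_events Bt {2..d} a b}"

definition window :: "real \<Rightarrow> real \<Rightarrow> 'w measure"
  where "window a b = sigma (space M) (window_events a b)"

lemma increment_events_space: "A \<in> increment_events W J a b \<Longrightarrow> A \<subseteq> space M" "space M \<in> increment_events W J a b"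
proof -
  interpret sigma_algebra "space M" "increment_events W J a b"
    unfolding increment_events_def by (rule sigma_algebra_generated_events)
  show "A \<in> increment_events W J a b \<Longrightarrow> A \<subseteq> space M" "space M \<in> increment_events W J a b"
    using space_closed by auto
qed

lemma window_events_space: "window_events a b \<subseteq> Pow (space M)"
  unfolding window_events_def using increment_events_space by blast

lemma sets_window: "sets (window a b) = sigma_sets (space M) (window_events a b)"
  unfolding window_def using window_events_space by (rule sets_measure_of)

lemma space_window [simp]: "space (window a b) = space M"
  by (simp add: window_def space_measure_of_conv)

lemma increment_events_past:
  assumes "brownian M F J W" "0 \<le> a" "a \<le> b"
  shows "increment_events W J a b \<subseteq> sets (F b)"
proof -
  interpret W: brownian M F J W by fact
  have "space (F b) = space M" using W.subalgebra_F[of b] assms by (simp add: subalgebra_def)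
  then show ?thesis unfolding increment_events_def
    using assms by (intro generated_events_subset) (auto intro!: borel_measurable_diff W.W_measurable_F)
qed

lemma increment_events_future:
  assumes "brownian M F J W"
  shows "increment_events W J b c \<subseteq> sets (brownian.future M J W b)"
proof -
  interpret W: brownian M F J W by fact
  show ?thesis unfolding increment_events_def
    by (intro generated_events_subset) (auto simp: W.future_def space_measure_of_conv intro!: W.increment_future[unfolded W.future_def])
qed

lemma increment_events_all:
  assumes "0 \<le> a"
  shows "increment_events W J a b \<subseteq> generated_events M (J \<times> {0..}) (\<lambda>(j, t). W j t)"
proof -
  have "W j u \<in> borel_measurable (sigma (space M) (generated_events M (J \<times> {0..}) (\<lambda>(j, t). W j t)))" if "j \<in> J" "0 \<le> u" for j u
    using generated_events_measurable[of "(j, u)" "J \<times> {0..}" "\<lambda>(j, t). W j t" M] that by simp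
  then have "increment_events W J a b \<subseteq> sets (sigma (space M) (generated_events M (J \<times> {0..}) (\<lambda>(j, t). W j t)))"
    unfolding increment_events_def using assms
    by (intro generated_events_subset) (auto simp: space_measure_of_conv intro!: borel_measurable_diff)
  then show ?thesis unfolding generated_events_sigma .
qed

lemma increment_events_indep:
  assumes W: "brownian M F J W" and ab: "0 \<le> a" "a \<le> b"
    and A: "A \<in> increment_events W J a b" and C: "C \<in> increment_events W J b c"
  shows "prob (A \<inter> C) = prob A * prob C"
proof -
  interpret W: brownian M F J W by fact
  have "0 \<le> b" using ab by simp
  from indep_setD[OF W.indep_future[OF this]] show ?thesis
    using increment_events_past[OF W ab] increment_events_future[OF W] A C by blast
qed

lemma subalgebra_window:
  assumes "0 \<le> a" "a \<le> b" shows "subalgebra M (window a b)"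
proof -
  have "increment_events B {1..d} a b \<subseteq> sets M" "increment_events Bt {2..d} a b \<subseteq> sets M"
    using increment_events_past[OF B.brownian_axioms assms] increment_events_past[OF Bt.brownian_axioms assms]
      B.subalgebra_F[of b] assms by (auto simp: subalgebra_def)
  then have "window_events a b \<subseteq> sets M" unfolding window_events_def by blast
  then have "sets (window a b) \<subseteq> sets M" unfolding sets_window by (rule sets.sigma_sets_subset)
  then show ?thesis by (simp add: subalgebra_def)
qed

lemma window_increment_measurable:
  assumes "a \<le> u" "u \<le> b" "a \<le> v" "v \<le> b"
  shows "j \<in> {1..d} \<Longrightarrow> (\<lambda>\<omega>. B j u \<omega> - B j v \<omega>) \<in> borel_measurable (window a b)"
    and "j \<in> {2..d} \<Longrightarrow> (\<lambda>\<omega>. Bt j u \<omega> - Bt j v \<omega>) \<in> borel_measurable (window a b)"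
proof -
  have *: "increment_events B {1..d} a b \<subseteq> window_events a b" "increment_events Bt {2..d} a b \<subseteq> window_events a b"
  proof -
    have "A \<in> window_events a b" if "A \<in> increment_events B {1..d} a b" for A
      unfolding window_events_def mem_Collect_eq
      using that increment_events_space(1)[OF that] increment_events_space(2)[of Bt "{2..d}" a b]
      by (intro exI[of _ A] exI[of _ "space M"]) auto
    moreover have "A \<in> window_events a b" if "A \<in> increment_events Bt {2..d} a b" for A
      unfolding window_events_def mem_Collect_eq
      using that increment_events_space(1)[OF that] increment_events_space(2)[of B "{1..d}" a b]
      by (intro exI[of _ "space M"] exI[of _ A]) auto
    ultimately show "increment_events B {1..d} a b \<subseteq> window_events a b" "increment_events Bt {2..d} a b \<subseteq> window_events a b"
      by blast+
  qed
  have **: "f \<in> borel_measurable (window a b)"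
    if f: "f \<in> borel_measurable (sigma (space M) (increment_events W J a b))"
      and sub: "increment_events W J a b \<subseteq> window_events a b" for f :: "'w \<Rightarrow> real" and W J
  proof (rule measurable_from_subalg[OF _ f])
    show "subalgebra (window a b) (sigma (space M) (increment_events W J a b))"
      unfolding subalgebra_def sets_window using sub
      unfolding increment_events_def generated_events_sigma by (auto simp: space_measure_of_conv)
  qed
  show "(\<lambda>\<omega>. B j u \<omega> - B j v \<omega>) \<in> borel_measurable (window a b)" if "j \<in> {1..d}"
    using generated_events_measurable[of "(j, u, v)" "{1..d} \<times> {a..b} \<times> {a..b}" "\<lambda>(j, u, v) \<omega>. B j u \<omega> - B j v \<omega>" M] that assms
    by (intro **[OF _ *(1)]) (simp add: increment_events_def)
  show "(\<lambda>\<omega>. Bt j u \<omega> - Bt j v \<omega>) \<in> borel_measurable (window a b)" if "j \<in> {2..d}"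
    using generated_events_measurable[of "(j, u, v)" "{2..d} \<times> {a..b} \<times> {a..b}" "\<lambda>(j, u, v) \<omega>. Bt j u \<omega> - Bt j v \<omega>" M] that assms
    by (intro **[OF _ *(2)]) (simp add: increment_events_def)
qed

lemma increment_events_mono:
  assumes "a \<le> a'" "b' \<le> b"
  shows "increment_events W J a' b' \<subseteq> increment_events W J a b"
  unfolding increment_events_def generated_events_def
proof (rule sigma_sets_mono')
  have "J \<times> {a'..b'} \<times> {a'..b'} \<subseteq> J \<times> {a..b} \<times> {a..b}" using assms by auto
  then show "{(case i of (j, u, v) \<Rightarrow> \<lambda>\<omega>. W j u \<omega> - W j v \<omega>) -` A \<inter> space M |i A. i \<in> J \<times> {a'..b'} \<times> {a'..b'} \<and> A \<in> sets borel}
    \<subseteq> {(case i of (j, u, v) \<Rightarrow> \<lambda>\<omega>. W j u \<omega> - W j v \<omega>) -` A \<inter> space M |i A. i \<in> J \<times> {a..b} \<times> {a..b} \<and> A \<in> sets borel}"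
    by blast
qed

lemma window_mono:
  assumes "a \<le> a'" "b' \<le> b"
  shows "subalgebra (window a b) (window a' b')"
proof -
  have "window_events a' b' \<subseteq> window_events a b"
    unfolding window_events_def using increment_events_mono[OF assms] by blast
  then have "sets (window a' b') \<subseteq> sets (window a b)"
    unfolding sets_window by (rule sigma_sets_mono')
  then show ?thesis by (simp add: subalgebra_def)
qed

text \<open>
  For each motion past and present are independent, and the two motions are independent of each other. So the
  probability of an intersection of four events, past and present of both motions, is the product of the four
  probabilities.
\<close>

lemma indep_window:
  assumes ab: "0 \<le> a" "a \<le> b" "b \<le> c"
  shows "indep_set (sets (window a b)) (sets (window b c))"
  unfolding sets_window
proof (rule indep_set_sigma_sets)
  have stable: "Int_stable (window_events a b)" for a b
  proof (rule Int_stableI)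
    fix E E' assume "E \<in> window_events a b" "E' \<in> window_events a b"
    then obtain A A' C C' where "E = A \<inter> A'" "E' = C \<inter> C'"
      and m: "A \<in> increment_events B {1..d} a b" "A' \<in> increment_events Bt {2..d} a b"
        "C \<in> increment_events B {1..d} a b" "C' \<in> increment_events Bt {2..d} a b"
      unfolding window_events_def by blast
    then have "E \<inter> E' = (A \<inter> C) \<inter> (A' \<inter> C')" by blast
    moreover have "A \<inter> C \<in> increment_events B {1..d} a b" "A' \<inter> C' \<in> increment_events Bt {2..d} a b"
      using m unfolding increment_events_def by (blast intro: generated_events_Int)+
    ultimately show "E \<inter> E' \<in> window_events a b" unfolding window_events_def by blast
  qed
  then show "Int_stable (window_events a b)" "Int_stable (window_events b c)" by auto
  show "indep_set (window_events a b) (window_events b c)"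
  proof (rule indep_setI)
    have b: "0 \<le> b" using ab by simp
    show "window_events a b \<subseteq> events" "window_events b c \<subseteq> events"
      using subalgebra_window[OF ab(1,2)] subalgebra_window[OF b ab(3)]
      unfolding subalgebra_def sets_window by (auto intro: sigma_sets.Basic)
    fix E E' assume "E \<in> window_events a b" "E' \<in> window_events b c"
    then obtain A A' C C' where E: "E = A \<inter> A'" "E' = C \<inter> C'"
      and m: "A \<in> increment_events B {1..d} a b" "A' \<in> increment_events Bt {2..d} a b"
        "C \<in> increment_events B {1..d} b c" "C' \<in> increment_events Bt {2..d} b c"
      unfolding window_events_def by blast
    have all: "A \<in> generated_events M ({1..d} \<times> {0..}) (\<lambda>(j, t). B j t)" "C \<in> generated_events M ({1..d} \<times> {0..}) (\<lambda>(j, t). B j t)"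
      "A' \<in> generated_events M ({2..d} \<times> {0..}) (\<lambda>(j, t). Bt j t)" "C' \<in> generated_events M ({2..d} \<times> {0..}) (\<lambda>(j, t). Bt j t)"
      using m increment_events_all[OF ab(1)] increment_events_all[OF b] by blast+
    have "prob (E \<inter> E') = prob ((A \<inter> C) \<inter> (A' \<inter> C'))" unfolding E by (simp add: Int_ac)
    also have "\<dots> = prob (A \<inter> C) * prob (A' \<inter> C')"
      by (rule indep_setD[OF indB generated_events_Int[OF all(1,2)] generated_events_Int[OF all(3,4)]])
    also have "\<dots> = (prob A * prob C) * (prob A' * prob C')"
      using increment_events_indep[OF B.brownian_axioms ab(1,2) m(1,3)]
        increment_events_indep[OF Bt.brownian_axioms ab(1,2) m(2,4)] by simp
    also have "\<dots> = prob E * prob E'"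
      unfolding E using indep_setD[OF indB all(1,3)] indep_setD[OF indB all(2,4)] by simp
    finally show "prob (E \<inter> E') = prob E * prob E'" .
  qed
qed

lemma area_expectation:
  assumes "j1 \<in> {1..d}" "j2 \<in> {2..d}" "0 \<le> s" "s \<le> t"
  shows "expectation (\<lambda>\<omega>. (B j1 t \<omega> - B j1 s \<omega>) * (Bt j2 t \<omega> - Bt j2 s \<omega>)) = 0"
proof -
  let ?G = "sigma (space M) (generated_events M ({1..d} \<times> {0..}) (\<lambda>(j, t). B j t))"
  let ?H = "sigma (space M) (generated_events M ({2..d} \<times> {0..}) (\<lambda>(j, t). Bt j t))"
  have 1: "B j1 v \<in> borel_measurable ?G" "Bt j2 v \<in> borel_measurable ?H" if "0 \<le> v" for v
    using generated_events_measurable[of "(j1, v)" "{1..d} \<times> {0..}" "\<lambda>(j, t). B j t" M]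
      generated_events_measurable[of "(j2, v)" "{2..d} \<times> {0..}" "\<lambda>(j, t). Bt j t" M] that assms by auto
  have "indep_var borel (\<lambda>\<omega>. B j1 t \<omega> - B j1 s \<omega>) borel (\<lambda>\<omega>. Bt j2 t \<omega> - Bt j2 s \<omega>)"
  proof (rule indep_var_subalgebra[of ?G ?H])
    show "indep_set (sets ?G) (sets ?H)" unfolding generated_events_sigma by (rule indB)
    show "subalgebra M ?G" "subalgebra M ?H"
      using indep_setD_ev1[OF indB] indep_setD_ev2[OF indB]
      unfolding subalgebra_def generated_events_sigma by (auto simp: space_measure_of_conv)
  qed ((intro borel_measurable_diff 1; use assms in linarith)+)
  from indep_var_lebesgue_integral[OF this] show ?thesis
    using B.increment_integrable[of j1 s t 1] Bt.increment_integrable[of j2 s t 1]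
      B.increment_expectation(1)[of j1 s t] assms by simp
qed

lemma increment_product_expectation:
  assumes "j1 \<in> {1..d}" "j2 \<in> {1..d}" "j1 \<noteq> j2" "0 \<le> s" "s < t"
  shows "expectation (\<lambda>\<omega>. (B j1 t \<omega> - B j1 s \<omega>) * (B j2 t \<omega> - B j2 s \<omega>)) = 0"
proof -
  have "indep_vars (\<lambda>_. borel) (\<lambda>j \<omega>. B j t \<omega> - B j s \<omega>) {1..d}"
    using bmB assms by (auto simp: brownian_motion_def)
  then have "indep_vars (\<lambda>_. borel) (\<lambda>j \<omega>. B j t \<omega> - B j s \<omega>) {j1, j2}"
    by (rule indep_vars_subset) (use assms in auto)
  from indep_vars_lebesgue_integral[OF _ this]
  show ?thesis using B.increment_integrable[of j1 s t 1] B.increment_integrable[of j2 s t 1]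
      B.increment_expectation(1)[of j1 s t] assms by auto
qed

end

locale scheme_step = driving_noise M F B Bt d + coefficients M I r R d \<sigma>
  for M :: "'w measure" and F B Bt d and I :: "'i set" and r R and \<sigma> :: "nat \<Rightarrow> real^'n::finite \<Rightarrow> real^'n"
begin

text \<open>
  The interval of the experiment \<open>i\<close> is \<open>[\<tau>0 i, \<tau>1 i]\<close>; its length may be smaller than \<open>r i\<close> squared, so that the
  statement covers half steps as well as full steps.
\<close>

lemma noise_window:
  assumes \<tau>: "\<And>i. i \<in> I \<Longrightarrow> 0 \<le> \<tau>0 i" "\<And>i. i \<in> I \<Longrightarrow> \<tau>0 i < \<tau>1 i" "\<And>i. i \<in> I \<Longrightarrow> \<tau>1 i - \<tau>0 i \<le> (r i)\<^sup>2"
  shows "noise d (\<lambda>i. window (\<tau>0 i) (\<tau>1 i)) (\<lambda>j i \<omega>. incr B j (\<tau>1 i) (\<tau>0 i) \<omega>)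
    (\<lambda>j1 j2 i \<omega>. pathwise_eta N B j1 j2 (\<tau>1 i) (\<tau>0 i) \<omega>) (\<lambda>j1 j2 i \<omega>. area_incr B Bt j1 j2 (\<tau>1 i) (\<tau>0 i) \<omega>)"
proof -
  have sq: "sqrt (\<tau>1 i - \<tau>0 i) \<le> r i" "0 \<le> sqrt (\<tau>1 i - \<tau>0 i)" if "i \<in> I" for i
    using \<tau>[OF that] r_nonneg[OF that] real_sqrt_le_mono[of "\<tau>1 i - \<tau>0 i" "(r i)\<^sup>2"] by auto
  have sub: "subalgebra M (window (\<tau>0 i) (\<tau>1 i))" if "i \<in> I" for i
    using \<tau>[OF that] by (intro subalgebra_window) auto
  have Bm: "(\<lambda>\<omega>. B j (\<tau>1 i) \<omega> - B j (\<tau>0 i) \<omega>) \<in> borel_measurable (window (\<tau>0 i) (\<tau>1 i))" if "i \<in> I" "j \<in> {1..d}" for i j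
    using \<tau>[OF that(1)] by (intro window_increment_measurable(1) that(2)) auto
  have Btm: "(\<lambda>\<omega>. Bt j (\<tau>1 i) \<omega> - Bt j (\<tau>0 i) \<omega>) \<in> borel_measurable (window (\<tau>0 i) (\<tau>1 i))" if "i \<in> I" "j \<in> {2..d}" for i j
    using \<tau>[OF that(1)] by (intro window_increment_measurable(2) that(2)) auto
  have Tm: "time_integral (B j) (\<tau>0 i) (\<tau>1 i) \<in> borel_measurable (window (\<tau>0 i) (\<tau>1 i))" if "i \<in> I" "j \<in> {1..d}" for i j
    using \<tau>[OF that(1)] by (intro B.riemann_measurable(2) window_increment_measurable(1) that(2)) auto
  have BO: "order r (\<lambda>i \<omega>. B j (\<tau>1 i) \<omega> - B j (\<tau>0 i) \<omega>)" if j: "j \<in> {1..d}" for j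
  proof (rule order_mono[where s="\<lambda>i. sqrt (\<tau>1 i - \<tau>0 i)" and K=1, OF orderI])
    show "\<exists>C\<ge>0. \<forall>i\<in>I. (\<integral>\<^sup>+\<omega>. ennreal (norm (B j (\<tau>1 i) \<omega> - B j (\<tau>0 i) \<omega>) ^ p) \<partial>M) \<le> ennreal (C * sqrt (\<tau>1 i - \<tau>0 i) ^ p)" for p
    proof -
      obtain C where "C \<ge> 0" "\<And>j s t. j \<in> {1..d} \<Longrightarrow> 0 \<le> s \<Longrightarrow> s \<le> t \<Longrightarrow>
        (\<integral>\<^sup>+\<omega>. ennreal (\<bar>B j t \<omega> - B j s \<omega>\<bar> ^ p) \<partial>M) \<le> ennreal (C * sqrt (t - s) ^ p)"
        by (rule B.increment_moments[where p=p]) blast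
      then show ?thesis using \<tau> j by (intro exI[of _ C]) (auto simp: less_imp_le)
    qed
    show "(\<lambda>\<omega>. B j (\<tau>1 i) \<omega> - B j (\<tau>0 i) \<omega>) \<in> borel_measurable M" if "i \<in> I" for i
      by (rule measurable_from_subalg[OF sub[OF that] Bm[OF that j]])
  qed (simp_all add: sq r_nonneg less_imp_le[OF \<tau>(2)])
  have BtO: "order r (\<lambda>i \<omega>. Bt j (\<tau>1 i) \<omega> - Bt j (\<tau>0 i) \<omega>)" if j: "j \<in> {2..d}" for j
  proof (rule order_mono[where s="\<lambda>i. sqrt (\<tau>1 i - \<tau>0 i)" and K=1, OF orderI])
    show "\<exists>C\<ge>0. \<forall>i\<in>I. (\<integral>\<^sup>+\<omega>. ennreal (norm (Bt j (\<tau>1 i) \<omega> - Bt j (\<tau>0 i) \<omega>) ^ p) \<partial>M) \<le> ennreal (C * sqrt (\<tau>1 i - \<tau>0 i) ^ p)" for p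
    proof -
      obtain C where "C \<ge> 0" "\<And>j s t. j \<in> {2..d} \<Longrightarrow> 0 \<le> s \<Longrightarrow> s \<le> t \<Longrightarrow>
        (\<integral>\<^sup>+\<omega>. ennreal (\<bar>Bt j t \<omega> - Bt j s \<omega>\<bar> ^ p) \<partial>M) \<le> ennreal (C * sqrt (t - s) ^ p)"
        by (rule Bt.increment_moments[where p=p]) blast
      then show ?thesis using \<tau> j by (intro exI[of _ C]) (auto simp: less_imp_le)
    qed
    show "(\<lambda>\<omega>. Bt j (\<tau>1 i) \<omega> - Bt j (\<tau>0 i) \<omega>) \<in> borel_measurable M" if "i \<in> I" for i
      by (rule measurable_from_subalg[OF sub[OF that] Btm[OF that j]])
  qed (simp_all add: sq r_nonneg less_imp_le[OF \<tau>(2)])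
  have TO: "order (\<lambda>i. r i ^ 3) (\<lambda>i \<omega>. time_integral (B j) (\<tau>0 i) (\<tau>1 i) \<omega>)" if j: "j \<in> {1..d}" for j
  proof (rule order_mono[where s="\<lambda>i. sqrt (\<tau>1 i - \<tau>0 i) ^ 3" and K=1, OF orderI])
    show "\<exists>C\<ge>0. \<forall>i\<in>I. (\<integral>\<^sup>+\<omega>. ennreal (norm (time_integral (B j) (\<tau>0 i) (\<tau>1 i) \<omega>) ^ p) \<partial>M) \<le> ennreal (C * (sqrt (\<tau>1 i - \<tau>0 i) ^ 3) ^ p)" for p
    proof -
      obtain C where "C \<ge> 0" "\<And>j s t. j \<in> {1..d} \<Longrightarrow> 0 \<le> s \<Longrightarrow> s < t \<Longrightarrow>
        (\<integral>\<^sup>+\<omega>. ennreal (\<bar>time_integral (B j) s t \<omega>\<bar> ^ p) \<partial>M) \<le> ennreal (C * (sqrt (t - s) ^ 3) ^ p)"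
        by (rule B.time_integral_moments[where p=p]) blast
      then show ?thesis using \<tau> j by (intro exI[of _ C]) auto
    qed
    show "sqrt (\<tau>1 i - \<tau>0 i) ^ 3 \<le> 1 * r i ^ 3" if "i \<in> I" for i
      using power_mono[OF sq[OF that], of 3] by simp
    show "time_integral (B j) (\<tau>0 i) (\<tau>1 i) \<in> borel_measurable M" if "i \<in> I" for i
      by (rule measurable_from_subalg[OF sub[OF that] Tm[OF that j]])
  qed (simp_all add: sq r_nonneg less_imp_le[OF \<tau>(2)])
  have tO: "order (\<lambda>i. (r i)\<^sup>2) (\<lambda>i \<omega>. \<tau>1 i - \<tau>0 i)"
    by (rule order_const[of _ 1]) (use \<tau> in \<open>auto simp: less_imp_le\<close>)
  have EB: "expectation (\<lambda>\<omega>. B j (\<tau>1 i) \<omega> - B j (\<tau>0 i) \<omega>) = 0" if "i \<in> I" "j \<in> {1..d}" for i j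
    using \<tau>[OF that(1)] by (intro B.increment_expectation that(2)) auto
  have ET: "expectation (\<lambda>\<omega>. time_integral (B j) (\<tau>0 i) (\<tau>1 i) \<omega>) = 0" if "i \<in> I" "j \<in> {1..d}" for i j
    using B.time_integral_expectation[OF that(2) \<tau>(1,2)[OF that(1)]] .
  have tBO: "order (\<lambda>i. r i ^ 3) (\<lambda>i \<omega>. (\<tau>1 i - \<tau>0 i) * (B j (\<tau>1 i) \<omega> - B j (\<tau>0 i) \<omega>))" if "j \<in> {1..d}" for j
    using order_mult[OF tO BO[OF that]] by (simp add: power2_eq_square power3_eq_cube)
  \<comment> \<open>the weights with one time step_index are centered and of order three\<close>
  have third: "second_order (\<lambda>i. window (\<tau>0 i) (\<tau>1 i)) n \<and> increment (\<lambda>i. (r i)\<^sup>2) n"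
    if n: "order (\<lambda>i. r i ^ 3) n" "\<And>i. i \<in> I \<Longrightarrow> n i \<in> borel_measurable (window (\<tau>0 i) (\<tau>1 i))" "\<And>i. i \<in> I \<Longrightarrow> expectation (n i) = 0" for n
  proof
    show "second_order (\<lambda>i. window (\<tau>0 i) (\<tau>1 i)) n"
      unfolding second_order_def using n r_power_mono[OF n(1), of 2] by simp
    show "increment (\<lambda>i. (r i)\<^sup>2) n"
      using n by (intro increment_centered) (auto simp: power2_eq_square power3_eq_cube mult.assoc)
  qed
  have mixed: "second_order (\<lambda>i. window (\<tau>0 i) (\<tau>1 i)) (\<lambda>i \<omega>. pathwise_eta N B j1 j2 (\<tau>1 i) (\<tau>0 i) \<omega>)
     \<and> increment (\<lambda>i. (r i)\<^sup>2) (\<lambda>i \<omega>. pathwise_eta N B j1 j2 (\<tau>1 i) (\<tau>0 i) \<omega>)" if j: "(j1 = 0 \<and> j2 \<in> {1..d}) \<or> (j2 = 0 \<and> j1 \<in> {1..d})" for j1 j2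
  proof -
    define j where "j = (if j1 = 0 then j2 else j1)"
    have jd: "j \<in> {1..d}" using j by (auto simp: j_def)
    have h3: "order (\<lambda>i. r i ^ 3) (\<lambda>i \<omega>. (1/2) * ((\<tau>1 i - \<tau>0 i) * (B j (\<tau>1 i) \<omega> - B j (\<tau>0 i) \<omega>)))"
      using order_mult[OF order_const[of "\<lambda>_. 1/2 :: real" 1 "\<lambda>_. 1"] tBO[OF jd]] by simp
    consider "N = 0" | "1 \<le> N" "j1 = 0" | "1 \<le> N" "j1 \<noteq> 0" "j2 = 0" using j by linarith
    then show ?thesis
    proof cases
      case 1
      then have eq: "pathwise_eta N B j1 j2 (\<tau>1 i) (\<tau>0 i) \<omega> = (1/2) * ((\<tau>1 i - \<tau>0 i) * (B j (\<tau>1 i) \<omega> - B j (\<tau>0 i) \<omega>))" for i \<omega>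
        using j by (auto simp: pathwise_eta_def incr_def j_def)
      show ?thesis unfolding eq
        by (rule third[OF h3]) (use EB[OF _ jd] Bm[OF _ jd] in \<open>auto intro!: borel_measurable_times\<close>)
    next
      case 2
      then have eq: "pathwise_eta N B j1 j2 (\<tau>1 i) (\<tau>0 i) \<omega> = (\<tau>1 i - \<tau>0 i) * (B j (\<tau>1 i) \<omega> - B j (\<tau>0 i) \<omega>) - time_integral (B j) (\<tau>0 i) (\<tau>1 i) \<omega>" for i \<omega>
        using j by (auto simp: pathwise_eta_def j_def)
      show ?thesis unfolding eq
      proof (rule third[OF order_diff[OF tBO[OF jd] TO[OF jd]]])
        fix i assume i: "i \<in> I"
        show "(\<lambda>\<omega>. (\<tau>1 i - \<tau>0 i) * (B j (\<tau>1 i) \<omega> - B j (\<tau>0 i) \<omega>) - time_integral (B j) (\<tau>0 i) (\<tau>1 i) \<omega>) \<in> borel_measurable (window (\<tau>0 i) (\<tau>1 i))"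
          by (intro borel_measurable_diff[OF borel_measurable_times[OF borel_measurable_const Bm[OF i jd]] Tm[OF i jd]])
        show "expectation (\<lambda>\<omega>. (\<tau>1 i - \<tau>0 i) * (B j (\<tau>1 i) \<omega> - B j (\<tau>0 i) \<omega>) - time_integral (B j) (\<tau>0 i) (\<tau>1 i) \<omega>) = 0"
          using EB[OF i jd] ET[OF i jd] order_integrable[OF tBO[OF jd] i] order_integrable[OF TO[OF jd] i]
          by (subst Bochner_Integration.integral_diff) auto
      qed
    next
      case 3
      then have eq: "pathwise_eta N B j1 j2 (\<tau>1 i) (\<tau>0 i) \<omega> = time_integral (B j) (\<tau>0 i) (\<tau>1 i) \<omega>" for i \<omega>
        using j by (auto simp: pathwise_eta_def j_def)
      show ?thesis unfolding eq by (rule third[OF TO[OF jd] Tm[OF _ jd] ET[OF _ jd]])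
    qed
  qed
  have zero: "second_order (\<lambda>i. window (\<tau>0 i) (\<tau>1 i)) (\<lambda>i \<omega>. pathwise_eta N B 0 0 (\<tau>1 i) (\<tau>0 i) \<omega>)
     \<and> increment (\<lambda>i. (r i)\<^sup>2) (\<lambda>i \<omega>. pathwise_eta N B 0 0 (\<tau>1 i) (\<tau>0 i) \<omega>)"
  proof -
    have eq: "pathwise_eta N B 0 0 (\<tau>1 i) (\<tau>0 i) \<omega> = (1/2) * ((\<tau>1 i - \<tau>0 i) * (\<tau>1 i - \<tau>0 i))" for i \<omega>
      by (simp add: pathwise_eta_def incr_def)
    have "order (\<lambda>i. 1 * ((r i)\<^sup>2 * (r i)\<^sup>2)) (\<lambda>i \<omega>. (1/2) * ((\<tau>1 i - \<tau>0 i) * (\<tau>1 i - \<tau>0 i)))"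
      by (intro order_mult tO order_const[of _ "1/2"]) auto
    then have o4: "order (\<lambda>i. r i ^ 4) (\<lambda>i \<omega>. (1/2) * ((\<tau>1 i - \<tau>0 i) * (\<tau>1 i - \<tau>0 i)))"
      by (simp flip: power_add)
    show ?thesis unfolding eq
    proof
      show "second_order (\<lambda>i. window (\<tau>0 i) (\<tau>1 i)) (\<lambda>i \<omega>. (1/2) * ((\<tau>1 i - \<tau>0 i) * (\<tau>1 i - \<tau>0 i)))"
        unfolding second_order_def using o4 r_power_mono[OF o4, of 2] by auto
      show "increment (\<lambda>i. (r i)\<^sup>2) (\<lambda>i \<omega>. (1/2) * ((\<tau>1 i - \<tau>0 i) * (\<tau>1 i - \<tau>0 i)))"
        using o4 by (intro increment_small) (auto simp flip: power_add)
    qed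
  qed
  have main: "second_order (\<lambda>i. window (\<tau>0 i) (\<tau>1 i)) (\<lambda>i \<omega>. pathwise_eta N B j1 j2 (\<tau>1 i) (\<tau>0 i) \<omega>)"
    if j: "j1 \<in> {1..d}" "j2 \<in> {1..d}" for j1 j2
  proof -
    let ?b = "\<lambda>j i \<omega>. B j (\<tau>1 i) \<omega> - B j (\<tau>0 i) \<omega>"
    let ?c = "\<lambda>i. if j1 = j2 then \<tau>1 i - \<tau>0 i else 0"
    have eq: "pathwise_eta N B j1 j2 (\<tau>1 i) (\<tau>0 i) \<omega> = (1/2) * (?b j1 i \<omega> * ?b j2 i \<omega> - ?c i)" for i \<omega>
      using j by (auto simp: pathwise_eta_def incr_def)
    have b2: "order (\<lambda>i. (r i)\<^sup>2) (\<lambda>i \<omega>. ?b j1 i \<omega> * ?b j2 i \<omega>)"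
      using order_mult[OF BO[OF j(1)] BO[OF j(2)]] by (simp add: power2_eq_square)
    have "order (\<lambda>i. (r i)\<^sup>2) (\<lambda>i \<omega>. ?c i)"
      by (rule order_const[of _ 1]) (use \<tau> in \<open>auto simp: less_imp_le\<close>)
    then have o: "order (\<lambda>i. (r i)\<^sup>2) (\<lambda>i \<omega>. ?b j1 i \<omega> * ?b j2 i \<omega> - ?c i)" by (rule order_diff[OF b2])
    have "order (\<lambda>i. (r i)\<^sup>2) (\<lambda>i \<omega>. (1/2) * (?b j1 i \<omega> * ?b j2 i \<omega> - ?c i))"
      using order_mult[OF order_const[of "\<lambda>_. 1/2 :: real" 1 "\<lambda>_. 1"] o] by simp
    moreover have "(\<lambda>\<omega>. (1/2) * (?b j1 i \<omega> * ?b j2 i \<omega> - ?c i)) \<in> borel_measurable (window (\<tau>0 i) (\<tau>1 i))" if "i \<in> I" for i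
      by (intro borel_measurable_times borel_measurable_diff[OF borel_measurable_times[OF Bm[OF that j(1)] Bm[OF that j(2)]]] borel_measurable_const)
    moreover have "expectation (\<lambda>\<omega>. (1/2) * (?b j1 i \<omega> * ?b j2 i \<omega> - ?c i)) = 0" if i: "i \<in> I" for i
    proof -
      have "expectation (\<lambda>\<omega>. ?b j1 i \<omega> * ?b j2 i \<omega>) = ?c i"
      proof (cases "j1 = j2")
        case True
        have "expectation (\<lambda>\<omega>. (?b j1 i \<omega>)\<^sup>2) = \<tau>1 i - \<tau>0 i"
          using \<tau>[OF i] by (intro B.increment_expectation(2) j(1)) auto
        then show ?thesis using True by (simp add: power2_eq_square)
      next
        case False
        then show ?thesis using increment_product_expectation[OF j False \<tau>(1,2)[OF i]] by simp
      qed
      then show ?thesis using order_integrable[OF b2 i] by (simp add: prob_space)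
    qed
    ultimately show ?thesis unfolding second_order_def eq by blast
  qed
  have area: "second_order (\<lambda>i. window (\<tau>0 i) (\<tau>1 i)) (\<lambda>i \<omega>. area_incr B Bt j1 j2 (\<tau>1 i) (\<tau>0 i) \<omega>)"
    if j: "j2 \<in> {1..d}" "j1 \<in> {1..<j2}" for j1 j2
  proof -
    have j': "j1 \<in> {1..d}" "j2 \<in> {2..d}" using j by auto
    have "order (\<lambda>i. (r i)\<^sup>2) (\<lambda>i \<omega>. area_incr B Bt j1 j2 (\<tau>1 i) (\<tau>0 i) \<omega>)"
      unfolding area_incr_def using order_mult[OF BO[OF j'(1)] BtO[OF j'(2)]] by (simp add: power2_eq_square)
    moreover have "(\<lambda>\<omega>. area_incr B Bt j1 j2 (\<tau>1 i) (\<tau>0 i) \<omega>) \<in> borel_measurable (window (\<tau>0 i) (\<tau>1 i))" if "i \<in> I" for i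
      unfolding area_incr_def by (intro borel_measurable_times Bm Btm that j')
    moreover have "expectation (\<lambda>\<omega>. area_incr B Bt j1 j2 (\<tau>1 i) (\<tau>0 i) \<omega>) = 0" if "i \<in> I" for i
      unfolding area_incr_def using \<tau>[OF that] by (intro area_expectation j') auto
    ultimately show ?thesis unfolding second_order_def by blast
  qed
  have I0: "order r (\<lambda>i \<omega>. \<tau>1 i - \<tau>0 i)" using r_power_mono[OF tO, of 1] by simp
  show ?thesis
    unfolding noise_def
  proof (intro conjI ballI)
    fix j assume j: "j \<in> {0..d}"
    show "order r (\<lambda>i \<omega>. incr B j (\<tau>1 i) (\<tau>0 i) \<omega>)"
      using j BO[of j] I0 by (cases "j = 0") (auto simp: incr_def)
    show "(\<lambda>\<omega>. incr B j (\<tau>1 i) (\<tau>0 i) \<omega>) \<in> borel_measurable (window (\<tau>0 i) (\<tau>1 i))" if "i \<in> I" for i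
      using j Bm[OF that, of j] by (cases "j = 0") (auto simp: incr_def)
    show "increment (\<lambda>i. (r i)\<^sup>2) (\<lambda>i \<omega>. pathwise_eta N B 0 j (\<tau>1 i) (\<tau>0 i) \<omega>)"
      "increment (\<lambda>i. (r i)\<^sup>2) (\<lambda>i \<omega>. pathwise_eta N B j 0 (\<tau>1 i) (\<tau>0 i) \<omega>)"
      using j zero mixed[of 0 j] mixed[of j 0] by (cases "j = 0"; auto)+
    fix j2 assume j2: "j2 \<in> {0..d}"
    show "second_order (\<lambda>i. window (\<tau>0 i) (\<tau>1 i)) (\<lambda>i \<omega>. pathwise_eta N B j j2 (\<tau>1 i) (\<tau>0 i) \<omega>)"
      using j j2 zero mixed[of j j2] main[of j j2] by (cases "j = 0"; cases "j2 = 0"; auto)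
  next
    fix j i assume "j \<in> {1..d}" "i \<in> I"
    then show "expectation (\<lambda>\<omega>. incr B j (\<tau>1 i) (\<tau>0 i) \<omega>) = 0" using EB by (simp add: incr_def)
  next
    show "order (\<lambda>i. (r i)\<^sup>2) (\<lambda>i \<omega>. incr B 0 (\<tau>1 i) (\<tau>0 i) \<omega>)" using tO by (simp add: incr_def)
  qed (use sub area in auto)
qed

end

section \<open>Iterating the one-step estimates\<close>

text \<open>
  Joint law of \<open>Y\<close> and of the noise, represented by the identity as a map into the coarser space \<open>H\<close>, is a product.
\<close>

lemma (in prob_space) nn_integral_independent:
  fixes g :: "'b \<times> 'a \<Rightarrow> ennreal"
  assumes ind: "indep_set (sets G) (sets H)" and G: "subalgebra M G" and H: "subalgebra M H"
    and Y: "Y \<in> measurable G N" and g: "g \<in> borel_measurable (N \<Otimes>\<^sub>M H)"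
  shows "(\<integral>\<^sup>+\<omega>. g (Y \<omega>, \<omega>) \<partial>M) = (\<integral>\<^sup>+\<omega>. (\<integral>\<^sup>+\<omega>'. g (Y \<omega>, \<omega>') \<partial>M) \<partial>M)"
proof -
  have id: "(\<lambda>\<omega>. \<omega>) \<in> measurable M H" using H by (intro measurable_from_subalg[OF H]) simp
  have YM: "Y \<in> measurable M N" by (rule measurable_from_subalg[OF G Y])
  interpret H: prob_space "distr M H (\<lambda>\<omega>. \<omega>)" by (rule prob_space_distr[OF id])
  interpret Y: prob_space "distr M N Y" by (rule prob_space_distr[OF YM])
  have pair: "(\<lambda>x. (Y x, x)) \<in> measurable M (N \<Otimes>\<^sub>M H)" by (rule measurable_Pair[OF YM id])
  have D: "distr M N Y \<Otimes>\<^sub>M distr M H (\<lambda>\<omega>. \<omega>) = distr M (N \<Otimes>\<^sub>M H) (\<lambda>x. (Y x, x))"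
  proof (rule pair_measure_eqI)
    show "sigma_finite_measure (distr M N Y)" "sigma_finite_measure (distr M H (\<lambda>\<omega>. \<omega>))" by unfold_locales
    show "sets (distr M N Y \<Otimes>\<^sub>M distr M H (\<lambda>\<omega>. \<omega>)) = sets (distr M (N \<Otimes>\<^sub>M H) (\<lambda>x. (Y x, x)))"
      by (simp cong: sets_pair_measure_cong)
    fix A C assume "A \<in> sets (distr M N Y)" "C \<in> sets (distr M H (\<lambda>\<omega>. \<omega>))"
    then have AC: "A \<in> sets N" "C \<in> sets H" by auto
    have YA: "Y -` A \<inter> space M \<in> sets G" using measurable_sets[OF Y AC(1)] G by (simp add: subalgebra_def)
    have C: "C \<subseteq> space M" "C \<in> sets M" using AC(2) H sets.sets_into_space by (auto simp: subalgebra_def)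
    have "emeasure (distr M (N \<Otimes>\<^sub>M H) (\<lambda>x. (Y x, x))) (A \<times> C) = emeasure M ((Y -` A \<inter> space M) \<inter> C)"
      using AC C by (subst emeasure_distr[OF pair]) (auto intro!: arg_cong[where f="emeasure M"])
    also have "\<dots> = emeasure M (Y -` A \<inter> space M) * emeasure M C"
      using indep_setD[OF ind YA AC(2)] by (simp add: emeasure_eq_measure ennreal_mult')
    also have "\<dots> = emeasure (distr M N Y) A * emeasure (distr M H (\<lambda>\<omega>. \<omega>)) C"
      using AC C by (simp add: emeasure_distr[OF YM] emeasure_distr[OF id] Int_absorb2)
    finally show "emeasure (distr M N Y) A * emeasure (distr M H (\<lambda>\<omega>. \<omega>)) C = emeasure (distr M (N \<Otimes>\<^sub>M H) (\<lambda>x. (Y x, x))) (A \<times> C)" ..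
  qed
  have g': "g \<in> borel_measurable (distr M N Y \<Otimes>\<^sub>M distr M H (\<lambda>\<omega>. \<omega>))" using g by simp
  have "(\<integral>\<^sup>+\<omega>. g (Y \<omega>, \<omega>) \<partial>M) = integral\<^sup>N (distr M (N \<Otimes>\<^sub>M H) (\<lambda>x. (Y x, x))) g"
    using g by (subst nn_integral_distr[OF pair]) auto
  also have "\<dots> = (\<integral>\<^sup>+y. (\<integral>\<^sup>+\<omega>'. g (y, \<omega>') \<partial>distr M H (\<lambda>\<omega>. \<omega>)) \<partial>distr M N Y)"
    unfolding D[symmetric] by (rule H.nn_integral_fst[OF g', symmetric])
  also have "\<dots> = (\<integral>\<^sup>+\<omega>. (\<integral>\<^sup>+\<omega>'. g (Y \<omega>, \<omega>') \<partial>distr M H (\<lambda>\<omega>. \<omega>)) \<partial>M)"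
    using g by (intro nn_integral_distr[OF YM] H.borel_measurable_nn_integral_fst) simp
  also have "\<dots> = (\<integral>\<^sup>+\<omega>. (\<integral>\<^sup>+\<omega>'. g (Y \<omega>, \<omega>') \<partial>M) \<partial>M)"
  proof (rule nn_integral_cong)
    fix \<omega> assume "\<omega> \<in> space M"
    then have "Y \<omega> \<in> space N" using YM by (rule measurable_space[rotated])
    then have "(\<lambda>\<omega>'. g (Y \<omega>, \<omega>')) \<in> borel_measurable H" using g by (rule measurable_Pair2[rotated])
    then show "(\<integral>\<^sup>+\<omega>'. g (Y \<omega>, \<omega>') \<partial>distr M H (\<lambda>\<omega>. \<omega>)) = (\<integral>\<^sup>+\<omega>'. g (Y \<omega>, \<omega>') \<partial>M)"
      by (subst nn_integral_distr[OF id]) auto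
  qed
  finally show ?thesis .
qed

text \<open>
  Formulated for extended values, so that no finiteness of the moments has to be known in advance.
\<close>

lemma discrete_gronwall:
  fixes u :: "nat \<Rightarrow> ennreal"
  assumes u0: "u 0 = 0" and step: "\<And>k. k < n \<Longrightarrow> u (Suc k) \<le> ennreal (1 + a) * u k + ennreal b"
    and ab: "a \<ge> 0" "b \<ge> 0" and k: "k \<le> n"
  shows "u k \<le> ennreal (real k * b * exp (real k * a))"
  using k
proof (induction k)
  case 0
  then show ?case using u0 by simp
next
  case (Suc k)
  have "u (Suc k) \<le> ennreal (1 + a) * ennreal (real k * b * exp (real k * a)) + ennreal b"
    using step[of k] Suc by (meson Suc_leD Suc_le_lessD add_mono_thms_linordered_semiring(3) mult_left_mono order_trans zero_le)
  also have "\<dots> = ennreal ((1 + a) * (real k * b * exp (real k * a)) + b)"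
    using ab by (simp add: ennreal_mult' ennreal_plus)
  also have "\<dots> \<le> ennreal (real (Suc k) * b * exp (real (Suc k) * a))"
  proof (rule ennreal_leI)
    have "(1 + a) * (real k * b * exp (real k * a)) \<le> exp a * (real k * b * exp (real k * a))"
      using ab exp_ge_add_one_self[of a] by (intro mult_right_mono) auto
    also have "\<dots> = real k * b * exp (real (Suc k) * a)"
      by (simp add: algebra_simps exp_add)
    finally have 1: "(1 + a) * (real k * b * exp (real k * a)) \<le> real k * b * exp (real (Suc k) * a)" .
    have "1 \<le> exp (real (Suc k) * a)" using ab by simp
    then have "b * 1 \<le> b * exp (real (Suc k) * a)" using ab by (intro mult_left_mono) auto
    with 1 show "(1 + a) * (real k * b * exp (real k * a)) + b \<le> real (Suc k) * b * exp (real (Suc k) * a)"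
      by (simp add: algebra_simps)
  qed
  finally show ?case .
qed

lemma borel_measurable_proj:
  fixes Z :: "'a \<Rightarrow> 'b::topological_space \<times> 'c::topological_space"
  assumes "Z \<in> borel_measurable N"
  shows "(\<lambda>p. fst (Z p)) \<in> borel_measurable N" "(\<lambda>p. snd (Z p)) \<in> borel_measurable N"
  by (rule measurable_compose[OF assms borel_measurable_continuous_onI], intro continuous_intros)+

type_synonym 'n states = "(real^'n) \<times> (real^'n) \<times> (real^'n) \<times> (real^'n)"

locale antithetic_schemes = driving_noise M F B Bt d
  for M :: "'w measure" and F B Bt d +
  fixes \<sigma> :: "nat \<Rightarrow> real^'n::finite \<Rightarrow> real^'n" and N :: nat and T :: real
  assumes coeff: "\<And>j. j \<in> {0..d} \<Longrightarrow> Cb_inf (\<sigma> j)" and T: "T > 0"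
begin

definition pathwise_step :: "real \<Rightarrow> 'w \<Rightarrow> real \<Rightarrow> real \<Rightarrow> real^'n \<Rightarrow> real^'n"
  where "pathwise_step \<theta> \<omega> t s = ito_step \<theta> d \<sigma> (\<lambda>j. incr B j t s \<omega>) (\<lambda>j1 j2. pathwise_eta N B j1 j2 t s \<omega>)
     (\<lambda>j1 j2. area_incr B Bt j1 j2 t s \<omega>)"

text \<open>
  One coarse step of the fine, the swapped fine, the coarse and the antithetic coarse scheme, in this order, starting at time \<open>t\<close>.
\<close>

fun next_states :: "real \<Rightarrow> real \<Rightarrow> 'w \<Rightarrow> 'n states \<Rightarrow> 'n states" where
  "next_states h t \<omega> (f, f', c, c') =
    (pathwise_step 1 \<omega> (t + h) (t + h/2) (pathwise_step 1 \<omega> (t + h/2) t f),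
     pathwise_step (-1) \<omega> (t + h/2) t (pathwise_step (-1) \<omega> (t + h) (t + h/2) f'),
     pathwise_step 1 \<omega> (t + h) t c, pathwise_step (-1) \<omega> (t + h) t c')"

primrec states :: "real \<Rightarrow> real^'n \<Rightarrow> nat \<Rightarrow> 'w \<Rightarrow> 'n states" where
  "states h x 0 \<omega> = (x, x, x, x)"
| "states h x (Suc k) \<omega> = next_states h (real k * h) \<omega> (states h x k \<omega>)"

text \<open>
  An experiment is given by a step size, a starting time and the four starting states.
\<close>

definition step_index :: "(real \<times> real \<times> 'n states) set"
  where "step_index = {(h, t, y). 0 < h \<and> h \<le> T \<and> 0 \<le> t}"

definition sqrt_step :: "real \<times> real \<times> 'n states \<Rightarrow> real"
  where "sqrt_step i = sqrt (fst i)"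

sublocale scheme_step M F B Bt d step_index sqrt_step "sqrt T" \<sigma>
proof unfold_locales
  fix i :: "real \<times> real \<times> 'n states" assume "i \<in> step_index"
  then show "0 < sqrt_step i" "sqrt_step i \<le> sqrt T" by (auto simp: step_index_def sqrt_step_def)
qed (rule coeff)

abbreviation "step_h \<equiv> (\<lambda>i :: real \<times> real \<times> 'n states. fst i)"
abbreviation "step_t \<equiv> (\<lambda>i :: real \<times> real \<times> 'n states. fst (snd i))"
abbreviation "step_m \<equiv> (\<lambda>i. step_t i + step_h i / 2)"
abbreviation "step_e \<equiv> (\<lambda>i. step_t i + step_h i)"

sublocale coupled_step M step_index sqrt_step "sqrt T" d \<sigma>
  "\<lambda>i. window (step_t i) (step_m i)" "\<lambda>i. window (step_m i) (step_e i)" "\<lambda>i. window (step_t i) (step_e i)"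
  "\<lambda>j i \<omega>. incr B j (step_m i) (step_t i) \<omega>" "\<lambda>j i \<omega>. incr B j (step_e i) (step_m i) \<omega>"
  "\<lambda>j1 j2 i \<omega>. pathwise_eta N B j1 j2 (step_m i) (step_t i) \<omega>"
  "\<lambda>j1 j2 i \<omega>. pathwise_eta N B j1 j2 (step_e i) (step_m i) \<omega>"
  "\<lambda>j1 j2 i \<omega>. pathwise_eta N B j1 j2 (step_e i) (step_t i) \<omega>"
  "\<lambda>j1 j2 i \<omega>. area_incr B Bt j1 j2 (step_m i) (step_t i) \<omega>"
  "\<lambda>j1 j2 i \<omega>. area_incr B Bt j1 j2 (step_e i) (step_m i) \<omega>"
  "\<lambda>j1 j2 i \<omega>. area_incr B Bt j1 j2 (step_e i) (step_t i) \<omega>"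
proof unfold_locales
  have idx: "0 < step_h i" "0 \<le> step_t i" "(sqrt_step i)\<^sup>2 = step_h i" if "i \<in> step_index" for i
    using that by (auto simp: step_index_def sqrt_step_def)
  show "noise d (\<lambda>i. window (step_t i) (step_m i)) (\<lambda>j i \<omega>. incr B j (step_m i) (step_t i) \<omega>)
     (\<lambda>j1 j2 i \<omega>. pathwise_eta N B j1 j2 (step_m i) (step_t i) \<omega>) (\<lambda>j1 j2 i \<omega>. area_incr B Bt j1 j2 (step_m i) (step_t i) \<omega>)"
    by (rule noise_window) (simp_all add: idx less_imp_le)
  show "noise d (\<lambda>i. window (step_m i) (step_e i)) (\<lambda>j i \<omega>. incr B j (step_e i) (step_m i) \<omega>)
     (\<lambda>j1 j2 i \<omega>. pathwise_eta N B j1 j2 (step_e i) (step_m i) \<omega>) (\<lambda>j1 j2 i \<omega>. area_incr B Bt j1 j2 (step_e i) (step_m i) \<omega>)"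
    by (rule noise_window) (simp_all add: idx less_imp_le)
  have add: "incr B j (step_m i) (step_t i) \<omega> + incr B j (step_e i) (step_m i) \<omega> = incr B j (step_e i) (step_t i) \<omega>" for j i \<omega>
    by (simp add: incr_def)
  show "noise d (\<lambda>i. window (step_t i) (step_e i)) (\<lambda>j i \<omega>. incr B j (step_m i) (step_t i) \<omega> + incr B j (step_e i) (step_m i) \<omega>)
     (\<lambda>j1 j2 i \<omega>. pathwise_eta N B j1 j2 (step_e i) (step_t i) \<omega>) (\<lambda>j1 j2 i \<omega>. area_incr B Bt j1 j2 (step_e i) (step_t i) \<omega>)"
    unfolding add by (rule noise_window) (simp_all add: idx less_imp_le)
  show "indep_set (sets (window (step_t i) (step_m i))) (sets (window (step_m i) (step_e i)))" if "i \<in> step_index" for i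
    using idx[OF that] by (intro indep_window) auto
  show "pathwise_eta N B j1 j2 (step_e i) (step_t i) \<omega> = pathwise_eta N B j1 j2 (step_m i) (step_t i) \<omega> + pathwise_eta N B j1 j2 (step_e i) (step_m i) \<omega>
     + (1/2) * (incr B j1 (step_m i) (step_t i) \<omega> * incr B j2 (step_e i) (step_m i) \<omega> + incr B j1 (step_e i) (step_m i) \<omega> * incr B j2 (step_m i) (step_t i) \<omega>)"
    if "j1 \<in> {1..d}" "j2 \<in> {1..d}" for j1 j2 i \<omega>
    using that by (auto simp: pathwise_eta_def incr_def field_simps)
qed

lemma next_states_halves:
  "next_states (step_h i) (step_t i) \<omega> (snd (snd i)) =
    (second_half 1 i \<omega> (first_half 1 i \<omega> (fst (snd (snd i)))),
     first_half (-1) i \<omega> (second_half (-1) i \<omega> (fst (snd (snd (snd i))))),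
     whole 1 i \<omega> (fst (snd (snd (snd (snd i))))), whole (-1) i \<omega> (snd (snd (snd (snd (snd i))))))"
proof -
  have add: "incr B j (step_m i) (step_t i) \<omega> + incr B j (step_e i) (step_m i) \<omega> = incr B j (step_e i) (step_t i) \<omega>" for j
    by (simp add: incr_def)
  obtain h t f f' c c' where "i = (h, t, f, f', c, c')" by (metis surj_pair)
  then show ?thesis unfolding add by (simp add: pathwise_step_def)
qed

definition fine_gap :: "'n states \<Rightarrow> real^'n" where "fine_gap y = fst y - fst (snd y)"
definition coarse_gap :: "'n states \<Rightarrow> real^'n" where "coarse_gap y = fst (snd (snd y)) - snd (snd (snd y))"
definition mean_gap :: "'n states \<Rightarrow> real^'n"
  where "mean_gap y = (1/2) *\<^sub>R (fst y + fst (snd y)) - (1/2) *\<^sub>R (fst (snd (snd y)) + snd (snd (snd y)))"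

lemma one_step_growth:
  fixes V :: "'n states \<Rightarrow> real^'n"
  assumes inc: "increment (\<lambda>i. norm (V (snd (snd i))) + e i)
      (\<lambda>i \<omega>. V (next_states (step_h i) (step_t i) \<omega> (snd (snd i))) - V (snd (snd i)))"
    and e: "\<And>i. i \<in> step_index \<Longrightarrow> 0 \<le> e i"
  obtains C where "C \<ge> 0" "\<And>h t y. 0 < h \<Longrightarrow> h \<le> T \<Longrightarrow> 0 \<le> t \<Longrightarrow>
    (\<integral>\<^sup>+\<omega>. ennreal (norm (V (next_states h t \<omega> y)) ^ (2*m)) \<partial>M)
      \<le> ennreal ((1 + C * h) * norm (V y) ^ (2*m) + C * h * e (h, t, y) ^ (2*m))"
proof -
  obtain C where C: "C \<ge> 0"
    "\<And>i. i \<in> step_index \<Longrightarrow> (\<integral>\<^sup>+\<omega>. ennreal (norm (V (snd (snd i)) + (V (next_states (step_h i) (step_t i) \<omega> (snd (snd i))) - V (snd (snd i)))) ^ (2*m)) \<partial>M)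
       \<le> ennreal ((1 + C * (sqrt_step i)\<^sup>2) * norm (V (snd (snd i))) ^ (2*m) + C * (sqrt_step i)\<^sup>2 * e i ^ (2*m))"
    by (rule moment_growth[OF inc e, where m=m]) auto
  show ?thesis
  proof (rule that[OF C(1)])
    fix h t :: real and y :: "'n states" assume "0 < h" "h \<le> T" "0 \<le> t"
    then show "(\<integral>\<^sup>+\<omega>. ennreal (norm (V (next_states h t \<omega> y)) ^ (2*m)) \<partial>M)
      \<le> ennreal ((1 + C * h) * norm (V y) ^ (2*m) + C * h * e (h, t, y) ^ (2*m))"
      using C(2)[of "(h, t, y)"] by (simp add: step_index_def sqrt_step_def)
  qed
qed

lemma pathwise_step_measurable:
  assumes ab: "0 \<le> a" "a \<le> s" "s < t" "t \<le> b" and Z: "Z \<in> borel_measurable N'" and id: "q \<in> measurable N' (window a b)"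
  shows "(\<lambda>p. pathwise_step \<theta> (q p) t s (Z p)) \<in> borel_measurable N'"
proof -
  have Bm: "(\<lambda>\<omega>. B j v \<omega> - B j s \<omega>) \<in> borel_measurable (window a b)" if "j \<in> {1..d}" "s \<le> v" "v \<le> t" for j v
    using ab that by (intro window_increment_measurable(1)) auto
  have Btm: "(\<lambda>\<omega>. Bt j v \<omega> - Bt j s \<omega>) \<in> borel_measurable (window a b)" if "j \<in> {2..d}" "s \<le> v" "v \<le> t" for j v
    using ab that by (intro window_increment_measurable(2)) auto
  have Tm: "time_integral (B j) s t \<in> borel_measurable (window a b)" if "j \<in> {1..d}" for j
    by (intro B.riemann_measurable(2) ab Bm that)
  have i: "incr B j t s \<in> borel_measurable (window a b)" if "j \<le> d" for j
    using Bm[of j t] that ab by (cases "j = 0") (auto simp: incr_def[abs_def])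
  have e: "pathwise_eta N B j1 j2 t s \<in> borel_measurable (window a b)" if "j1 \<le> d" "j2 \<le> d" for j1 j2
  proof -
    have prod: "(\<lambda>\<omega>. (1/2) * (incr B j1 t s \<omega> * incr B j2 t s \<omega> - c)) \<in> borel_measurable (window a b)" for c :: real
      by (intro borel_measurable_times borel_measurable_diff borel_measurable_const i that)
    have ito: "(\<lambda>\<omega>. (t - s) * (B j2 t \<omega> - B j2 s \<omega>) - time_integral (B j2) s t \<omega>) \<in> borel_measurable (window a b)" if "1 \<le> j2"
      using \<open>j2 \<le> d\<close> that ab by (intro borel_measurable_times borel_measurable_diff[OF borel_measurable_times] borel_measurable_const Bm Tm) auto
    show ?thesis
    proof (cases "1 \<le> N \<and> j1 = 0 \<and> 1 \<le> j2")
      case True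
      then show ?thesis unfolding pathwise_eta_def[abs_def] if_P[OF True] by (intro ito) simp
    next
      case F1: False
      show ?thesis
      proof (cases "1 \<le> N \<and> 1 \<le> j1 \<and> j2 = 0")
        case True
        then show ?thesis unfolding pathwise_eta_def[abs_def] if_not_P[OF F1] if_P[OF True] using that by (intro Tm) simp
      next
        case False
        show ?thesis unfolding pathwise_eta_def[abs_def] if_not_P[OF F1] if_not_P[OF False] by (rule prod)
      qed
    qed
  qed
  have a: "area_incr B Bt j1 j2 t s \<in> borel_measurable (window a b)" if "1 \<le> j1" "j1 < j2" "j2 \<le> d" for j1 j2
    unfolding area_incr_def[abs_def] using Bm[of j1 t] Btm[of j2 t] that ab by (intro borel_measurable_times) auto
  show ?thesis unfolding pathwise_step_def
    by (intro ito_step_measurable Z measurable_compose[OF id i] measurable_compose[OF id e] measurable_compose[OF id a])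
qed

lemma next_states_measurable:
  assumes h: "0 < h" "0 \<le> a" "a \<le> t" "t + h \<le> b" and Y: "Y \<in> borel_measurable N'" and q: "q \<in> measurable N' (window a b)"
  shows "(\<lambda>p. next_states h t (q p) (Y p)) \<in> borel_measurable N'"
proof -
  have eq: "next_states h t (q p) (Y p) =
    (pathwise_step 1 (q p) (t + h) (t + h/2) (pathwise_step 1 (q p) (t + h/2) t (fst (Y p))),
     pathwise_step (-1) (q p) (t + h/2) t (pathwise_step (-1) (q p) (t + h) (t + h/2) (fst (snd (Y p)))),
     pathwise_step 1 (q p) (t + h) t (fst (snd (snd (Y p)))), pathwise_step (-1) (q p) (t + h) t (snd (snd (snd (Y p)))))" for p
    by (cases "Y p") auto
  show ?thesis unfolding eq
    using h by (intro borel_measurable_Pair pathwise_step_measurable[OF h(2) _ _ _ _ q] borel_measurable_proj Y) auto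
qed

lemma states_measurable:
  assumes "0 < h" shows "states h x k \<in> borel_measurable (window 0 (real k * h))"
proof (induction k)
  case 0
  then show ?case by simp
next
  case (Suc k)
  have "0 \<le> real k * h" "real k * h \<le> real (Suc k) * h" "real k * h + h \<le> real (Suc k) * h"
    using assms by (auto simp: algebra_simps)
  then have "(\<lambda>\<omega>. next_states h (real k * h) \<omega> (states h x k \<omega>)) \<in> borel_measurable (window 0 (real (Suc k) * h))"
    by (intro next_states_measurable[OF assms] measurable_from_subalg[OF window_mono Suc]) auto
  then show ?case by simp
qed

text \<open>
  Freezing the states reached after \<open>l\<close> steps turns the one-step bound into a recursion for the moments of \<open>V\<close>. There are at most
  \<open>T / h\<close> steps, so the factors \<open>1 + C h\<close> accumulate to a constant.
\<close>

lemma iterate_moments: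
  fixes V :: "'n states \<Rightarrow> real^'n" and e :: "real \<times> real \<times> 'n states \<Rightarrow> real"
  assumes m: "m > 0"
    and inc: "increment (\<lambda>i. norm (V (snd (snd i))) + e i)
      (\<lambda>i \<omega>. V (next_states (step_h i) (step_t i) \<omega> (snd (snd i))) - V (snd (snd i)))"
    and e: "\<And>i. i \<in> step_index \<Longrightarrow> 0 \<le> e i" and eh: "\<And>h t t' y. e (h, t, y) = e (h, t', y)"
    and em: "\<And>h. (\<lambda>y. e (h, 0, y)) \<in> borel_measurable borel"
    and V: "V \<in> borel_measurable borel" and V0: "V (x, x, x, x) = 0"
    and K: "K \<ge> 0" "\<And>h k. 0 < h \<Longrightarrow> real k * h \<le> T \<Longrightarrow>
       (\<integral>\<^sup>+\<omega>. ennreal (e (h, 0, states h x k \<omega>) ^ (2*m)) \<partial>M) \<le> ennreal (K * h ^ q)"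
  obtains C where "C \<ge> 0" "\<And>h k. 0 < h \<Longrightarrow> real k * h \<le> T \<Longrightarrow>
      (\<integral>\<^sup>+\<omega>. ennreal (norm (V (states h x k \<omega>)) ^ (2*m)) \<partial>M) \<le> ennreal (C * h ^ q)"
proof -
  obtain C where C: "C \<ge> 0" "\<And>h t y. 0 < h \<Longrightarrow> h \<le> T \<Longrightarrow> 0 \<le> t \<Longrightarrow>
    (\<integral>\<^sup>+\<omega>. ennreal (norm (V (next_states h t \<omega> y)) ^ (2*m)) \<partial>M)
      \<le> ennreal ((1 + C * h) * norm (V y) ^ (2*m) + C * h * e (h, t, y) ^ (2*m))"
    by (rule one_step_growth[OF inc e, where m=m]) auto
  show ?thesis
  proof (rule that[of "T * (C * K) * exp (T * C)"])
    fix h and k :: nat assume h: "0 < h" and kh: "real k * h \<le> T"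
    define u where "u l = (\<integral>\<^sup>+\<omega>. ennreal (norm (V (states h x l \<omega>)) ^ (2*m)) \<partial>M)" for l
    have "u k \<le> ennreal (real k * (C * h * (K * h ^ q)) * exp (real k * (C * h)))"
    proof (rule discrete_gronwall[where n=k])
      show "u 0 = 0" unfolding u_def using m by (simp add: V0)
      fix l assume l: "l < k"
      define t where "t = real l * h"
      have t: "0 \<le> t" using h by (simp add: t_def)
      have "real (Suc l) * h \<le> real k * h" using l h by (intro mult_right_mono) auto
      then have th: "t + h \<le> T" using kh by (simp add: t_def algebra_simps)
      have hT: "h \<le> T" using t th by simp
      have lh: "real l * h \<le> T" using th h by (simp add: t_def)
      have sub: "subalgebra M (window 0 t)" "subalgebra M (window t (t + h))"
        using t h by (auto intro!: subalgebra_window)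
      have Sm: "states h x l \<in> borel_measurable (window 0 t)" unfolding t_def by (rule states_measurable[OF h])
      have gm: "(\<lambda>(y, \<omega>). ennreal (norm (V (next_states h t \<omega> y)) ^ (2*m))) \<in> borel_measurable (borel \<Otimes>\<^sub>M window t (t + h))"
      proof -
        have "(\<lambda>p. next_states h t (snd p) (fst p)) \<in> borel_measurable (borel \<Otimes>\<^sub>M window t (t + h))"
          using h t by (intro next_states_measurable[OF h t]) auto
        from measurable_compose[OF this V] show ?thesis by (simp add: case_prod_beta)
      qed
      have "u (Suc l) = (\<integral>\<^sup>+\<omega>. ennreal (norm (V (next_states h t \<omega> (states h x l \<omega>))) ^ (2*m)) \<partial>M)"
        unfolding u_def t_def by simp
      also have "\<dots> = (\<integral>\<^sup>+\<omega>. (\<integral>\<^sup>+\<omega>'. ennreal (norm (V (next_states h t \<omega>' (states h x l \<omega>))) ^ (2*m)) \<partial>M) \<partial>M)"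
        using nn_integral_independent[OF indep_window sub Sm gm] t h by simp
      also have "\<dots> \<le> (\<integral>\<^sup>+\<omega>. ennreal (1 + C * h) * ennreal (norm (V (states h x l \<omega>)) ^ (2*m))
          + ennreal (C * h) * ennreal (e (h, 0, states h x l \<omega>) ^ (2*m)) \<partial>M)"
      proof (rule nn_integral_mono)
        fix \<omega>
        have "0 \<le> e (h, 0, states h x l \<omega>)" using h hT by (intro e) (simp add: step_index_def)
        then show "(\<integral>\<^sup>+\<omega>'. ennreal (norm (V (next_states h t \<omega>' (states h x l \<omega>))) ^ (2*m)) \<partial>M)
           \<le> ennreal (1 + C * h) * ennreal (norm (V (states h x l \<omega>)) ^ (2*m)) + ennreal (C * h) * ennreal (e (h, 0, states h x l \<omega>) ^ (2*m))"
          using C(2)[OF h hT t, of "states h x l \<omega>"] C(1) h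
          by (simp add: ennreal_mult' ennreal_plus eh[of h t _ 0])
      qed
      also have "\<dots> = ennreal (1 + C * h) * u l + ennreal (C * h) * (\<integral>\<^sup>+\<omega>. ennreal (e (h, 0, states h x l \<omega>) ^ (2*m)) \<partial>M)"
      proof -
        have S: "states h x l \<in> borel_measurable M" by (rule measurable_from_subalg[OF sub(1) Sm])
        note [measurable] = measurable_compose[OF S V] measurable_compose[OF S em[of h]]
        show ?thesis unfolding u_def by (simp add: nn_integral_add nn_integral_cmult)
      qed
      also have "\<dots> \<le> ennreal (1 + C * h) * u l + ennreal (C * h) * ennreal (K * h ^ q)"
        by (intro add_left_mono mult_left_mono K(2)[OF h lh]) simp
      also have "\<dots> = ennreal (1 + C * h) * u l + ennreal (C * h * (K * h ^ q))"
        using C(1) K(1) h by (simp add: ennreal_mult')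
      finally show "u (Suc l) \<le> ennreal (1 + C * h) * u l + ennreal (C * h * (K * h ^ q))" .
    qed (use C(1) K(1) h in auto)
    also have "\<dots> \<le> ennreal (T * (C * K) * exp (T * C) * h ^ q)"
    proof (rule ennreal_leI)
      have "real k * (C * h * (K * h ^ q)) * exp (real k * (C * h)) = (real k * h) * (C * K) * exp ((real k * h) * C) * h ^ q"
        by (simp add: mult_ac)
      also have "\<dots> \<le> T * (C * K) * exp (T * C) * h ^ q"
        using kh C(1) K(1) h T by (intro mult_right_mono mult_mono) (auto intro!: mult_right_mono mult_nonneg_nonneg)
      finally show "real k * (C * h * (K * h ^ q)) * exp (real k * (C * h)) \<le> T * (C * K) * exp (T * C) * h ^ q" .
    qed
    finally show "(\<integral>\<^sup>+\<omega>. ennreal (norm (V (states h x k \<omega>)) ^ (2*m)) \<partial>M) \<le> ennreal (T * (C * K) * exp (T * C) * h ^ q)"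
      unfolding u_def .
  qed (use C(1) K(1) T in auto)
qed

lemma gap_measurable:
  "fine_gap \<in> borel_measurable borel" "coarse_gap \<in> borel_measurable borel" "mean_gap \<in> borel_measurable borel"
  unfolding fine_gap_def[abs_def] coarse_gap_def[abs_def] mean_gap_def[abs_def]
  by (rule borel_measurable_continuous_onI, intro continuous_intros)+

lemma antithetic_gap_moments:
  assumes m: "m > 0" and V: "V = fine_gap \<or> V = coarse_gap"
  obtains C where "C \<ge> 0" "\<And>h k. 0 < h \<Longrightarrow> real k * h \<le> T \<Longrightarrow>
      (\<integral>\<^sup>+\<omega>. ennreal (norm (V (states h x k \<omega>)) ^ (2*m)) \<partial>M) \<le> ennreal (C * h ^ m)"
proof -
  have inc: "increment (\<lambda>i. norm (V (snd (snd i))) + sqrt_step i)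
      (\<lambda>i \<omega>. V (next_states (step_h i) (step_t i) \<omega> (snd (snd i))) - V (snd (snd i)))"
    using V
  proof
    assume V: "V = fine_gap"
    show ?thesis unfolding V
      by (rule increment_cong[OF increment_mono[OF antithetic_differences(1)[of "\<lambda>i. fst (snd (snd i))" "\<lambda>i. fst (snd (snd (snd i)))"], where K=1]])
        (auto simp: fine_gap_def next_states_halves r_nonneg)
  next
    assume V: "V = coarse_gap"
    show ?thesis unfolding V
      by (rule increment_cong[OF increment_mono[OF antithetic_differences(2)[of "\<lambda>i. fst (snd (snd (snd (snd i))))" "\<lambda>i. snd (snd (snd (snd (snd i))))"], where K=1]])
        (auto simp: coarse_gap_def next_states_halves r_nonneg)
  qed
  show ?thesis
  proof (rule iterate_moments[OF m inc, where x=x and q=m and K=1])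
    show "V \<in> borel_measurable borel" "V (x, x, x, x) = 0"
      using V gap_measurable by (auto simp: fine_gap_def coarse_gap_def)
    show "(\<integral>\<^sup>+\<omega>. ennreal (sqrt_step (h, 0, states h x k \<omega>) ^ (2*m)) \<partial>M) \<le> ennreal (1 * h ^ m)" if "0 < h" for h k
      using that by (simp add: sqrt_step_def power_mult emeasure_space_1)
  qed (use that r_nonneg in \<open>auto simp: sqrt_step_def\<close>)
qed

text \<open>
  The error term \<open>h + \<bar>fine_gap\<bar>^2 + \<bar>coarse_gap\<bar>^2\<close> of the one-step bound is of order \<open>h\<close>, since the antithetic gaps are of order
  \<open>sqrt h\<close> in every moment.
\<close>

lemma mean_gap_moments:
  assumes m: "m > 0"
  obtains C where "C \<ge> 0" "\<And>h k. 0 < h \<Longrightarrow> real k * h \<le> T \<Longrightarrow>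
      (\<integral>\<^sup>+\<omega>. ennreal (norm (mean_gap (states h x k \<omega>)) ^ (2*m)) \<partial>M) \<le> ennreal (C * h ^ (2*m))"
    "\<And>h k. 0 < h \<Longrightarrow> real k * h \<le> T \<Longrightarrow>
      (\<integral>\<^sup>+\<omega>. ennreal ((h + (norm (fine_gap (states h x k \<omega>)))\<^sup>2 + (norm (coarse_gap (states h x k \<omega>)))\<^sup>2) ^ (2*m)) \<partial>M) \<le> ennreal (C * h ^ (2*m))"
proof -
  define e :: "real \<times> real \<times> 'n states \<Rightarrow> real" where
    "e i = fst i + (norm (fine_gap (snd (snd i))))\<^sup>2 + (norm (coarse_gap (snd (snd i))))\<^sup>2" for i
  have e0: "0 \<le> e i" if "i \<in> step_index" for i
  proof -
    have "0 \<le> fst i" using that by (auto simp: step_index_def)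
    then show ?thesis by (simp add: e_def)
  qed
  have inc: "increment (\<lambda>i. norm (mean_gap (snd (snd i))) + e i)
      (\<lambda>i \<omega>. mean_gap (next_states (step_h i) (step_t i) \<omega> (snd (snd i))) - mean_gap (snd (snd i)))"
    by (rule increment_cong[OF increment_mono[OF average_difference[of "\<lambda>i. fst (snd (snd i))" "\<lambda>i. fst (snd (snd (snd i)))"
        "\<lambda>i. fst (snd (snd (snd (snd i))))" "\<lambda>i. snd (snd (snd (snd (snd i))))"], where K=1]])
      (auto simp: mean_gap_def fine_gap_def coarse_gap_def e_def next_states_halves sqrt_step_def step_index_def)
  obtain Cf where Cf: "Cf \<ge> 0" "\<And>h k. 0 < h \<Longrightarrow> real k * h \<le> T \<Longrightarrow>
      (\<integral>\<^sup>+\<omega>. ennreal (norm (fine_gap (states h x k \<omega>)) ^ (2*(2*m))) \<partial>M) \<le> ennreal (Cf * h ^ (2*m))"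
    by (rule antithetic_gap_moments[where m="2*m" and V=fine_gap and x=x]) (use m in auto)
  obtain Cc where Cc: "Cc \<ge> 0" "\<And>h k. 0 < h \<Longrightarrow> real k * h \<le> T \<Longrightarrow>
      (\<integral>\<^sup>+\<omega>. ennreal (norm (coarse_gap (states h x k \<omega>)) ^ (2*(2*m))) \<partial>M) \<le> ennreal (Cc * h ^ (2*m))"
    by (rule antithetic_gap_moments[where m="2*m" and V=coarse_gap and x=x]) (use m in auto)
  define K where "K = 2^(2*m) * (2^(2*m) * (1 + Cf) + Cc)"
  have K0: "K \<ge> 0" using Cf Cc by (simp add: K_def)
  have K: "(\<integral>\<^sup>+\<omega>. ennreal (e (h, 0, states h x k \<omega>) ^ (2*m)) \<partial>M) \<le> ennreal (K * h ^ (2*m))" if h: "0 < h" and kh: "real k * h \<le> T" for h k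
  proof -
    have S: "states h x k \<in> borel_measurable M"
      using h by (intro measurable_from_subalg[OF subalgebra_window states_measurable]) auto
    note [measurable] = measurable_compose[OF S gap_measurable(1)] measurable_compose[OF S gap_measurable(2)]
    let ?f = "\<lambda>\<omega>. norm (fine_gap (states h x k \<omega>))" and ?c = "\<lambda>\<omega>. norm (coarse_gap (states h x k \<omega>))"
    have "(\<integral>\<^sup>+\<omega>. ennreal (e (h, 0, states h x k \<omega>) ^ (2*m)) \<partial>M)
      \<le> (\<integral>\<^sup>+\<omega>. ennreal (2^(2*m)) * (ennreal (2^(2*m)) * (ennreal (h ^ (2*m)) + ennreal (?f \<omega> ^ (2*(2*m)))) + ennreal (?c \<omega> ^ (2*(2*m)))) \<partial>M)"
    proof (rule nn_integral_mono)
      fix \<omega>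
      have "e (h, 0, states h x k \<omega>) ^ (2*m) \<le> 2^(2*m) * ((h + (?f \<omega>)\<^sup>2) ^ (2*m) + ((?c \<omega>)\<^sup>2) ^ (2*m))"
        unfolding e_def using h by (simp only: fst_conv snd_conv) (intro power_add_le, auto)
      also have "\<dots> \<le> 2^(2*m) * (2^(2*m) * (h ^ (2*m) + ((?f \<omega>)\<^sup>2) ^ (2*m)) + ((?c \<omega>)\<^sup>2) ^ (2*m))"
        using h by (intro mult_left_mono add_right_mono power_add_le) auto
      finally have "ennreal (e (h, 0, states h x k \<omega>) ^ (2*m)) \<le> ennreal (2^(2*m) * (2^(2*m) * (h ^ (2*m) + ?f \<omega> ^ (2*(2*m))) + ?c \<omega> ^ (2*(2*m))))"
        by (intro ennreal_leI) (simp add: power_mult)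
      also have "\<dots> = ennreal (2^(2*m)) * (ennreal (2^(2*m)) * (ennreal (h ^ (2*m)) + ennreal (?f \<omega> ^ (2*(2*m)))) + ennreal (?c \<omega> ^ (2*(2*m))))"
        using h by (simp only: ennreal_mult' ennreal_plus zero_le_power zero_le_numeral norm_ge_zero add_nonneg_nonneg mult_nonneg_nonneg less_imp_le)
      finally show "ennreal (e (h, 0, states h x k \<omega>) ^ (2*m)) \<le> \<dots>" .
    qed
    also have "\<dots> = ennreal (2^(2*m)) * (ennreal (2^(2*m)) * (ennreal (h ^ (2*m)) + (\<integral>\<^sup>+\<omega>. ennreal (?f \<omega> ^ (2*(2*m))) \<partial>M)) + (\<integral>\<^sup>+\<omega>. ennreal (?c \<omega> ^ (2*(2*m))) \<partial>M))"
      by (simp add: nn_integral_add nn_integral_cmult emeasure_space_1)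
    also have "\<dots> \<le> ennreal (2^(2*m)) * (ennreal (2^(2*m)) * (ennreal (h ^ (2*m)) + ennreal (Cf * h ^ (2*m))) + ennreal (Cc * h ^ (2*m)))"
      by (intro mult_left_mono add_mono Cf(2) Cc(2) h kh) auto
    also have "\<dots> = ennreal (2^(2*m) * (2^(2*m) * (h ^ (2*m) + Cf * h ^ (2*m)) + Cc * h ^ (2*m)))"
      using h Cf(1) Cc(1) by (simp only: ennreal_mult' ennreal_plus zero_le_power zero_le_numeral add_nonneg_nonneg mult_nonneg_nonneg less_imp_le)
    also have "2^(2*m) * (2^(2*m) * (h ^ (2*m) + Cf * h ^ (2*m)) + Cc * h ^ (2*m)) = K * h ^ (2*m)"
      by (simp add: K_def algebra_simps)
    finally show ?thesis .
  qed
  obtain C where C: "C \<ge> 0" "\<And>h k. 0 < h \<Longrightarrow> real k * h \<le> T \<Longrightarrow>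
      (\<integral>\<^sup>+\<omega>. ennreal (norm (mean_gap (states h x k \<omega>)) ^ (2*m)) \<partial>M) \<le> ennreal (C * h ^ (2*m))"
  proof (rule iterate_moments[OF m inc e0, where x=x and q="2*m" and K=K])
    show "(\<lambda>y. e (h, 0, y)) \<in> borel_measurable borel" for h
      unfolding e_def using gap_measurable by simp
    show "mean_gap (x, x, x, x) = 0" by (simp add: mean_gap_def)
  qed (use K0 K gap_measurable that in \<open>auto simp: e_def\<close>)
  show ?thesis
  proof (rule that[of "max C K"])
    fix h and k :: nat assume h: "0 < h" "real k * h \<le> T"
    have "ennreal (C * h ^ (2*m)) \<le> ennreal (max C K * h ^ (2*m))" "ennreal (K * h ^ (2*m)) \<le> ennreal (max C K * h ^ (2*m))"
      using h by (auto intro!: ennreal_leI mult_right_mono)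
    with C(2)[OF h] K[OF h] show "(\<integral>\<^sup>+\<omega>. ennreal (norm (mean_gap (states h x k \<omega>)) ^ (2*m)) \<partial>M) \<le> ennreal (max C K * h ^ (2*m))"
      "(\<integral>\<^sup>+\<omega>. ennreal ((h + (norm (fine_gap (states h x k \<omega>)))\<^sup>2 + (norm (coarse_gap (states h x k \<omega>)))\<^sup>2) ^ (2*m)) \<partial>M) \<le> ennreal (max C K * h ^ (2*m))"
      unfolding e_def by auto
  qed (use C in auto)
qed

end

section \<open>Moments of the coupling difference\<close>

lemma ito_step_cong:
  assumes "\<And>j1 j2. j1 \<le> d \<Longrightarrow> j2 \<le> d \<Longrightarrow> e j1 j2 = e' j1 j2"
  shows "ito_step \<theta> d \<sigma> b e a = ito_step \<theta> d \<sigma> b e' a"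
proof
  fix z
  have "(\<Sum>j1=0..d. \<Sum>j2=0..d. e j1 j2 *\<^sub>R lie_op d \<sigma> j1 (\<sigma> j2) z) = (\<Sum>j1=0..d. \<Sum>j2=0..d. e' j1 j2 *\<^sub>R lie_op d \<sigma> j1 (\<sigma> j2) z)"
    by (intro sum.cong refl) (simp add: assms)
  then show "ito_step \<theta> d \<sigma> b e a z = ito_step \<theta> d \<sigma> b e' a z" by (simp add: ito_step_def second_part_def)
qed

text \<open>
  Reduces real exponents \<open>p\<close> to integer exponents \<open>q\<close>: for \<open>x \<ge> h\<close> the quotient \<open>x / h\<close> is at least one, and its
  power grows with the exponent.
\<close>

lemma powr_le_interpolation:
  fixes x h p :: real
  assumes x: "0 \<le> x" and h: "0 < h" and p: "0 < p" "p \<le> real q"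
  shows "x powr p \<le> h powr p + h powr (p - real q) * x ^ q"
proof (cases "x \<le> h")
  case True
  then have "x powr p \<le> h powr p" using x p by (intro powr_mono2) auto
  moreover have "0 \<le> h powr (p - real q) * x ^ q" using x by simp
  ultimately show ?thesis by linarith
next
  case False
  then have xh: "0 < x" "1 \<le> x / h" using h by auto
  have "x powr p = h powr p * (x / h) powr p" using xh h by (simp add: powr_divide)
  also have "\<dots> \<le> h powr p * (x / h) powr real q"
    using xh p by (intro mult_left_mono powr_mono) auto
  also have "\<dots> = h powr (p - real q) * x ^ q"
    using xh h by (simp add: powr_divide powr_diff powr_realpow)
  finally have "x powr p \<le> h powr (p - real q) * x ^ q" .
  moreover have "0 \<le> h powr p" by simp
  ultimately show ?thesis by linarith
qed

context antithetic_schemes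
begin

lemma integrator_AE:
  assumes st: "0 \<le> s" "s < t"
  shows "AE \<omega> in M. \<forall>\<theta>. integrator \<theta> M F N d \<sigma> B Bt \<omega> t s = pathwise_step \<theta> \<omega> t s"
proof -
  have "AE \<omega> in M. \<forall>j\<in>{1..d}. ito_integral M F (B j) (\<lambda>v _. LBINT u:{s..v}. 1) s t \<omega>
      = (t - s) * (B j t \<omega> - B j s \<omega>) - time_integral (B j) s t \<omega>"
    by (rule AE_finite_allI) (auto intro!: B.ito_integral_elapsed_time st)
  moreover have "AE \<omega> in M. \<forall>j\<in>{1..d}. (\<lambda>n. riemann (B j) s t n \<omega>) \<longlonglongrightarrow> time_integral (B j) s t \<omega>
    \<and> time_integral (B j) s t \<omega> = (LBINT v:{s..t}. (B j v \<omega> - B j s \<omega>))"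
    by (rule AE_finite_allI, simp, rule B.riemann_AE[OF _ st], assumption)
  ultimately show ?thesis
  proof eventually_elim
    case (elim \<omega>)
    have "eta_incr M F N B j1 j2 t s \<omega> = pathwise_eta N B j1 j2 t s \<omega>" if "j1 \<le> d" "j2 \<le> d" for j1 j2
      using elim that unfolding eta_incr_def pathwise_eta_def by auto
    then show ?case unfolding integrator_eq_ito_step pathwise_step_def by (intro allI ito_step_cong) auto
  qed
qed

text \<open>
  The exceptional sets of the countably many steps are united; outside of them the two recursions coincide.
\<close>

lemma states_eq_schemes:
  assumes h: "0 < h"
  shows "AE \<omega> in M. \<forall>k. states h x k \<omega> =
    (fine_scheme (integrator 1 M F N d \<sigma> B Bt \<omega>) h x k, swapped_fine_scheme (integrator (-1) M F N d \<sigma> B Bt \<omega>) h x k,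
     coarse_scheme (integrator 1 M F N d \<sigma> B Bt \<omega>) h x k, coarse_scheme (integrator (-1) M F N d \<sigma> B Bt \<omega>) h x k)"
proof -
  let ?eq = "\<lambda>\<theta> \<omega> t s. integrator \<theta> M F N d \<sigma> B Bt \<omega> t s = pathwise_step \<theta> \<omega> t s"
  have "AE \<omega> in M. \<forall>k :: nat. \<forall>\<theta>.
     ?eq \<theta> \<omega> (real k * h + h) (real k * h + h/2)
   \<and> ?eq \<theta> \<omega> (real k * h + h/2) (real k * h)
   \<and> ?eq \<theta> \<omega> (real k * h + h) (real k * h)"
    unfolding AE_all_countable
  proof
    fix k :: nat
    have k: "0 \<le> real k * h" using h by simp
    have "AE \<omega> in M. \<forall>\<theta>. ?eq \<theta> \<omega> (real k * h + h) (real k * h + h/2)"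
      "AE \<omega> in M. \<forall>\<theta>. ?eq \<theta> \<omega> (real k * h + h/2) (real k * h)"
      "AE \<omega> in M. \<forall>\<theta>. ?eq \<theta> \<omega> (real k * h + h) (real k * h)"
      using h k by (intro integrator_AE; simp)+
    then show "AE \<omega> in M. \<forall>\<theta>.
     ?eq \<theta> \<omega> (real k * h + h) (real k * h + h/2)
   \<and> ?eq \<theta> \<omega> (real k * h + h/2) (real k * h)
   \<and> ?eq \<theta> \<omega> (real k * h + h) (real k * h)"
      by eventually_elim blast
  qed
  then show ?thesis
  proof eventually_elim
    case (elim \<omega>)
    have t: "(real k + 1) * h = real k * h + h" "(real k + 1/2) * h = real k * h + h/2" for k
      by (simp_all add: algebra_simps)
    show ?case
    proof
      fix k
      show "states h x k \<omega> =
        (fine_scheme (integrator 1 M F N d \<sigma> B Bt \<omega>) h x k, swapped_fine_scheme (integrator (-1) M F N d \<sigma> B Bt \<omega>) h x k,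
         coarse_scheme (integrator 1 M F N d \<sigma> B Bt \<omega>) h x k, coarse_scheme (integrator (-1) M F N d \<sigma> B Bt \<omega>) h x k)"
      proof (induction k)
        case (Suc k)
        show ?case
          unfolding states.simps Suc next_states.simps fine_scheme.simps swapped_fine_scheme.simps coarse_scheme.simps t
          using elim by simp
      qed simp
    qed
  qed
qed

lemma coupling_bound:
  assumes \<phi>: "Cb 2 (\<phi> :: real^'n \<Rightarrow> real)" and p: "p \<ge> 2"
  obtains C where "C > 0" "\<And>l. 1 \<le> l \<Longrightarrow>
    (\<integral>\<^sup>+\<omega>. ennreal (\<bar>coupling_fine M F N d \<sigma> B Bt T x \<phi> l \<omega> - coupling_coarse M F N d \<sigma> B Bt T x \<phi> l \<omega>\<bar> powr p) \<partial>M)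
      \<le> ennreal (C * step_size T (l - 1) powr p)"
proof -
  obtain K1 where K1: "K1 \<ge> 0" "\<And>a b. norm ((1/2) *\<^sub>R (\<phi> a + \<phi> b) - \<phi> ((1/2) *\<^sub>R (a + b))) \<le> K1 * (norm (a - b))\<^sup>2"
    using Cb_2_midpoint[OF \<phi>] by metis
  have "bdd_lip \<phi>" using \<phi> Cb_Suc_0_bdd_lip[of 1 \<phi>] by (simp add: numeral_2_eq_2)
  then obtain K2 where K2: "K2 \<ge> 0" "\<And>a b. norm (\<phi> a - \<phi> b) \<le> K2 * norm (a - b)" by (metis bdd_lipE)
  define K where "K = max K1 K2"
  have K: "K \<ge> 0" "K1 \<le> K" "K2 \<le> K" using K1 by (auto simp: K_def)
  \<comment> \<open>an even exponent \<open>2 * m\<close> above \<open>p\<close>\<close>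
  define m where "m = nat \<lceil>p\<rceil>"
  have m: "m > 0" "p \<le> real (2 * m)" using p by (auto simp: m_def) linarith+
  obtain C where C: "C \<ge> 0"
    "\<And>h k. 0 < h \<Longrightarrow> real k * h \<le> T \<Longrightarrow> (\<integral>\<^sup>+\<omega>. ennreal (norm (mean_gap (states h x k \<omega>)) ^ (2*m)) \<partial>M) \<le> ennreal (C * h ^ (2*m))"
    "\<And>h k. 0 < h \<Longrightarrow> real k * h \<le> T \<Longrightarrow>
      (\<integral>\<^sup>+\<omega>. ennreal ((h + (norm (fine_gap (states h x k \<omega>)))\<^sup>2 + (norm (coarse_gap (states h x k \<omega>)))\<^sup>2) ^ (2*m)) \<partial>M) \<le> ennreal (C * h ^ (2*m))"
    by (rule mean_gap_moments[OF m(1), where x=x]) blast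
  define C' where "C' = K ^ (2*m) * (2 ^ (2*m) * (C + C))"
  have C': "C' \<ge> 0" using K(1) C(1) by (simp add: C'_def)
  let ?diff = "\<lambda>l \<omega>. coupling_fine M F N d \<sigma> B Bt T x \<phi> l \<omega> - coupling_coarse M F N d \<sigma> B Bt T x \<phi> l \<omega>"
  show ?thesis
  proof (rule that[of "1 + C'"])
    show "0 < 1 + C'" using C' by simp
    fix l :: nat assume l: "1 \<le> l"
    define h where "h = step_size T (l - 1)"
    define k :: nat where "k = 2 ^ (l - 1)"
    have h: "0 < h" "real k * h \<le> T" using T by (auto simp: h_def k_def step_size_def)
    define D where "D \<omega> = norm (mean_gap (states h x k \<omega>))" for \<omega>
    define E where "E \<omega> = h + (norm (fine_gap (states h x k \<omega>)))\<^sup>2 + (norm (coarse_gap (states h x k \<omega>)))\<^sup>2" for \<omega>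
    have S: "states h x k \<in> borel_measurable M"
      using h by (intro measurable_from_subalg[OF subalgebra_window states_measurable]) auto
    note gm[measurable] = measurable_compose[OF S gap_measurable(1)] measurable_compose[OF S gap_measurable(2)] measurable_compose[OF S gap_measurable(3)]
    have [measurable]: "D \<in> borel_measurable M" "E \<in> borel_measurable M"
      unfolding D_def[abs_def] E_def[abs_def] by measurable
    have DE: "0 \<le> D \<omega>" "0 \<le> E \<omega>" for \<omega> using h by (auto simp: D_def E_def)
    have "AE \<omega> in M. \<bar>?diff l \<omega>\<bar> \<le> K * (D \<omega> + E \<omega>)"
      using states_eq_schemes[OF h(1), of x]
    proof eventually_elim
      case (elim \<omega>)
      obtain f f' c c' where y: "states h x k \<omega> = (f, f', c, c')" by (metis surj_pair)
      have P: "coupling_fine M F N d \<sigma> B Bt T x \<phi> l \<omega> = (1/2) *\<^sub>R (\<phi> f + \<phi> f')"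
        "coupling_coarse M F N d \<sigma> B Bt T x \<phi> l \<omega> = (1/2) *\<^sub>R (\<phi> c + \<phi> c')"
        using elim[rule_format, of k] y unfolding coupling_fine_def coupling_coarse_def h_def[symmetric] k_def[symmetric] by auto
      have "\<bar>(1/2) *\<^sub>R (\<phi> f + \<phi> f') - (1/2) *\<^sub>R (\<phi> c + \<phi> c')\<bar>
        \<le> norm ((1/2) *\<^sub>R (\<phi> f + \<phi> f') - \<phi> ((1/2) *\<^sub>R (f + f'))) + norm ((1/2) *\<^sub>R (\<phi> c + \<phi> c') - \<phi> ((1/2) *\<^sub>R (c + c')))
          + norm (\<phi> ((1/2) *\<^sub>R (f + f')) - \<phi> ((1/2) *\<^sub>R (c + c')))"
        unfolding real_norm_def by linarith
      also have "\<dots> \<le> K1 * (norm (f - f'))\<^sup>2 + K1 * (norm (c - c'))\<^sup>2 + K2 * norm ((1/2) *\<^sub>R (f + f') - (1/2) *\<^sub>R (c + c'))"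
        by (intro add_mono K1(2) K2(2))
      also have "\<dots> \<le> K * (norm (f - f'))\<^sup>2 + K * (norm (c - c'))\<^sup>2 + K * norm ((1/2) *\<^sub>R (f + f') - (1/2) *\<^sub>R (c + c'))"
        using K by (intro add_mono mult_right_mono) auto
      also have "\<dots> = K * (D \<omega> + E \<omega>) - K * h"
        by (simp add: D_def E_def y mean_gap_def fine_gap_def coarse_gap_def algebra_simps)
      also have "\<dots> \<le> K * (D \<omega> + E \<omega>)" using K(1) h(1) by simp
      finally show ?case unfolding P .
    qed
    then have "(\<integral>\<^sup>+\<omega>. ennreal (\<bar>?diff l \<omega>\<bar> powr p) \<partial>M)
      \<le> (\<integral>\<^sup>+\<omega>. ennreal (h powr p) + ennreal (h powr (p - real (2*m)) * K ^ (2*m) * 2 ^ (2*m)) * (ennreal (D \<omega> ^ (2*m)) + ennreal (E \<omega> ^ (2*m))) \<partial>M)"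
    proof (intro nn_integral_mono_AE, eventually_elim)
      case (elim \<omega>)
      let ?X = "\<bar>?diff l \<omega>\<bar>"
      have "?X powr p \<le> (K * (D \<omega> + E \<omega>)) powr p" using elim p by (intro powr_mono2) auto
      also have "\<dots> \<le> h powr p + h powr (p - real (2*m)) * (K * (D \<omega> + E \<omega>)) ^ (2*m)"
        using h p m DE[of \<omega>] K(1) by (intro powr_le_interpolation) auto
      also have "\<dots> \<le> h powr p + h powr (p - real (2*m)) * (K ^ (2*m) * (2 ^ (2*m) * (D \<omega> ^ (2*m) + E \<omega> ^ (2*m))))"
        unfolding power_mult_distrib[of K] using DE[of \<omega>] K(1)
        by (intro add_left_mono mult_left_mono power_add_le) auto
      finally have "ennreal (?X powr p) \<le> ennreal (h powr p + h powr (p - real (2*m)) * K ^ (2*m) * 2 ^ (2*m) * (D \<omega> ^ (2*m) + E \<omega> ^ (2*m)))"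
        by (intro ennreal_leI) (simp only: mult.assoc)
      also have "\<dots> = ennreal (h powr p) + ennreal (h powr (p - real (2*m)) * K ^ (2*m) * 2 ^ (2*m)) * (ennreal (D \<omega> ^ (2*m)) + ennreal (E \<omega> ^ (2*m)))"
      proof -
        have "0 \<le> D \<omega> ^ (2*m)" "0 \<le> E \<omega> ^ (2*m)" "0 \<le> h powr (p - real (2*m)) * K ^ (2*m) * 2 ^ (2*m)" "0 \<le> h powr p"
          using DE[of \<omega>] K(1) by auto
        then show ?thesis by (simp only: ennreal_mult' ennreal_plus mult_nonneg_nonneg add_nonneg_nonneg)
      qed
      finally show ?case .
    qed
    also have "\<dots> = ennreal (h powr p) + ennreal (h powr (p - real (2*m)) * K ^ (2*m) * 2 ^ (2*m)) *
      ((\<integral>\<^sup>+\<omega>. ennreal (D \<omega> ^ (2*m)) \<partial>M) + (\<integral>\<^sup>+\<omega>. ennreal (E \<omega> ^ (2*m)) \<partial>M))"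
      by (simp add: nn_integral_add nn_integral_cmult emeasure_space_1)
    also have "\<dots> \<le> ennreal (h powr p) + ennreal (h powr (p - real (2*m)) * K ^ (2*m) * 2 ^ (2*m)) * (ennreal (C * h ^ (2*m)) + ennreal (C * h ^ (2*m)))"
      unfolding D_def E_def by (intro add_left_mono mult_left_mono add_mono C(2,3) h) auto
    also have "\<dots> = ennreal (h powr p + h powr (p - real (2*m)) * K ^ (2*m) * 2 ^ (2*m) * (C * h ^ (2*m) + C * h ^ (2*m)))"
    proof -
      have "0 \<le> C * h ^ (2*m)" "0 \<le> h powr (p - real (2*m)) * K ^ (2*m) * 2 ^ (2*m)" "0 \<le> h powr p"
        using C(1) K(1) h(1) by auto
      then show ?thesis by (simp only: ennreal_mult' ennreal_plus mult_nonneg_nonneg add_nonneg_nonneg)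
    qed
    also have "h powr p + h powr (p - real (2*m)) * K ^ (2*m) * 2 ^ (2*m) * (C * h ^ (2*m) + C * h ^ (2*m)) = (1 + C') * h powr p"
    proof -
      have "h powr (p - real (2*m)) * h ^ (2*m) = h powr p"
        using h(1) by (simp add: powr_diff flip: powr_realpow)
      then have "h powr (p - real (2*m)) * K ^ (2*m) * 2 ^ (2*m) * (C * h ^ (2*m) + C * h ^ (2*m)) = C' * h powr p"
        unfolding C'_def by (simp add: algebra_simps)
      then show ?thesis by (simp add: algebra_simps)
    qed
    finally show "(\<integral>\<^sup>+\<omega>. ennreal (\<bar>?diff l \<omega>\<bar> powr p) \<partial>M)
      \<le> ennreal ((1 + C') * step_size T (l - 1) powr p)" unfolding h_def .
  qed
qed

end

theorem corollary2p1:
  fixes M :: "'w measure" and F :: "real \<Rightarrow> 'w measure"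
    and B Bt :: "nat \<Rightarrow> real \<Rightarrow> 'w \<Rightarrow> real"
    and \<sigma> :: "nat \<Rightarrow> real^'n::finite \<Rightarrow> real^'n"
    and S :: "'n set" and N\<^sub>S N\<^sub>R d :: nat
    and x :: "real^'n" and T :: real and \<phi> :: "real^'n \<Rightarrow> real"
  assumes "T > 0" and "d \<ge> 1"
    and "card S = N\<^sub>S" and "card (- S) = N\<^sub>R" and "N\<^sub>R \<ge> 1"
    and "prob_space M" and "filtered M F"
    and "brownian_motion M F {1..d} B"
    and "brownian_motion M F {2..d} Bt"
    and "prob_space.indep_set M
           (generated_events M ({1..d} \<times> {0..}) (\<lambda>(j, t). B j t))
           (generated_events M ({2..d} \<times> {0..}) (\<lambda>(j, t). Bt j t))"
    and "\<And>j z i. j \<in> {1..d} \<Longrightarrow> i \<in> S \<Longrightarrow> \<sigma> j z $ i = 0"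
    and "\<And>j. j \<in> {0..d} \<Longrightarrow> Cb_inf (\<sigma> j)"
    and "span_condition S d \<sigma>"
    and "Cb 2 \<phi>"
  shows "\<forall>p::real. p \<ge> 2 \<longrightarrow> (\<exists>C>0. \<forall>L l::nat. 1 \<le> l \<and> l \<le> L \<longrightarrow>
    (\<integral>\<^sup>+\<omega>. ennreal (\<bar>coupling_fine M F N\<^sub>S d \<sigma> B Bt T x \<phi> l \<omega>
                   - coupling_coarse M F N\<^sub>S d \<sigma> B Bt T x \<phi> l \<omega>\<bar> powr p) \<partial>M)
      \<le> ennreal (C * step_size T (l - 1) powr p))"
proof (intro allI impI)
  interpret prob_space M by fact
  interpret antithetic_schemes M F B Bt d \<sigma> N\<^sub>S T
    by unfold_locales (use assms in auto)
  fix p :: real assume p: "p \<ge> 2"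
  obtain C where "C > 0" "\<And>l. 1 \<le> l \<Longrightarrow>
    (\<integral>\<^sup>+\<omega>. ennreal (\<bar>coupling_fine M F N\<^sub>S d \<sigma> B Bt T x \<phi> l \<omega>
                   - coupling_coarse M F N\<^sub>S d \<sigma> B Bt T x \<phi> l \<omega>\<bar> powr p) \<partial>M)
      \<le> ennreal (C * step_size T (l - 1) powr p)"
    by (rule coupling_bound[OF \<open>Cb 2 \<phi>\<close> p, where x=x]) blast
  then show "\<exists>C>0. \<forall>L l::nat. 1 \<le> l \<and> l \<le> L \<longrightarrow>
    (\<integral>\<^sup>+\<omega>. ennreal (\<bar>coupling_fine M F N\<^sub>S d \<sigma> B Bt T x \<phi> l \<omega>
                   - coupling_coarse M F N\<^sub>S d \<sigma> B Bt T x \<phi> l \<omega>\<bar> powr p) \<partial>M)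
      \<le> ennreal (C * step_size T (l - 1) powr p)" by blast
qed

end
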